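(* Let $B$ be a fractional Brownian motion with Hurst index $H$, fix an integer $q\geq2$ and assume $H<1-\frac{1}{2q}$. Let $\rho(x)=\frac12(|x+1|^{2H}+|x-1|^{2H}-2|x|^{2H})$, $\sigma=\sqrt{q!\sum_{r\in\mathbb{Z}}\rho^2(r)}$ and $$S_n(t)=\frac{1}{\sigma\sqrt n}\sum_{k=0}^{\lfloor nt\rfloor-1}H_q(B_{k+1}-B_k),\qquad t\geq0.$$ For any fixed $d\geq1$ and $0=t_0<t_1<\dots<t_d$, there exists a constant $c$ depending only on $d$, $H$ and $(t_0,\dots,t_d)$ (and not on $n$) such that for every $n\geq1$, $$d_{\rm W}\Big(\Big(\tfrac{S_n(t_i)-S_n(t_{i-1})}{\sqrt{t_i-t_{i-1}}}\Big)_{1\leq i\leq d};\mathscr{N}_d(0,\mathbf{I}_d)\Big)\leq c\times\begin{cases}n^{-1/2}&\text{if }H\in(0,\tfrac12],\\ n^{H-1}&\text{if }H\in(\tfrac12,\tfrac{2q-3}{2q-2}],\\ n^{qH-q+\frac12}&\text{if }H\in(\tfrac{2q-3}{2q-2},\tfrac{2q-1}{2q}).\end{cases}$$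
   Context: A fractional Brownian motion $B=\{B_t:t\geq0\}$ with Hurst index $H\in(0,1)$ is a centered Gaussian process with $B_0=0$ and covariance $E[B_sB_t]=\frac12(t^{2H}+s^{2H}-|t-s|^{2H})$. $H_q(x)=(-1)^qe^{x^2/2}\frac{d^q}{dx^q}e^{-x^2/2}$ is the $q$th Hermite polynomial. $d_{\rm W}$ denotes the Wasserstein distance between the law of the given $\mathbb{R}^d$-valued vector and the standard Gaussian law $\mathscr{N}_d(0,\mathbf{I}_d)$: $d_{\rm W}(X,Y)=\sup\{|Eg(X)-Eg(Y)|:g:\mathbb{R}^d\to\mathbb{R},\ \|g\|_{Lip}\leq1\}$.
   Formalization: The normalisation proved is σ = sqrt(q! Σ ρ^q(r)) instead of sqrt(q! Σ ρ^2(r)); the two agree for q=2 or H=1/2, but otherwise the printed σ is infinite or gives a limit variance different from 1, so the bound fails. The constant c may also depend on the fixed q. *)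

theory Defs
  imports "HOL-Probability.Probability"
begin

definition fbm_cov :: "real \<Rightarrow> real \<Rightarrow> real \<Rightarrow> real" where
  "fbm_cov H s t = (s powr (2*H) + t powr (2*H) - \<bar>t - s\<bar> powr (2*H)) / 2"

definition centered_gaussian_rv :: "'a measure \<Rightarrow> ('a \<Rightarrow> real) \<Rightarrow> real \<Rightarrow> bool" where
  "centered_gaussian_rv M X v \<longleftrightarrow>
     (if v = 0 then X \<in> borel_measurable M \<and> (AE \<omega> in M. X \<omega> = 0)
      else distributed M lborel X (normal_density 0 (sqrt v)))"

definition is_fbm :: "'a measure \<Rightarrow> real \<Rightarrow> (real \<Rightarrow> 'a \<Rightarrow> real) \<Rightarrow> bool" where
  "is_fbm M H B \<longleftrightarrow> prob_space M \<and> 0 < H \<and> H < 1 \<and>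
     (\<forall>t\<ge>0. B t \<in> borel_measurable M) \<and>
     (AE \<omega> in M. B 0 \<omega> = 0) \<and>
     (\<forall>(m::nat) (ts::nat \<Rightarrow> real) (c::nat \<Rightarrow> real). (\<forall>i<m. ts i \<ge> 0) \<longrightarrow>
        centered_gaussian_rv M (\<lambda>\<omega>. \<Sum>i<m. c i * B (ts i) \<omega>)
          (\<Sum>i<m. \<Sum>j<m. c i * c j * fbm_cov H (ts i) (ts j)))"

definition hermite :: "nat \<Rightarrow> real \<Rightarrow> real" where
  "hermite q x = (-1)^q * exp (x^2 / 2) * (deriv ^^ q) (\<lambda>y. exp (- (y^2) / 2)) x"

definition rho_fbm :: "real \<Rightarrow> real \<Rightarrow> real" where
  "rho_fbm H x = (\<bar>x + 1\<bar> powr (2*H) + \<bar>x - 1\<bar> powr (2*H) - 2 * \<bar>x\<bar> powr (2*H)) / 2"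

definition sigma_fbm :: "real \<Rightarrow> nat \<Rightarrow> real" where
  "sigma_fbm H q = sqrt (fact q * (\<Sum>\<^sub>\<infinity>r::int. (rho_fbm H (real_of_int r)) ^ q))"

definition S_fbm :: "real \<Rightarrow> nat \<Rightarrow> (real \<Rightarrow> 'a \<Rightarrow> real) \<Rightarrow> nat \<Rightarrow> real \<Rightarrow> 'a \<Rightarrow> real" where
  "S_fbm H q B n t \<omega> = 1 / (sigma_fbm H q * sqrt (real n)) *
     (\<Sum>k<nat \<lfloor>real n * t\<rfloor>. hermite q (B (real k + 1) \<omega> - B (real k) \<omega>))"

text \<open>Vectors of R^d are represented as extensional functions on {..<d} (index i stands for
  coordinate i+1). Standard Gaussian law on R^d and 1-Lipschitz functions w.r.t. Euclidean norm.\<close>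
definition std_gauss :: "nat \<Rightarrow> (nat \<Rightarrow> real) measure" where
  "std_gauss d = PiM {..<d} (\<lambda>_. density lborel std_normal_density)"

definition lip1 :: "nat \<Rightarrow> ((nat \<Rightarrow> real) \<Rightarrow> real) \<Rightarrow> bool" where
  "lip1 d g \<longleftrightarrow> (\<forall>x\<in>PiE {..<d} (\<lambda>_. UNIV). \<forall>y\<in>PiE {..<d} (\<lambda>_. UNIV).
       \<bar>g x - g y\<bar> \<le> sqrt (\<Sum>i<d. (x i - y i)^2))"

definition dW_std :: "'a measure \<Rightarrow> nat \<Rightarrow> ('a \<Rightarrow> nat \<Rightarrow> real) \<Rightarrow> ereal" where
  "dW_std M d X = (SUP g\<in>{g. lip1 d g}.
      ereal \<bar>(\<integral>\<omega>. g (X \<omega>) \<partial>M) - (\<integral>x. g x \<partial>std_gauss d)\<bar>)"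

definition rate_fbm :: "real \<Rightarrow> nat \<Rightarrow> nat \<Rightarrow> real" where
  "rate_fbm H q n =
     (if H \<le> 1/2 then real n powr (-1/2)
      else if H \<le> (2 * real q - 3) / (2 * real q - 2) then real n powr (H - 1)
      else real n powr (real q * H - real q + 1/2))"

end

theory Submission
  imports Defs
begin

text \<open>
  The increments \<open>X\<^sub>k = B\<^sub>k\<^sub>+\<^sub>1 - B\<^sub>k\<close> form a stationary Gaussian sequence with covariance
  \<open>\<rho>(k - l)\<close>. Put \<open>p = q - 1\<close> and let \<open>F\<^sub>i = s\<^sub>i \<Sum>k\<in>I\<^sub>i. H\<^sub>q(X\<^sub>k)\<close> be the normalized increments of \<open>S\<^sub>n\<close>.
  Gaussian integration by parts gives \<open>E[F\<^sub>i h(F)] = \<Sum>j. E[W\<^sub>i\<^sub>j \<partial>\<^sub>j h(F)]\<close> with the kernel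
  \<open>W\<^sub>i\<^sub>j = s\<^sub>i s\<^sub>j q \<Sum>k\<in>I\<^sub>i. \<Sum>l\<in>I\<^sub>j. \<rho>(k - l) H\<^sub>p(X\<^sub>k) H\<^sub>p(X\<^sub>l)\<close>. For an independent standard
  Gaussian vector \<open>Z\<close>, differentiating \<open>\<theta> \<mapsto> E g(F sin \<theta> + Z cos \<theta>)\<close> and moving one derivative onto
  \<open>Z\<close> yields \<open>sin \<theta> \<Sum>i j. E[(W\<^sub>i\<^sub>j - \<delta>\<^sub>i\<^sub>j) \<partial>\<^sub>i g(F sin \<theta> + Z cos \<theta>) Z\<^sub>j]\<close>, so the Wasserstein distance is at
  most \<open>\<pi>/2 \<Sum>i j. E|W\<^sub>i\<^sub>j - \<delta>\<^sub>i\<^sub>j|\<close>. All these identities are needed only for trigonometric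
  polynomials \<open>g\<close>, where they reduce to statements about characteristic functions; a Lipschitz
  function is approximated by trigonometric polynomials with almost the same gradient bound.

  The mean of \<open>W\<^sub>i\<^sub>j\<close> is controlled by tails of \<open>\<Sum> \<rho>\<^sup>q\<close>. The variance is a sum over Feynman diagrams on
  four vertices, each of which is dominated by four-cycles with edge weights \<open>\<rho>, \<rho>\<^sup>p, \<rho>, \<rho>\<^sup>p\<close>. Opening
  the cycle at the two edges \<open>\<rho>\<close> bounds it by
  \<open>N (\<Sum>\<bar>r\<bar><N. \<rho>(r)\<^sup>2) (\<Sum>\<bar>r\<bar><N. \<bar>\<rho>(r)\<bar>\<^sup>p)\<^sup>2\<close>; this choice avoids a logarithm at the boundary
  value \<open>H = (2q - 3) / (2q - 2)\<close>.
\<close>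

section \<open>Hermite polynomials\<close>

text \<open>Why a rotation: along \<open>F sin \<theta> + Z cos \<theta>\<close> the contribution of
  \<open>F\<close>, through the kernel, and that of \<open>Z\<close>, through the Gaussian formula,
  both carry \<open>sin \<theta> cos \<theta>\<close> and second derivatives of \<open>g\<close>, so
  they merge into \<open>W - \<delta>\<close>. Moving one derivative onto \<open>Z\<close> costs
  \<open>1 / cos \<theta>\<close>, which cancels exactly: only the gradient of \<open>g\<close>
  remains, with no singularity at \<open>\<theta> = pi / 2\<close>. The length of this interval is
  the factor \<open>pi / 2\<close>. The obstacle at the other end is that a trigonometric polynomial
  uniformly close to a Lipschitz function may have a wild gradient. Gaussian smoothing repairs this
  and keeps it a trigonometric polynomial. As to the exponents: sums of \<open>\<rho>^2\<close> and
  \<open>|\<rho>|^p\<close> may grow logarithmically only in the middle range of \<open>H\<close>.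
  There the target \<open>n^(H-1)\<close> is larger than what the four-cycle yields, so a small
  power absorbs every logarithm. Below that range the sums are bounded, above it they are bounded or
  genuine powers.\<close>

lemma hermite_density:
  "(deriv ^^ q) (\<lambda>y::real. exp (- (y^2) / 2)) x = (-1)^q * hermite q x * exp (- (x^2) / 2)"
proof -
  have "exp (x\<^sup>2 / 2) * exp (- (x\<^sup>2) / 2) = 1"
    by (simp flip: exp_add)
  moreover have "(-1::real)^q * (-1)^q = 1"
    by (simp flip: power_add add: mult_2[symmetric])
  ultimately show ?thesis
    unfolding hermite_def by (metis (no_types, lifting) mult.assoc mult.commute mult_1_left)
qed

lemma hermite_0 [simp]: "hermite 0 x = 1"
  by (simp add: hermite_def flip: exp_add)

text \<open>The two claims need each other: the derivative in degree \<open>n\<close> comes from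
  differentiating the recursion one index below, and the recursion for \<open>n + 1\<close> from
  differentiating \<open>(-1)^n H_n(x) exp (-x^2/2)\<close>, which is an \<open>n\<close>-th
  derivative by definition. At \<open>n = 0\<close> the truncated \<open>n - 1\<close> is harmless,
  its factor being \<open>0\<close>.\<close>

lemma hermite_deriv_and_recursion:
  "(hermite n has_real_derivative real n * hermite (n - 1) x) (at x)
   \<and> hermite (Suc n) x = x * hermite n x - real n * hermite (n - 1) x"
proof (induction n arbitrary: x rule: less_induct)
  case (less n)
  have d: "(hermite n has_real_derivative real n * hermite (n - 1) x) (at x)" for x
  proof (cases n)
    case 0
    then show ?thesis by (simp add: hermite_0[abs_def])
  next
    case (Suc m)
    have eq: "hermite n = (\<lambda>x. x * hermite m x - real m * hermite (m - 1) x)"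
      using less[of m] Suc by auto
    have dm: "(hermite m has_real_derivative real m * hermite (m - 1) x) (at x)"
      using less[of m x] Suc by auto
    have dj: "(hermite (m - 1) has_real_derivative real (m - 1) * hermite (m - 1 - 1) x) (at x)"
      using less[of "m - 1" x] Suc by simp
    have rj: "real m * hermite m x = real m * (x * hermite (m - 1) x - real (m - 1) * hermite (m - 1 - 1) x)"
      using less[of "m - 1" x] Suc by (cases m) auto
    show ?thesis unfolding eq
      by (rule derivative_eq_intros dm dj refl)+ (use Suc rj in \<open>simp add: algebra_simps\<close>)
  qed
  have "((\<lambda>y. (-1)^n * hermite n y * exp (- (y^2) / 2)) has_real_derivative
      (-1)^n * (real n * hermite (n - 1) x - x * hermite n x) * exp (- (x^2) / 2)) (at x)"
    by (auto intro!: derivative_eq_intros d simp: algebra_simps)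
  moreover have "(\<lambda>y. (-1)^n * hermite n y * exp (- (y^2) / 2)) =
      (deriv ^^ n) (\<lambda>y::real. exp (- (y^2) / 2))"
    using hermite_density by presburger
  ultimately have "((deriv ^^ n) (\<lambda>y::real. exp (- (y^2) / 2)) has_real_derivative
      (-1)^n * (real n * hermite (n - 1) x - x * hermite n x) * exp (- (x^2) / 2)) (at x)"
    by metis
  then have "(deriv ^^ Suc n) (\<lambda>y::real. exp (- (y^2) / 2)) x =
      (-1)^n * (real n * hermite (n - 1) x - x * hermite n x) * exp (- (x^2) / 2)"
    by (simp only: funpow.simps o_apply DERIV_imp_deriv)
  then have "(-1)^Suc n * hermite (Suc n) x * exp (- (x^2) / 2) =
      (-1)^n * (real n * hermite (n - 1) x - x * hermite n x) * exp (- (x^2) / 2)"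
    by (simp only: hermite_density)
  then have "((-1)^n * exp (- (x^2) / 2)) * (- hermite (Suc n) x) =
      ((-1)^n * exp (- (x^2) / 2)) * (real n * hermite (n - 1) x - x * hermite n x)"
    by (simp only: power_Suc mult_minus1 mult_minus_left mult_minus_right mult_ac)
  then have "- hermite (Suc n) x = real n * hermite (n - 1) x - x * hermite n x"
    by (subst (asm) mult_left_cancel) auto
  then have "hermite (Suc n) x = x * hermite n x - real n * hermite (n - 1) x"
    by simp
  then show ?case using d by blast
qed

lemma hermite_deriv:
  "(hermite n has_real_derivative real n * hermite (n - 1) x) (at x)"
  using hermite_deriv_and_recursion by blast

lemma hermite_Suc: "hermite (Suc n) x = x * hermite n x - real n * hermite (n - 1) x"
  using hermite_deriv_and_recursion by blast

lemma isCont_hermite: "isCont (hermite n) x"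
  using hermite_deriv DERIV_isCont by blast

lemma continuous_on_hermite [continuous_intros]:
  "continuous_on A f \<Longrightarrow> continuous_on A (\<lambda>x. hermite n (f x))"
  by (rule continuous_on_compose2[of UNIV "hermite n"])
     (auto intro: continuous_at_imp_continuous_on isCont_hermite)

lemma hermite_measurable [measurable]: "hermite n \<in> borel_measurable borel"
  by (intro borel_measurable_continuous_onI continuous_on_hermite continuous_on_id)

lemma hermite_growth: "\<exists>C\<ge>0. \<forall>x. \<bar>hermite n x\<bar> \<le> C * (1 + \<bar>x\<bar>) ^ n"
proof (induction n rule: less_induct)
  case (less n)
  show ?case
  proof (cases n)
    case 0
    then show ?thesis by (intro exI[of _ 1]) auto
  next
    case (Suc m)
    have lt: "m - 1 < n" using Suc by simp
    obtain C where C: "C \<ge> 0" "\<And>x. \<bar>hermite m x\<bar> \<le> C * (1 + \<bar>x\<bar>) ^ m"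
      using less[of m] Suc by auto
    obtain D where D: "D \<ge> 0" "\<And>x. \<bar>hermite (m - 1) x\<bar> \<le> D * (1 + \<bar>x\<bar>) ^ (m - 1)"
      using less[of "m - 1", OF lt] by auto
    have "\<bar>hermite n x\<bar> \<le> (C + real m * D) * (1 + \<bar>x\<bar>) ^ n" for x
    proof -
      have "\<bar>hermite n x\<bar> \<le> \<bar>x\<bar> * \<bar>hermite m x\<bar> + real m * \<bar>hermite (m - 1) x\<bar>"
        unfolding Suc hermite_Suc by (metis abs_mult abs_of_nat abs_triangle_ineq4)
      also have "\<dots> \<le> (1 + \<bar>x\<bar>) * (C * (1 + \<bar>x\<bar>) ^ m) + real m * (D * (1 + \<bar>x\<bar>) ^ n)"
      proof (intro add_mono mult_mono order.refl)
        have "(1 + \<bar>x\<bar>) ^ (m - 1) \<le> (1 + \<bar>x\<bar>) ^ n"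
          using Suc by (intro power_increasing) auto
        then show "\<bar>hermite (m - 1) x\<bar> \<le> D * (1 + \<bar>x\<bar>) ^ n"
          using D(1) D(2)[of x] by (meson mult_left_mono order_trans)
      qed (use C in auto)
      finally show ?thesis using Suc by (simp add: algebra_simps)
    qed
    then show ?thesis using C(1) D(1) by (intro exI[of _ "C + real m * D"]) auto
  qed
qed

section \<open>Correlations of fractional Gaussian noise\<close>

text \<open>For \<open>\<kappa> < 1\<close>, raising the exponent from \<open>-s\<close> to
  \<open>\<kappa> - 1\<close> lets the sum telescope against \<open>N^\<kappa>\<close>. Insisting on
  \<open>\<kappa> > 0\<close> is what swallows the logarithm at \<open>s = 1\<close>.\<close>

lemma powr_partial_sum_bound:
  assumes "\<kappa> > 0" "\<kappa> \<ge> 1 - s"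
  shows "\<exists>C\<ge>0. \<forall>N. (\<Sum>r=1..N. real r powr (-s)) \<le> C * real N powr \<kappa>"
proof -
  have mono: "(\<Sum>r=1..N. real r powr (-s)) \<le> (\<Sum>r=1..N. real r powr (\<kappa> - 1))" for N
    using assms by (intro sum_mono powr_mono) auto
  show ?thesis
  proof (cases "\<kappa> \<ge> 1")
    case True
    have "(\<Sum>r=1..N. real r powr (\<kappa> - 1)) \<le> 1 * real N powr \<kappa>" for N
    proof -
      have "(\<Sum>r=1..N. real r powr (\<kappa> - 1)) \<le> (\<Sum>r=1..N. real N powr (\<kappa> - 1))"
        using True by (intro sum_mono powr_mono2) auto
      also have "\<dots> = real N powr \<kappa>"
        by (cases "N = 0") (simp_all add: powr_diff)
      finally show ?thesis by simp
    qed
    then show ?thesis using mono by (intro exI[of _ 1]) (meson order_trans zero_le_one)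
  next
    case False
    have "(\<Sum>r=1..N. real r powr (\<kappa> - 1)) \<le> 1 / \<kappa> * real N powr \<kappa>" for N
    proof (induction N)
      case (Suc N)
      have "\<kappa> * real (Suc N) powr (\<kappa> - 1) \<le> real (Suc N) powr \<kappa> - real N powr \<kappa>"
      proof (cases "N = 0")
        case False
        then have N: "real N > 0" by simp
        have "\<exists>z>real N. z < real (Suc N) \<and>
            real (Suc N) powr \<kappa> - real N powr \<kappa> = (real (Suc N) - real N) * (\<kappa> * z powr (\<kappa> - 1))"
          using N by (intro MVT2) (auto intro!: derivative_eq_intros)
        then obtain z where z: "z > real N" "z < real (Suc N)"
          "real (Suc N) powr \<kappa> - real N powr \<kappa> = \<kappa> * z powr (\<kappa> - 1)" by auto
        have "real (Suc N) powr (\<kappa> - 1) \<le> z powr (\<kappa> - 1)"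
          using z N \<open>\<not> \<kappa> \<ge> 1\<close> by (intro powr_mono2') auto
        then show ?thesis using z(3) assms(1) by (simp add: mult_left_mono)
      qed (use \<open>\<not> \<kappa> \<ge> 1\<close> in simp)
      then have "real (Suc N) powr (\<kappa> - 1) \<le> 1 / \<kappa> * (real (Suc N) powr \<kappa> - real N powr \<kappa>)"
        using assms(1) by (simp add: field_simps)
      then show ?case using Suc by (simp add: algebra_simps)
    qed simp
    then show ?thesis using mono assms(1) by (intro exI[of _ "1 / \<kappa>"]) (auto intro: order_trans)
  qed
qed

lemma powr_partial_sum_bounded:
  assumes "s > 1"
  shows "\<exists>C\<ge>0. \<forall>N. (\<Sum>r=1..N. real r powr (-s)) \<le> C"
proof -
  have sm: "summable (\<lambda>n. real n powr (-s))" using assms by (subst summable_real_powr_iff) simp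
  have "(\<Sum>r=1..N. real r powr (-s)) \<le> (\<Sum>n. real n powr (-s))" for N
    by (rule sum_le_suminf[OF sm]) auto
  moreover have "(\<Sum>n. real n powr (-s)) \<ge> 0" by (rule suminf_nonneg[OF sm]) auto
  ultimately show ?thesis by blast
qed

text \<open>Split \<open>s = u + (s - u)\<close> with \<open>s - u > 1\<close>: the first factor is
  frozen at the start of the tail and gives the rate, the second stays summable. The loss against
  the true rate \<open>s - 1\<close> is as small as desired, which suffices because the later
  conditions on exponents are strict.\<close>

lemma powr_tail_bound:
  fixes e :: "nat \<Rightarrow> real"
  assumes "C \<ge> 0" "u > 0" "s > 1 + u" "\<And>n. \<bar>e n\<bar> \<le> C * real (Suc n) powr (-s)"
  shows "summable e" "\<exists>D\<ge>0. \<forall>A. \<bar>suminf e - (\<Sum>n<A. e n)\<bar> \<le> D * real (Suc A) powr (-u)"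
proof -
  have sm: "summable (\<lambda>n. real (Suc n) powr (-v))" if "v > 1" for v
    using that by (subst summable_Suc_iff) (simp add: summable_real_powr_iff)
  have sa: "summable (\<lambda>n. \<bar>e n\<bar>)"
    using assms by (intro summable_comparison_test'[OF summable_mult[OF sm[of s], of C]]) auto
  show se: "summable e" by (rule summable_rabs_cancel[OF sa])
  let ?v = "s - u"
  have v: "?v > 1" using assms by simp
  let ?Z = "\<Sum>n. real (Suc n) powr (-?v)"
  have Z: "?Z \<ge> 0" by (intro suminf_nonneg sm v) auto
  have "\<bar>suminf e - (\<Sum>n<A. e n)\<bar> \<le> (C * ?Z) * real (Suc A) powr (-u)" for A
  proof -
    have "suminf e - (\<Sum>n<A. e n) = (\<Sum>n. e (n + A))"
      using suminf_split_initial_segment[OF se, of A] by simp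
    also have "\<bar>\<dots>\<bar> \<le> (\<Sum>n. \<bar>e (n + A)\<bar>)"
      by (intro summable_rabs summable_ignore_initial_segment[OF sa])
    also have "\<dots> \<le> (\<Sum>n. C * real (Suc A) powr (-u) * real (Suc n) powr (-?v))"
    proof (intro suminf_le summable_ignore_initial_segment[OF sa] summable_mult sm v)
      fix n
      have "real (Suc (n + A)) powr (-s) = real (Suc (n + A)) powr (-u) * real (Suc (n + A)) powr (-?v)"
        by (simp flip: powr_add)
      also have "\<dots> \<le> real (Suc A) powr (-u) * real (Suc n) powr (-?v)"
        using assms v by (intro mult_mono powr_mono2') auto
      finally have "C * real (Suc (n + A)) powr (-s) \<le> C * (real (Suc A) powr (-u) * real (Suc n) powr (-?v))"
        using assms(1) by (rule mult_left_mono)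
      then show "\<bar>e (n + A)\<bar> \<le> C * real (Suc A) powr (-u) * real (Suc n) powr (-?v)"
        using assms(4)[of "n + A"] by (simp add: mult.assoc)
    qed
    also have "\<dots> = C * real (Suc A) powr (-u) * ?Z"
      by (intro suminf_mult sm v)
    finally show ?thesis by (simp add: algebra_simps)
  qed
  then show "\<exists>D\<ge>0. \<forall>A. \<bar>suminf e - (\<Sum>n<A. e n)\<bar> \<le> D * real (Suc A) powr (-u)"
    using Z assms(1) by (intro exI[of _ "C * ?Z"]) auto
qed

section \<open>The correlation function of unit increments: sign, decay, positivity of the
  variance\<close>

lemma rho_fbm_minus [simp]: "rho_fbm H (- x) = rho_fbm H x"
  by (simp add: rho_fbm_def abs_minus_commute add.commute)

lemma rho_fbm_0 [simp]: "rho_fbm H 0 = 1"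
  by (simp add: rho_fbm_def)

lemma rho_fbm_one: "rho_fbm H 1 = (2 powr (2 * H) - 2) / 2"
  by (simp add: rho_fbm_def)

text \<open>\<open>rho_fbm H\<close> is half the centred second difference of \<open>x^(2H)\<close>,
  so applying the mean value theorem twice yields half its second derivative at an intermediate
  point.\<close>

lemma rho_fbm_second_derivative:
  assumes "r \<ge> 2"
  shows "\<exists>\<eta>. r - 1 < \<eta> \<and> \<eta> < r + 1 \<and> rho_fbm H r = H * (2 * H - 1) * \<eta> powr (2 * H - 2)"
proof -
  let ?g = "\<lambda>x. (x + 1) powr (2 * H) - x powr (2 * H)"
  let ?g' = "\<lambda>x. 2 * H * (x + 1) powr (2 * H - 1) - 2 * H * x powr (2 * H - 1)"
  have "\<exists>z>r - 1. z < r \<and> ?g r - ?g (r - 1) = (r - (r - 1)) * ?g' z"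
    using assms by (intro MVT2) (auto intro!: derivative_eq_intros)
  then obtain z where z: "z > r - 1" "z < r" "?g r - ?g (r - 1) = ?g' z" by auto
  have "\<exists>w>z. w < z + 1 \<and> 2 * H * (z + 1) powr (2 * H - 1) - 2 * H * z powr (2 * H - 1) =
      (z + 1 - z) * (2 * H * ((2 * H - 1) * w powr (2 * H - 1 - 1)))"
    using assms z(1) by (intro MVT2) (auto intro!: derivative_eq_intros)
  then obtain w where w: "w > z" "w < z + 1" "?g' z = 2 * H * ((2 * H - 1) * w powr (2 * H - 2))"
    by auto
  have "rho_fbm H r = (?g r - ?g (r - 1)) / 2"
    using assms by (simp add: rho_fbm_def)
  then show ?thesis using z w by (intro exI[of _ w]) auto
qed

lemma rho_fbm_decay_le:
  assumes "0 < H" "H < 1" "r \<ge> 1"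
  shows "\<bar>rho_fbm H (real r)\<bar> \<le> 4 * real r powr (- (2 - 2 * H))"
proof (cases "r = 1")
  case True
  have "2 powr (2 * H) \<le> (2::real) powr 2" using assms by (intro powr_mono) auto
  then have "2 powr (2 * H) \<le> (4::real)" by simp
  moreover have "2 powr (2 * H) \<ge> (0::real)" by simp
  ultimately have "\<bar>2 powr (2 * H) - (2::real)\<bar> \<le> 2" by linarith
  then show ?thesis using True by (simp add: rho_fbm_one)
next
  case False
  then have r: "real r \<ge> 2" using assms by simp
  obtain \<eta> where e: "real r - 1 < \<eta>" "rho_fbm H r = H * (2 * H - 1) * \<eta> powr (2 * H - 2)"
    using rho_fbm_second_derivative[OF r] by blast
  \<comment> \<open>Here \<open>\<eta> > r - 1 \<ge> r / 2\<close> and the exponent is negative;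
    halving the base costs \<open>2^(2-2H) \<le> 4\<close>, the constant of the lemma.\<close>
  have "\<eta> powr (2 * H - 2) \<le> (real r / 2) powr (2 * H - 2)"
    using r e assms by (intro powr_mono2') auto
  also have "\<dots> = real r powr (2 * H - 2) * 2 powr (2 - 2 * H)"
    by (simp add: powr_divide powr_minus_divide flip: powr_minus)
       (metis minus_diff_eq powr_minus_divide divide_inverse mult.commute inverse_eq_divide)
  also have "\<dots> \<le> real r powr (2 * H - 2) * 2 powr 2"
    using assms by (intro mult_left_mono powr_mono) auto
  finally have "\<eta> powr (2 * H - 2) \<le> 4 * real r powr (2 * H - 2)" by simp
  moreover have "\<bar>H * (2 * H - 1)\<bar> \<le> 1"
    using assms by (simp add: abs_mult mult_le_one)
  ultimately have "\<bar>H * (2 * H - 1)\<bar> * \<eta> powr (2 * H - 2) \<le> 1 * (4 * real r powr (2 * H - 2))"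
    by (intro mult_mono) auto
  then show ?thesis using e by (simp add: abs_mult)
qed

lemma rho_fbm_half: "r \<ge> 1 \<Longrightarrow> rho_fbm (1/2) (real r) = 0"
  by (simp add: rho_fbm_def)

text \<open>At \<open>H = 1/2\<close> the correlations vanish off the diagonal and any exponent is
  admissible. The natural value \<open>2 - 2H = 1\<close> would produce a spurious logarithm, so one
  above \<open>1\<close> is taken.\<close>

definition fbm_decay :: "real \<Rightarrow> real" where
  "fbm_decay H = (if H = 1/2 then 2 else 2 - 2 * H)"

lemma rho_fbm_decay:
  assumes "0 < H" "H < 1" "r \<ge> 1"
  shows "\<bar>rho_fbm H (real r)\<bar> \<le> 4 * real r powr (- fbm_decay H)"
proof (cases "H = 1/2")
  case True
  show ?thesis using rho_fbm_half[of r] assms(3) unfolding True by simp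
next
  case False
  then show ?thesis using rho_fbm_decay_le[OF assms] by (simp add: fbm_decay_def)
qed

lemma rho_fbm_nonneg:
  assumes "1/2 \<le> H" shows "rho_fbm H (real r) \<ge> 0"
proof -
  consider "r = 0" | "r = 1" | "real r \<ge> 2" by force
  then show ?thesis
  proof cases
    case 2
    have "(2::real) powr 1 \<le> 2 powr (2 * H)" using assms by (intro powr_mono) auto
    then show ?thesis using 2 by (simp add: rho_fbm_one)
  next
    case 3
    then show ?thesis using rho_fbm_second_derivative[OF 3, of H] assms by auto
  qed auto
qed

lemma rho_fbm_nonpos:
  assumes "0 < H" "H \<le> 1/2" "r \<ge> 1" shows "rho_fbm H (real r) \<le> 0"
proof -
  consider "r = 1" | "real r \<ge> 2" using assms by force
  then show ?thesis
  proof cases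
    case 1
    have "2 powr (2 * H) \<le> (2::real) powr 1" using assms by (intro powr_mono) auto
    then show ?thesis using 1 by (simp add: rho_fbm_one)
  next
    case 2
    then show ?thesis using rho_fbm_second_derivative[OF 2, of H] assms
      by (auto simp: mult_nonneg_nonpos mult_nonpos_nonneg)
  qed
qed

lemma rho_fbm_telescope:
  "(\<Sum>n<N. rho_fbm H (real (Suc n))) = (real (Suc N) powr (2*H) - real N powr (2*H) - 1) / 2"
  by (induction N) (simp_all add: rho_fbm_def field_simps)

text \<open>This keeps the limiting variance away from \<open>0\<close>; the danger is odd
  \<open>q\<close> with \<open>H < 1/2\<close>, where all terms are negative. There the correlations
  telescope to total mass at most \<open>1/2\<close>, so each is at most \<open>1/2\<close> and the
  \<open>q\<close>-th powers sum to at most \<open>1/2 * 1/2\<close>.\<close>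

lemma rho_fbm_power_sum_ge:
  assumes "0 < H" "q \<ge> 2"
  shows "(\<Sum>n<N. rho_fbm H (real (Suc n)) ^ q) \<ge> - 1/4"
proof (cases "H \<ge> 1/2")
  case True
  then have "(\<Sum>n<N. rho_fbm H (real (Suc n)) ^ q) \<ge> 0"
    by (intro sum_nonneg zero_le_power rho_fbm_nonneg)
  then show ?thesis by simp
next
  case False
  have np: "rho_fbm H (real (Suc n)) \<le> 0" for n
    by (rule rho_fbm_nonpos) (use False assms in auto)
  have s: "(\<Sum>n<N. \<bar>rho_fbm H (real (Suc n))\<bar>) \<le> 1/2" for N
  proof -
    have "real N powr (2*H) \<le> real (Suc N) powr (2*H)" using assms by (intro powr_mono2) auto
    moreover have "(\<Sum>n<N. \<bar>rho_fbm H (real (Suc n))\<bar>) = - (\<Sum>n<N. rho_fbm H (real (Suc n)))"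
      using np by (simp add: sum_negf[symmetric] abs_of_nonpos)
    ultimately show ?thesis unfolding rho_fbm_telescope by simp
  qed
  have b: "\<bar>rho_fbm H (real (Suc n))\<bar> \<le> 1/2" for n
    using s[of "Suc n"] by (simp add: sum_nonneg) (smt (verit) abs_ge_zero sum_nonneg)
  have "\<bar>rho_fbm H (real (Suc n)) ^ q\<bar> \<le> 1/2 * \<bar>rho_fbm H (real (Suc n))\<bar>" for n
  proof -
    let ?x = "\<bar>rho_fbm H (real (Suc n))\<bar>"
    have "?x ^ q \<le> ?x ^ 2" using assms b[of n] by (intro power_decreasing) auto
    also have "\<dots> \<le> 1/2 * ?x" unfolding power2_eq_square using b[of n] by (intro mult_right_mono) auto
    finally show ?thesis by (simp add: power_abs)
  qed
  then have "(\<Sum>n<N. \<bar>rho_fbm H (real (Suc n)) ^ q\<bar>) \<le> (\<Sum>n<N. 1/2 * \<bar>rho_fbm H (real (Suc n))\<bar>)"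
    by (intro sum_mono)
  also have "\<dots> \<le> 1/4" using s[of N] by (simp flip: sum_divide_distrib)
  finally show ?thesis using sum_abs[of "\<lambda>n. rho_fbm H (real (Suc n)) ^ q" "{..<N}"] by linarith
qed

section \<open>Row sums of the Toeplitz matrix \<open>rho(k - l)\<close> and the two-sided
  series\<close>

lemma row_sum_split:
  fixes f :: "real \<Rightarrow> real" and a b k :: nat
  assumes "\<And>x. f (- x) = f x" "a \<le> k" "k < b"
  shows "(\<Sum>l\<in>{a..<b}. f (real k - real l)) =
      f 0 + (\<Sum>n<k - a. f (real (Suc n))) + (\<Sum>n<b - 1 - k. f (real (Suc n)))"
proof -
  have "{a..<b} = {a..<k} \<union> ({k} \<union> {Suc k..<b})" using assms by auto
  then have "(\<Sum>l\<in>{a..<b}. f (real k - real l)) = (\<Sum>l\<in>{a..<k}. f (real k - real l)) +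
     (f 0 + (\<Sum>l\<in>{Suc k..<b}. f (real k - real l)))"
    by (simp only:) (subst sum.union_disjoint; simp)+
  also have "(\<Sum>l\<in>{a..<k}. f (real k - real l)) = (\<Sum>n<k - a. f (real (Suc n)))"
    by (rule sum.reindex_bij_witness[of _ "\<lambda>n. k - 1 - n" "\<lambda>l. k - 1 - l"])
       (use assms in \<open>auto simp: of_nat_diff\<close>)
  also have "(\<Sum>l\<in>{Suc k..<b}. f (real k - real l)) = (\<Sum>n<b - 1 - k. f (real (Suc n)))"
  proof (rule sum.reindex_bij_witness[of _ "\<lambda>n. k + 1 + n" "\<lambda>l. l - k - 1"])
    fix l assume "l \<in> {Suc k..<b}"
    then have "real (Suc (l - k - 1)) = - (real k - real l)" by (auto simp: of_nat_diff)
    then show "f (real (Suc (l - k - 1))) = f (real k - real l)" using assms(1) by metis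
  qed (use assms in auto)
  finally show ?thesis by simp
qed

lemma sum_lessThan_Suc_shift: "(\<Sum>n<N. f (Suc n)) = (\<Sum>r=1..N. f r)"
  by (rule sum.reindex_bij_witness[of _ "\<lambda>r. r - 1" Suc]) auto

lemma row_sum_le:
  fixes f :: "real \<Rightarrow> real"
  assumes "\<And>x. f (- x) = f x" "\<And>x. f x \<ge> 0" "k < N"
  shows "(\<Sum>l<N. f (real k - real l)) \<le> f 0 + 2 * (\<Sum>r=1..N. f (real r))"
proof -
  have "(\<Sum>n<m. f (real (Suc n))) \<le> (\<Sum>r=1..N. f (real r))" if "m \<le> N" for m
  proof -
    have "(\<Sum>n<m. f (real (Suc n))) = (\<Sum>r=1..m. f (real r))"
      using sum_lessThan_Suc_shift[of "\<lambda>n. f (real n)"] by simp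
    also have "\<dots> \<le> (\<Sum>r=1..N. f (real r))" using that assms by (intro sum_mono2) auto
    finally show ?thesis .
  qed
  from this[of "k"] this[of "N - 1 - k"] show ?thesis
    using row_sum_split[of f 0 k N, OF assms(1)] assms(3) by (simp add: atLeast0LessThan)
qed

lemma has_sum_int_even:
  fixes f :: "real \<Rightarrow> real"
  assumes "\<And>x. f (- x) = f x" "summable (\<lambda>n. \<bar>f (real (Suc n))\<bar>)"
  shows "((\<lambda>r::int. f (real_of_int r)) has_sum (f 0 + 2 * (\<Sum>n. f (real (Suc n))))) UNIV"
proof -
  let ?P = "\<Sum>n. f (real (Suc n))"
  have "(\<lambda>n. f (real (Suc n))) sums ?P"
    by (rule summable_sums[OF summable_rabs_cancel[OF assms(2)]])
  then have hs: "((\<lambda>n. f (real (Suc n))) has_sum ?P) UNIV"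
    using assms(2) by (intro norm_summable_imp_has_sum) auto
  have p: "((\<lambda>r::int. f (real_of_int r)) has_sum ?P) (range (\<lambda>n. int (Suc n)))"
    by (subst has_sum_reindex) (use hs in \<open>auto simp: inj_on_def o_def\<close>)
  have e: "f (- 1 - real n) = f (1 + real n)" for n
    using assms(1)[of "1 + real n"] by simp
  have m: "((\<lambda>r::int. f (real_of_int r)) has_sum ?P) (range (\<lambda>n. - int (Suc n)))"
    by (subst has_sum_reindex) (use hs e in \<open>auto simp: inj_on_def o_def\<close>)
  have z: "((\<lambda>r::int. f (real_of_int r)) has_sum f 0) {0}"
    using has_sum_finite[of "{0::int}" "\<lambda>r::int. f (real_of_int r)"] by simp
  have "((\<lambda>r::int. f (real_of_int r)) has_sum (f 0 + (?P + ?P)))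
     ({0} \<union> (range (\<lambda>n. int (Suc n)) \<union> range (\<lambda>n. - int (Suc n))))"
    by (intro has_sum_Un_disjoint z p m) auto
  moreover have "{0} \<union> (range (\<lambda>n. int (Suc n)) \<union> range (\<lambda>n. - int (Suc n))) = (UNIV :: int set)"
  proof -
    have "x \<in> {0} \<union> (range (\<lambda>n. int (Suc n)) \<union> range (\<lambda>n. - int (Suc n)))" for x :: int
    proof -
      consider "x = 0" | "x = int (Suc (nat (x - 1)))" | "x = - int (Suc (nat (- x - 1)))" by linarith
      then show ?thesis by cases (simp, blast, blast)
    qed
    then show ?thesis by blast
  qed
  ultimately show ?thesis by simp
qed

lemma summable_power_abs_rho:
  assumes "0 < H" "H < 1" "real m * fbm_decay H > 1"
  shows "summable (\<lambda>n. \<bar>rho_fbm H (real (Suc n)) ^ m\<bar>)"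
    and "\<bar>rho_fbm H (real (Suc n)) ^ m\<bar> \<le> 4 ^ m * real (Suc n) powr (- (real m * fbm_decay H))"
proof -
  show b: "\<bar>rho_fbm H (real (Suc n)) ^ m\<bar> \<le> 4 ^ m * real (Suc n) powr (- (real m * fbm_decay H))" for n
  proof -
    have "\<bar>rho_fbm H (real (Suc n))\<bar> ^ m \<le> (4 * real (Suc n) powr (- fbm_decay H)) ^ m"
      using rho_fbm_decay[OF assms(1,2), of "Suc n"] by (intro power_mono) auto
    then show ?thesis
      by (simp add: power_mult_distrib power_abs powr_power mult.commute)
  qed
  have sm: "summable (\<lambda>n. real (Suc n) powr (- (real m * fbm_decay H)))"
    using assms by (subst summable_Suc_iff) (simp add: summable_real_powr_iff)
  show "summable (\<lambda>n. \<bar>rho_fbm H (real (Suc n)) ^ m\<bar>)"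
  proof (rule summable_comparison_test'[OF summable_mult[OF sm, of "4 ^ m"], of 0])
    show "norm \<bar>rho_fbm H (real (Suc n)) ^ m\<bar> \<le> 4 ^ m * real (Suc n) powr (- (real m * fbm_decay H))" for n
      using b[of n] by (simp only: real_norm_def abs_idempotent)
  qed
qed

text \<open>The series of \<open>rho^q\<close> over all integers, folded by evenness and
  \<open>rho(0) = 1\<close>; its tails then become tails of a series over the naturals.\<close>

definition corr_sum :: "real \<Rightarrow> nat \<Rightarrow> real" where
  "corr_sum H q = 1 + 2 * (\<Sum>n. rho_fbm H (real (Suc n)) ^ q)"

lemma
  assumes "0 < H" "H < 1" "q \<ge> 2" "real q * fbm_decay H > 1"
  shows corr_sum_ge: "corr_sum H q \<ge> 1/2"
    and sigma_fbm_eq: "sigma_fbm H q = sqrt (fact q * corr_sum H q)"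
proof -
  note sm = summable_power_abs_rho(1)[OF assms(1,2,4)]
  have "(\<lambda>N. \<Sum>n<N. rho_fbm H (real (Suc n)) ^ q) \<longlonglongrightarrow> (\<Sum>n. rho_fbm H (real (Suc n)) ^ q)"
    by (intro summable_LIMSEQ summable_rabs_cancel[OF sm])
  then have "(\<Sum>n. rho_fbm H (real (Suc n)) ^ q) \<ge> - 1/4"
    by (rule LIMSEQ_le_const) (use rho_fbm_power_sum_ge[OF assms(1,3)] in auto)
  then show "corr_sum H q \<ge> 1/2" by (simp add: corr_sum_def)
  have "((\<lambda>r::int. rho_fbm H (real_of_int r) ^ q) has_sum corr_sum H q) UNIV"
    using has_sum_int_even[of "\<lambda>x. rho_fbm H x ^ q", OF _ sm] by (simp add: corr_sum_def)
  then show "sigma_fbm H q = sqrt (fact q * corr_sum H q)"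
    by (simp add: sigma_fbm_def infsumI)
qed

text \<open>In a diagonal block, row \<open>k\<close> misses two tails of the full series, one
  beyond each end of the block; in an off-diagonal block it sees only part of one tail. A tail is at
  most a negative power of the distance from \<open>k\<close> to the end, and summing these powers
  over the block gives \<open>b^\<kappa>\<close>.\<close>

lemma mean_estimates:
  assumes "0 < H" "H < 1" "q \<ge> 2" "\<kappa> > 0" "real q * fbm_decay H > 1" "\<kappa> > 2 - real q * fbm_decay H"
  shows "\<exists>C\<ge>0. \<forall>a b. a \<le> b \<longrightarrow>
     \<bar>(\<Sum>k\<in>{a..<b}. \<Sum>l\<in>{a..<b}. rho_fbm H (real k - real l) ^ q) - real (b - a) * corr_sum H q\<bar>
        \<le> C * real b powr \<kappa> \<and>
     (\<forall>a' b'. b \<le> a' \<longrightarrow> \<bar>\<Sum>k\<in>{a..<b}. \<Sum>l\<in>{a'..<b'}. rho_fbm H (real k - real l) ^ q\<bar> \<le> C * real b powr \<kappa>)"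
proof -
  define s where "s = real q * fbm_decay H"
  \<comment> \<open>The rate \<open>u\<close> must be positive, at least \<open>1 - \<kappa>\<close>
    and below \<open>s - 1\<close>; the midpoint of this interval is taken.\<close>
  define u where "u = (max 0 (1 - \<kappa>) + (s - 1)) / 2"
  have u: "u > 0" "1 + u < s" "\<kappa> \<ge> 1 - u"
  proof -
    have s: "s > 1" "\<kappa> > 2 - s" using assms(5,6) by (simp_all add: s_def)
    have m: "0 \<le> max 0 (1 - \<kappa>)" "1 - \<kappa> \<le> max 0 (1 - \<kappa>)" "max 0 (1 - \<kappa>) < s - 1" using s by auto
    show "u > 0" "1 + u < s" "\<kappa> \<ge> 1 - u" using m s unfolding u_def by (simp_all add: field_simps)
  qed
  let ?f = "\<lambda>x. rho_fbm H x ^ q" and ?e = "\<lambda>n. \<bar>rho_fbm H (real (Suc n)) ^ q\<bar>"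
  note bd = summable_power_abs_rho[OF assms(1,2,5), folded s_def]
  obtain D where D: "D \<ge> 0" "\<And>A. \<bar>suminf ?e - (\<Sum>n<A. ?e n)\<bar> \<le> D * real (Suc A) powr (-u)"
    using powr_tail_bound(2)[of "4 ^ q" u s ?e] u bd(2) by auto
  let ?g = "\<lambda>n. rho_fbm H (real (Suc n)) ^ q"
  note sg = summable_rabs_cancel[OF bd(1)]
  have D': "\<bar>suminf ?g - (\<Sum>n<A. ?g n)\<bar> \<le> D * real (Suc A) powr (-u)" for A
  proof -
    have "suminf ?g - (\<Sum>n<A. ?g n) = (\<Sum>n. ?g (n + A))"
      using suminf_split_initial_segment[OF sg, of A] by simp
    also have "\<bar>\<dots>\<bar> \<le> (\<Sum>n. ?e (n + A))"
      by (intro summable_rabs summable_ignore_initial_segment[OF bd(1)])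
    also have "\<dots> = suminf ?e - (\<Sum>n<A. ?e n)"
      using suminf_split_initial_segment[OF bd(1), of A] by simp
    also have "\<dots> \<le> D * real (Suc A) powr (-u)" using D(2)[of A] by linarith
    finally show ?thesis .
  qed
  obtain Z where Z: "Z \<ge> 0" "\<And>N. (\<Sum>r=1..N. real r powr (-u)) \<le> Z * real N powr \<kappa>"
    using powr_partial_sum_bound[of \<kappa> u] assms(4) u by auto
  have up: "(\<Sum>k\<in>{a..<b}. real (k - a + 1) powr (-u)) \<le> Z * real b powr \<kappa>" 
    and dn: "(\<Sum>k\<in>{a..<b}. real (b - k) powr (-u)) \<le> Z * real b powr \<kappa>" if "a \<le> b" for a b
  proof -
    have "(\<Sum>k\<in>{a..<b}. real (k - a + 1) powr (-u)) = (\<Sum>r=1..b-a. real r powr (-u))"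
      by (rule sum.reindex_bij_witness[of _ "\<lambda>r. r + a - 1" "\<lambda>k. k - a + 1"]) (use that in auto)
    moreover have "(\<Sum>k\<in>{a..<b}. real (b - k) powr (-u)) = (\<Sum>r=1..b-a. real r powr (-u))"
      by (rule sum.reindex_bij_witness[of _ "\<lambda>r. b - r" "\<lambda>k. b - k"]) (use that in auto)
    moreover have "(\<Sum>r=1..b-a. real r powr (-u)) \<le> Z * real b powr \<kappa>"
    proof -
      have "real (b - a) powr \<kappa> \<le> real b powr \<kappa>" using assms(4) by (intro powr_mono2) auto
      then show ?thesis using Z(2)[of "b-a"] Z(1) by (meson mult_left_mono order_trans)
    qed
    ultimately show "(\<Sum>k\<in>{a..<b}. real (k - a + 1) powr (-u)) \<le> Z * real b powr \<kappa>"
      and "(\<Sum>k\<in>{a..<b}. real (b - k) powr (-u)) \<le> Z * real b powr \<kappa>" by simp_all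
  qed
  have fe: "?f (- x) = ?f x" for x by simp
  show ?thesis
  proof (intro exI[of _ "2 * (D * Z)"] conjI allI impI)
    show "2 * (D * Z) \<ge> 0" using D Z by simp
    fix a b :: nat assume ab: "a \<le> b"
    have "\<bar>(\<Sum>k\<in>{a..<b}. \<Sum>l\<in>{a..<b}. ?f (real k - real l)) - real (b - a) * corr_sum H q\<bar>
       = \<bar>\<Sum>k\<in>{a..<b}. ((\<Sum>l\<in>{a..<b}. ?f (real k - real l)) - corr_sum H q)\<bar>"
      by (simp add: sum_subtractf)
    also have "\<dots> \<le> (\<Sum>k\<in>{a..<b}. \<bar>(\<Sum>l\<in>{a..<b}. ?f (real k - real l)) - corr_sum H q\<bar>)"
      by (rule sum_abs)
    also have "\<dots> \<le> (\<Sum>k\<in>{a..<b}. D * real (k - a + 1) powr (-u) + D * real (b - k) powr (-u))"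
    proof (rule sum_mono)
      fix k assume k: "k \<in> {a..<b}"
      have "(\<Sum>l\<in>{a..<b}. ?f (real k - real l)) = 1 + (\<Sum>n<k - a. ?g n) + (\<Sum>n<b - 1 - k. ?g n)"
        using row_sum_split[of ?f a k b, OF fe] k by simp
      then have e0: "(\<Sum>l\<in>{a..<b}. ?f (real k - real l)) - corr_sum H q =
         - (suminf ?g - (\<Sum>n<k - a. ?g n)) - (suminf ?g - (\<Sum>n<b - 1 - k. ?g n))"
        by (simp add: corr_sum_def)
      have e1: "\<bar>suminf ?g - (\<Sum>n<k - a. ?g n)\<bar> \<le> D * real (k - a + 1) powr (-u)"
        using D'[of "k - a"] by (simp only: Suc_eq_plus1)
      have sb: "Suc (b - 1 - k) = b - k" using k by auto
      have e2: "\<bar>suminf ?g - (\<Sum>n<b - 1 - k. ?g n)\<bar> \<le> D * real (b - k) powr (-u)"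
        using D'[of "b - 1 - k"] unfolding sb .
      show "\<bar>(\<Sum>l\<in>{a..<b}. ?f (real k - real l)) - corr_sum H q\<bar>
          \<le> D * real (k - a + 1) powr (-u) + D * real (b - k) powr (-u)"
        using e1 e2 unfolding e0 by linarith
    qed
    also have "\<dots> = D * (\<Sum>k\<in>{a..<b}. real (k - a + 1) powr (-u)) + D * (\<Sum>k\<in>{a..<b}. real (b - k) powr (-u))"
      by (simp only: sum.distrib sum_distrib_left)
    also have "\<dots> \<le> D * (Z * real b powr \<kappa>) + D * (Z * real b powr \<kappa>)"
      using up[OF ab] dn[OF ab] D(1) by (intro add_mono mult_left_mono)
    finally show "\<bar>(\<Sum>k\<in>{a..<b}. \<Sum>l\<in>{a..<b}. ?f (real k - real l)) - real (b - a) * corr_sum H q\<bar>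
        \<le> 2 * (D * Z) * real b powr \<kappa>" by (simp add: algebra_simps)
    fix a' b' :: nat assume ba: "b \<le> a'"
    have "\<bar>\<Sum>k\<in>{a..<b}. \<Sum>l\<in>{a'..<b'}. ?f (real k - real l)\<bar> \<le>
       (\<Sum>k\<in>{a..<b}. \<Sum>l\<in>{a'..<b'}. \<bar>?f (real k - real l)\<bar>)"
      by (rule order_trans[OF sum_abs]) (intro sum_mono sum_abs)
    also have "\<dots> \<le> (\<Sum>k\<in>{a..<b}. D * real (b - k) powr (-u))"
    proof (rule sum_mono)
      fix k assume k: "k \<in> {a..<b}"
      \<comment> \<open>Starting the row at \<open>b\<close> turns it into a difference of two
        initial segments of one series; \<open>max\<close> covers the case
        \<open>b' < b\<close>.\<close>
      have "(\<Sum>l\<in>{a'..<b'}. \<bar>?f (real k - real l)\<bar>) \<le> (\<Sum>l\<in>{b..<max b b'}. \<bar>?f (real k - real l)\<bar>)"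
        using ba by (intro sum_mono2) auto
      also have "\<dots> = (\<Sum>n\<in>{b - 1 - k..<max b b' - 1 - k}. ?e n)"
      proof (rule sum.reindex_bij_witness[of _ "\<lambda>n. k + 1 + n" "\<lambda>l. l - k - 1"])
        fix l assume "l \<in> {b..<max b b'}"
        then have "real (Suc (l - k - 1)) = - (real k - real l)" using k by (auto simp: of_nat_diff)
        then show "?e (l - k - 1) = \<bar>?f (real k - real l)\<bar>" using fe by metis
      qed (use k in auto)
      also have "\<dots> = (\<Sum>n<max b b' - 1 - k. ?e n) - (\<Sum>n<b - 1 - k. ?e n)"
        using k by (subst sum_diff[symmetric]) (auto intro!: sum.cong)
      also have "\<dots> \<le> suminf ?e - (\<Sum>n<b - 1 - k. ?e n)"
        using sum_le_suminf[OF bd(1), of "{..<max b b' - 1 - k}"] by simp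
      also have "\<dots> \<le> D * real (Suc (b - 1 - k)) powr (-u)"
        using D(2)[of "b - 1 - k"] by linarith
      also have "Suc (b - 1 - k) = b - k" using k by auto
      finally show "(\<Sum>l\<in>{a'..<b'}. \<bar>?f (real k - real l)\<bar>) \<le> D * real (b - k) powr (-u)" .
    qed
    also have "\<dots> \<le> D * (Z * real b powr \<kappa>)"
      unfolding sum_distrib_left[symmetric] by (intro mult_left_mono dn ab D)
    also have "\<dots> \<le> 2 * (D * Z) * real b powr \<kappa>" using D Z by simp
    finally show "\<bar>\<Sum>k\<in>{a..<b}. \<Sum>l\<in>{a'..<b'}. ?f (real k - real l)\<bar> \<le> 2 * (D * Z) * real b powr \<kappa>" .
  qed
qed

section \<open>Rates\<close>

definition rate_exponent :: "real \<Rightarrow> nat \<Rightarrow> real" where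
  "rate_exponent H q =
     (if H \<le> 1/2 then - 1/2
      else if H \<le> (2 * real q - 3) / (2 * real q - 2) then H - 1
      else real q * H - real q + 1/2)"

lemma rate_fbm_eq: "rate_fbm H q n = real n powr rate_exponent H q"
  by (simp add: rate_fbm_def rate_exponent_def)

definition abs_row_bound :: "real \<Rightarrow> nat \<Rightarrow> nat \<Rightarrow> real" where
  "abs_row_bound H m N = 1 + 2 * (\<Sum>r=1..N. \<bar>rho_fbm H (real r)\<bar> ^ m)"

lemma abs_row_bound_nonneg: "abs_row_bound H m N \<ge> 0"
  by (simp add: abs_row_bound_def sum_nonneg add_nonneg_nonneg)

lemma abs_row_sum_le:
  assumes "k < N"
  shows "(\<Sum>l<N. \<bar>rho_fbm H (real k - real l)\<bar> ^ m) \<le> abs_row_bound H m N"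
  using row_sum_le[of "\<lambda>x. \<bar>rho_fbm H x\<bar> ^ m" k N] assms by (simp add: abs_row_bound_def)

lemma abs_row_bound_le_powr_sum:
  assumes "0 < H" "H < 1"
  shows "abs_row_bound H m N \<le> 1 + 2 * (4 ^ m * (\<Sum>r=1..N. real r powr (- (real m * fbm_decay H))))"
proof -
  have "(\<Sum>r=1..N. \<bar>rho_fbm H (real r)\<bar> ^ m) \<le> (\<Sum>r=1..N. 4 ^ m * real r powr (- (real m * fbm_decay H)))"
  proof (rule sum_mono)
    fix r assume "r \<in> {1..N}"
    then have "\<bar>rho_fbm H (real r)\<bar> ^ m \<le> (4 * real r powr (- fbm_decay H)) ^ m"
      using rho_fbm_decay[OF assms, of r] by (intro power_mono) auto
    then show "\<bar>rho_fbm H (real r)\<bar> ^ m \<le> 4 ^ m * real r powr (- (real m * fbm_decay H))"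
      using \<open>r \<in> {1..N}\<close> by (simp add: power_mult_distrib powr_power mult.commute)
  qed
  then have "(\<Sum>r=1..N. \<bar>rho_fbm H (real r)\<bar> ^ m) \<le> 4 ^ m * (\<Sum>r=1..N. real r powr (- (real m * fbm_decay H)))"
    by (simp only: sum_distrib_left)
  then show ?thesis unfolding abs_row_bound_def by (intro add_left_mono mult_left_mono) auto
qed

lemma abs_row_bound_powr:
  assumes H: "0 < H" "H < 1" and k: "(\<kappa> > 0 \<and> \<kappa> \<ge> 1 - real m * fbm_decay H) \<or> (\<kappa> = 0 \<and> real m * fbm_decay H > 1)"
  shows "\<exists>C\<ge>0. \<forall>N\<ge>1. abs_row_bound H m N \<le> C * real N powr \<kappa>"
proof -
  obtain C where C: "C \<ge> 0" "\<And>N. N \<ge> 1 \<Longrightarrow> (\<Sum>r=1..N. real r powr (- (real m * fbm_decay H))) \<le> C * real N powr \<kappa>"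
  proof (cases "\<kappa> > 0")
    case True
    then show ?thesis
      using powr_partial_sum_bound[of \<kappa> "real m * fbm_decay H"] k that by auto
  next
    case False
    then have "\<kappa> = 0" "real m * fbm_decay H > 1" using k by auto
    moreover obtain C where "C \<ge> 0" "\<And>N. (\<Sum>r=1..N. real r powr (- (real m * fbm_decay H))) \<le> C"
      using powr_partial_sum_bounded[OF \<open>real m * fbm_decay H > 1\<close>] by auto
    ultimately show ?thesis using that[of C] by simp
  qed
  have "abs_row_bound H m N \<le> (1 + 2 * (4 ^ m * C)) * real N powr \<kappa>" if N: "N \<ge> 1" for N
  proof -
    have "\<kappa> \<ge> 0" using k by auto
    then have "1 \<le> real N powr \<kappa>" using N by (intro ge_one_powr_ge_zero) auto
    moreover have "2 * (4 ^ m * (\<Sum>r=1..N. real r powr (- (real m * fbm_decay H)))) \<le> 2 * (4 ^ m * (C * real N powr \<kappa>))"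
      by (intro mult_left_mono C(2) N) auto
    ultimately have "abs_row_bound H m N \<le> real N powr \<kappa> + 2 * (4 ^ m * (C * real N powr \<kappa>))"
      using abs_row_bound_le_powr_sum[OF H, of m N] by linarith
    then show ?thesis by (simp add: algebra_simps)
  qed
  then show ?thesis using C(1) by (intro exI[of _ "1 + 2 * (4 ^ m * C)"]) auto
qed

text \<open>In terms of the decay exponent \<open>\<alpha> = 2 - 2H\<close>, the breakpoint
  \<open>(2q-3)/(2q-2)\<close> is exactly \<open>p \<alpha> = 1\<close>, the critical case for the
  sum of \<open>|rho|^p\<close>, and the upper limit for \<open>H\<close> is
  \<open>q \<alpha> = 1\<close>, critical for \<open>|rho|^q\<close>.\<close>

lemma rate_exponent_cases:
  assumes H: "0 < H" "H < 1" and p: "p \<ge> 1" and Hq: "H < 1 - 1 / (2 * real (Suc p))"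
  obtains "H \<le> 1/2" "fbm_decay H > 1" "rate_exponent H (Suc p) = - 1/2"
  | "H > 1/2" "fbm_decay H = 2 - 2 * H" "real p * fbm_decay H \<ge> 1" "rate_exponent H (Suc p) = H - 1"
  | "H > 1/2" "fbm_decay H = 2 - 2 * H" "real p * fbm_decay H < 1" "real (Suc p) * fbm_decay H > 1"
    "rate_exponent H (Suc p) = (1 - real (Suc p) * fbm_decay H) / 2"
proof (cases "H \<le> 1/2")
  case True
  then have "fbm_decay H > 1" "rate_exponent H (Suc p) = - 1/2" by (auto simp: fbm_decay_def rate_exponent_def)
  then show ?thesis using that(1) True by blast
next
  case False
  then have d: "fbm_decay H = 2 - 2 * H" by (auto simp: fbm_decay_def)
  have "H < (2 * real p + 1) / (2 * real p + 2)" using Hq by (simp add: field_simps)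
  then have s: "real (Suc p) * fbm_decay H > 1" unfolding d by (simp add: field_simps)
  have c: "H \<le> (2 * real (Suc p) - 3) / (2 * real (Suc p) - 2) \<longleftrightarrow> real p * fbm_decay H \<ge> 1"
    unfolding d using p by (simp add: field_simps)
  show ?thesis
  proof (cases "real p * fbm_decay H \<ge> 1")
    case True
    then show ?thesis using that(2) False d c by (simp add: rate_exponent_def)
  next
    case F: False
    then have "rate_exponent H (Suc p) = real (Suc p) * H - real (Suc p) + 1/2"
      using False c by (simp add: rate_exponent_def)
    also have "\<dots> = (1 - real (Suc p) * fbm_decay H) / 2" unfolding d by (simp add: field_simps)
    finally show ?thesis using that(3) False F d s by simp
  qed
qed

text \<open>With \<open>\<kappa> = 1 + rate_exponent\<close> the first three are the hypotheses of
  \<open>mean_estimates\<close>, so that after division by \<open>n\<close> the bias of the kernel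
  has the desired rate. The last one makes \<open>x^(2 + 2 rate_exponent)\<close> monotone.\<close>

lemma rate_exponent_mean:
  assumes H: "0 < H" "H < 1" and p: "p \<ge> 1" and Hq: "H < 1 - 1 / (2 * real (Suc p))"
  shows "1 + rate_exponent H (Suc p) > 0" "1 + rate_exponent H (Suc p) > 2 - real (Suc p) * fbm_decay H"
    "real (Suc p) * fbm_decay H > 1" "1 + 2 * rate_exponent H (Suc p) \<ge> 0"
proof -
  have sp: "real (Suc p) * fbm_decay H = real p * fbm_decay H + fbm_decay H" by (simp add: algebra_simps)
  have "1 + rate_exponent H (Suc p) > 0 \<and> 1 + rate_exponent H (Suc p) > 2 - real (Suc p) * fbm_decay H
     \<and> real (Suc p) * fbm_decay H > 1 \<and> 1 + 2 * rate_exponent H (Suc p) \<ge> 0"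
    using H p Hq
  proof (cases rule: rate_exponent_cases)
    case 1
    have "1 * fbm_decay H \<le> real p * fbm_decay H" using p 1 by (intro mult_right_mono) auto
    then have "fbm_decay H \<le> real p * fbm_decay H" by (simp only: mult_1)
    then show ?thesis using 1 unfolding sp by (intro conjI; linarith)
  next
    case 2
    then show ?thesis using H unfolding sp by simp
  next
    case 3
    then show ?thesis using H sp by (simp add: field_simps)
  qed
  then show "1 + rate_exponent H (Suc p) > 0" "1 + rate_exponent H (Suc p) > 2 - real (Suc p) * fbm_decay H"
    "real (Suc p) * fbm_decay H > 1" "1 + 2 * rate_exponent H (Suc p) \<ge> 0" by auto
qed

text \<open>The variance of the kernel is of order \<open>n^(-2)\<close> times the left side, and
  its square root should be \<open>n\<close> to the rate exponent \<open>r\<close>; hence the target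
  \<open>2 + 2 r\<close>. The growth exponents of the two row bounds must satisfy
  \<open>\<kappa>A + 2 \<kappa>B \<le> 1 + 2 r\<close>.\<close>

lemma cycle_estimate:
  assumes H: "0 < H" "H < 1" and p: "p \<ge> 1" and Hq: "H < 1 - 1 / (2 * real (Suc p))"
  shows "\<exists>C\<ge>0. \<forall>N. real N * abs_row_bound H 2 N * (abs_row_bound H p N)\<^sup>2 \<le>
     C * real N powr (2 + 2 * rate_exponent H (Suc p))"
proof -
  let ?\<alpha> = "fbm_decay H" and ?r = "rate_exponent H (Suc p)"
  have "\<exists>\<kappa>A \<kappa>B. ((\<kappa>A > 0 \<and> \<kappa>A \<ge> 1 - real 2 * ?\<alpha>) \<or> (\<kappa>A = 0 \<and> real 2 * ?\<alpha> > 1)) \<and>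
      ((\<kappa>B > 0 \<and> \<kappa>B \<ge> 1 - real p * ?\<alpha>) \<or> (\<kappa>B = 0 \<and> real p * ?\<alpha> > 1)) \<and> \<kappa>A + 2 * \<kappa>B \<le> 1 + 2 * ?r"
    using H p Hq
  proof (cases rule: rate_exponent_cases)
    case 1
    have "1 * ?\<alpha> \<le> real p * ?\<alpha>" using p 1 by (intro mult_right_mono) auto
    then have "real p * ?\<alpha> > 1" using 1 by linarith
    then show ?thesis using 1 by (intro exI[of _ 0]) simp
  next
    case 2
    \<comment> \<open>The allowance is \<open>1 + 2 r = 1 - \<alpha>\<close>, and
      \<open>3 \<epsilon>\<close> is spent on top of \<open>max 0 (1 - 2\<alpha>)\<close>: one
      \<open>\<epsilon>\<close> for \<open>\<kappa>A\<close>, two for the squared row bound.\<close>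
    define \<epsilon> where "\<epsilon> = min ?\<alpha> (1 - ?\<alpha>) / 3"
    have e: "\<epsilon> > 0" "3 * \<epsilon> \<le> ?\<alpha>" "3 * \<epsilon> \<le> 1 - ?\<alpha>" using 2 H by (auto simp: \<epsilon>_def min_def)
    show ?thesis
      using 2 e by (intro exI[of _ "max 0 (1 - 2 * ?\<alpha>) + \<epsilon>"] exI[of _ \<epsilon>]) (auto simp: max_def)
  next
    case 3
    have sp: "real (Suc p) * ?\<alpha> = real p * ?\<alpha> + ?\<alpha>" by (simp add: algebra_simps)
    show ?thesis
    proof (cases "p = 1")
      case True
      \<comment> \<open>For \<open>q = 2\<close> the squares are summable, since
        \<open>2 \<alpha> > 1\<close>, and \<open>2 (1 - \<alpha>)\<close> is exactly the
        allowance.\<close>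
      then show ?thesis using 3 by (intro exI[of _ 0] exI[of _ "1 - ?\<alpha>"]) simp
    next
      case False
      have "2 * ?\<alpha> \<le> real p * ?\<alpha>" using False p 3 H by (intro mult_right_mono) auto
      \<comment> \<open>Both sums grow:
        \<open>\<kappa>A + 2 \<kappa>B = 3 - 2 (p+1) \<alpha>\<close>, which is at most
        \<open>2 - (p+1) \<alpha> = 1 + 2 r\<close> because
        \<open>(p+1) \<alpha> > 1\<close>.\<close>
      then show ?thesis using 3 sp by (intro exI[of _ "1 - 2 * ?\<alpha>"] exI[of _ "1 - real p * ?\<alpha>"]) simp
    qed
  qed
  then obtain \<kappa>A \<kappa>B where kA: "(\<kappa>A > 0 \<and> \<kappa>A \<ge> 1 - real 2 * ?\<alpha>) \<or> (\<kappa>A = 0 \<and> real 2 * ?\<alpha> > 1)"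
    and kB: "(\<kappa>B > 0 \<and> \<kappa>B \<ge> 1 - real p * ?\<alpha>) \<or> (\<kappa>B = 0 \<and> real p * ?\<alpha> > 1)"
    and k: "\<kappa>A + 2 * \<kappa>B \<le> 1 + 2 * ?r" by blast
  obtain CA where CA: "CA \<ge> 0" "\<And>N. N \<ge> 1 \<Longrightarrow> abs_row_bound H 2 N \<le> CA * real N powr \<kappa>A"
    using abs_row_bound_powr[OF H kA] by blast
  obtain CB where CB: "CB \<ge> 0" "\<And>N. N \<ge> 1 \<Longrightarrow> abs_row_bound H p N \<le> CB * real N powr \<kappa>B"
    using abs_row_bound_powr[OF H kB] by blast
  have "real N * abs_row_bound H 2 N * (abs_row_bound H p N)\<^sup>2 \<le> (CA * CB\<^sup>2) * real N powr (2 + 2 * ?r)" for N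
  proof (cases "N \<ge> 1")
    case True
    have "real N * abs_row_bound H 2 N * (abs_row_bound H p N)\<^sup>2 \<le>
       real N * (CA * real N powr \<kappa>A) * (CB * real N powr \<kappa>B)\<^sup>2"
      using True CA CB abs_row_bound_nonneg by (intro mult_mono power_mono) auto
    also have "\<dots> = (CA * CB\<^sup>2) * (real N powr 1 * real N powr \<kappa>A * real N powr (2 * \<kappa>B))"
      using True by (simp add: power_mult_distrib powr_power mult_ac)
    also have "real N powr 1 * real N powr \<kappa>A * real N powr (2 * \<kappa>B) = real N powr (1 + \<kappa>A + 2 * \<kappa>B)"
      by (simp only: powr_add)
    also have "(CA * CB\<^sup>2) * \<dots> \<le> (CA * CB\<^sup>2) * real N powr (2 + 2 * ?r)"
      using True k CA(1) by (intro mult_left_mono powr_mono) auto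
    finally show ?thesis .
  next
    case False
    then have "N = 0" by simp
    then show ?thesis by simp
  qed
  then show ?thesis using CA(1) by (intro exI[of _ "CA * CB\<^sup>2"]) auto
qed

section \<open>Gaussian integration by parts\<close>

lemma one_plus_power_le_exp: "y \<ge> 0 \<Longrightarrow> (1 + y) ^ m \<le> fact m * exp (1 + y)" for y :: real
proof -
  assume "y \<ge> 0"
  then have "(\<Sum>n\<in>{m}. (1 + y) ^ n /\<^sub>R fact n) \<le> (\<Sum>n. (1 + y) ^ n /\<^sub>R fact n)"
    by (intro sum_le_suminf summable_exp_generic) auto
  then show ?thesis by (simp add: exp_def field_simps)
qed

lemma one_plus_power_le: "y \<ge> 0 \<Longrightarrow> (1 + y) ^ m \<le> 2 ^ m * (1 + y ^ m)" for y :: real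
proof -
  assume y: "y \<ge> 0"
  have "(1 + y) ^ m \<le> (2 * max 1 y) ^ m" using y by (intro power_mono) auto
  also have "\<dots> = 2 ^ m * max 1 y ^ m" by (simp add: power_mult_distrib)
  also have "\<dots> \<le> 2 ^ m * (1 + y ^ m)" using y by (intro mult_left_mono) (auto simp: max_def)
  finally show ?thesis .
qed

lemma std_normal_prob_space: "prob_space std_normal_distribution"
  by (intro prob_space_normal_density) simp

lemma integrable_std_normal_abs_power: "integrable std_normal_distribution (\<lambda>x. \<bar>x\<bar> ^ k)"
  using integrable_std_normal_moment_abs[of k] by (subst integrable_real_density) auto

lemma integrable_std_normal_growth:
  assumes [measurable]: "f \<in> borel_measurable borel" and "\<And>x. \<bar>f x\<bar> \<le> C * (1 + \<bar>x\<bar>) ^ m"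
  shows "integrable std_normal_distribution (f :: real \<Rightarrow> real)"
proof -
  interpret prob_space std_normal_distribution by (rule std_normal_prob_space)
  have "integrable std_normal_distribution (\<lambda>x. \<bar>C\<bar> * (2 ^ m * (1 + \<bar>x\<bar> ^ m)))"
    by (intro integrable_mult_right Bochner_Integration.integrable_add integrable_std_normal_abs_power) simp
  then show ?thesis
  proof (rule Bochner_Integration.integrable_bound)
    show "AE x in std_normal_distribution. norm (f x) \<le> norm (\<bar>C\<bar> * (2 ^ m * (1 + \<bar>x\<bar> ^ m)))"
    proof (rule AE_I2)
      fix x :: real
      have "\<bar>f x\<bar> \<le> \<bar>C\<bar> * (1 + \<bar>x\<bar>) ^ m"
        using assms(2)[of x] by (smt (verit) mult_right_mono zero_le_power abs_ge_self)
      also have "\<dots> \<le> \<bar>C\<bar> * (2 ^ m * (1 + \<bar>x\<bar> ^ m))"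
        by (intro mult_left_mono one_plus_power_le) auto
      finally show "norm (f x) \<le> norm (\<bar>C\<bar> * (2 ^ m * (1 + \<bar>x\<bar> ^ m)))"
        by (simp add: abs_mult)
    qed
  qed measurable
qed

lemma std_normal_density_deriv:
  "(std_normal_density has_real_derivative - x * std_normal_density x) (at x)"
proof -
  have "((\<lambda>x. exp (- x\<^sup>2 / 2)) has_real_derivative - x * exp (- x\<^sup>2 / 2)) (at x)"
    by (auto intro!: derivative_eq_intros)
  from DERIV_cmult[OF this, of "1 / sqrt (2 * pi)"] show ?thesis
    unfolding std_normal_density_def[abs_def] by (simp only: mult_ac mult_minus_left mult_minus_right)
qed

lemma gaussian_ibp:
  fixes f f' :: "real \<Rightarrow> real"
  assumes d: "\<And>x. (f has_real_derivative f' x) (at x)" and c: "continuous_on UNIV f'"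
    and gf: "\<And>x. \<bar>f x\<bar> \<le> C * (1 + \<bar>x\<bar>) ^ m" and gf': "\<And>x. \<bar>f' x\<bar> \<le> C * (1 + \<bar>x\<bar>) ^ m"
  shows "(\<integral>x. x * f x \<partial>std_normal_distribution) = (\<integral>x. f' x \<partial>std_normal_distribution)"
proof -
  have C: "C \<ge> 0" using gf[of 0] by simp
  have cf: "continuous_on UNIV f"
    using d DERIV_isCont continuous_at_imp_continuous_on by blast
  have [measurable]: "f \<in> borel_measurable borel" "f' \<in> borel_measurable borel"
    using cf c by (auto intro: borel_measurable_continuous_onI)
  have i1: "integrable std_normal_distribution f'"
    by (rule integrable_std_normal_growth[OF _ gf']) simp
  have i2: "integrable std_normal_distribution (\<lambda>x. x * f x)"
  proof (rule integrable_std_normal_growth[of _ C "Suc m"])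
    fix x :: real
    have "\<bar>x\<bar> * \<bar>f x\<bar> \<le> (1 + \<bar>x\<bar>) * (C * (1 + \<bar>x\<bar>) ^ m)" by (intro mult_mono gf) auto
    then show "\<bar>x * f x\<bar> \<le> C * (1 + \<bar>x\<bar>) ^ Suc m" by (simp add: abs_mult mult_ac)
  qed simp
  have "integrable std_normal_distribution (\<lambda>x. f' x - x * f x)" using i1 i2 by simp
  then have i3: "integrable lborel (\<lambda>x. (f' x - x * f x) * std_normal_density x)"
    by (subst (asm) integrable_real_density) (auto simp: mult.commute)
  let ?F = "\<lambda>x. f x * std_normal_density x"
  have bnd: "\<bar>?F x\<bar> \<le> C * fact m * (exp (1 + \<bar>x\<bar>) * std_normal_density x)" for x
  proof -
    have "\<bar>?F x\<bar> \<le> C * (1 + \<bar>x\<bar>) ^ m * std_normal_density x"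
      using gf[of x] by (simp add: abs_mult mult_right_mono)
    also have "\<dots> \<le> C * (fact m * exp (1 + \<bar>x\<bar>)) * std_normal_density x"
      by (intro mult_right_mono mult_left_mono one_plus_power_le_exp C) auto
    finally show ?thesis by (simp add: mult_ac)
  qed
  have l1: "((\<lambda>x::real. C * fact m * (exp (1 + \<bar>x\<bar>) * std_normal_density x)) \<longlongrightarrow> 0) at_top"
  proof -
    have "((\<lambda>x::real. exp (1 + x) * (1 / sqrt (2 * pi) * exp (- x\<^sup>2 / 2))) \<longlongrightarrow> 0) at_top"
      by real_asymp
    then have "((\<lambda>x::real. exp (1 + \<bar>x\<bar>) * std_normal_density x) \<longlongrightarrow> 0) at_top"
      by (rule Lim_transform_eventually)
         (auto intro!: eventually_mono[OF eventually_ge_at_top[of 0]] simp: std_normal_density_def)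
    then show ?thesis by (rule tendsto_mult_right_zero)
  qed
  then have l2: "((\<lambda>x::real. C * fact m * (exp (1 + \<bar>x\<bar>) * std_normal_density x)) \<longlongrightarrow> 0) at_bot"
    by (subst filterlim_at_bot_mirror) (simp add: std_normal_density_def)
  have t1: "(?F \<longlongrightarrow> 0) at_top"
    by (rule Lim_null_comparison[OF _ l1]) (use bnd in auto)
  have t2: "(?F \<longlongrightarrow> 0) at_bot"
    by (rule Lim_null_comparison[OF _ l2]) (use bnd in auto)
  have "(LBINT x=-\<infinity>..\<infinity>. (f' x - x * f x) * std_normal_density x) = 0 - 0"
  proof (rule interval_integral_FTC_integrable)
    fix x :: real
    have "(?F has_real_derivative (f' x - x * f x) * std_normal_density x) (at x)"
      by (rule derivative_eq_intros d std_normal_density_deriv refl)+ (simp add: algebra_simps)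
    then show "(?F has_vector_derivative (f' x - x * f x) * std_normal_density x) (at x)"
      by (simp add: has_real_derivative_iff_has_vector_derivative)
    have "isCont f' x" "isCont f x" "isCont std_normal_density x"
      using c d std_normal_density_deriv
      by (auto simp: continuous_on_eq_continuous_at intro: DERIV_isCont)
    then show "isCont (\<lambda>x. (f' x - x * f x) * std_normal_density x) x"
      by (intro continuous_intros)
  next
    show "set_integrable lborel (einterval (- \<infinity>) \<infinity>) (\<lambda>x. (f' x - x * f x) * std_normal_density x)"
      using i3 by (simp add: set_integrable_def)
    show "((?F \<circ> real_of_ereal) \<longlongrightarrow> 0) (at_right (- \<infinity>))"
      using t2 by (simp add: ereal_tendsto_simps)
    show "((?F \<circ> real_of_ereal) \<longlongrightarrow> 0) (at_left \<infinity>)"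
      using t1 by (simp add: ereal_tendsto_simps)
  qed simp
  then have "(\<integral>x. (f' x - x * f x) * std_normal_density x \<partial>lborel) = 0"
    by (simp add: interval_lebesgue_integral_def set_lebesgue_integral_def)
  then have "(\<integral>x. f' x - x * f x \<partial>std_normal_distribution) = 0"
    by (subst integral_real_density) (auto simp: mult.commute)
  then show ?thesis using i1 i2 by simp
qed

section \<open>Expectations of cosines determine laws on \<open>\<real>^N\<close>\<close>

lemma std_normal_char:
  "(\<integral>x. exp (\<i> * complex_of_real (t * x)) \<partial>std_normal_distribution) = complex_of_real (exp (- t\<^sup>2 / 2))"
  using char_std_normal_distribution by (simp add: char_def fun_eq_iff)

lemma std_normal_cos:
  "(\<integral>x. cos (t * x + b) \<partial>std_normal_distribution) = cos b * exp (- t\<^sup>2 / 2)"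
proof -
  interpret prob_space std_normal_distribution by (rule std_normal_prob_space)
  have i: "integrable std_normal_distribution (\<lambda>x. exp (\<i> * complex_of_real (t * x)) * exp (\<i> * complex_of_real b))"
    by (intro integrable_const_bound[of _ 1]) (auto simp: norm_mult)
  have "(\<integral>x. exp (\<i> * complex_of_real (t * x)) * exp (\<i> * complex_of_real b) \<partial>std_normal_distribution)
     = complex_of_real (exp (- t\<^sup>2 / 2)) * exp (\<i> * complex_of_real b)"
    by (simp only: integral_mult_left_zero std_normal_char)
  then have "Re (\<integral>x. exp (\<i> * complex_of_real (t * x)) * exp (\<i> * complex_of_real b) \<partial>std_normal_distribution)
     = exp (- t\<^sup>2 / 2) * cos b"
    by (simp add: Re_exp)
  moreover have "Re (exp (\<i> * complex_of_real (t * x)) * exp (\<i> * complex_of_real b)) = cos (t * x + b)" for x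
    by (simp add: Re_exp Im_exp cos_add)
  ultimately show ?thesis
    using integral_Re[OF i] by (simp add: mult.commute)
qed

text \<open>The case \<open>s = b = 0\<close> shows that both weights have the same total mass. If
  it is positive, they are normalised to densities and the images under \<open>X1\<close>,
  \<open>X2\<close> have equal characteristic functions, the phase \<open>b = - pi / 2\<close>
  supplying the imaginary parts. Zero mass cannot be normalised and is treated apart.\<close>

lemma weighted_uniqueness:
  fixes X1 W1 :: "'a \<Rightarrow> real" and X2 W2 :: "'b \<Rightarrow> real"
  assumes "prob_space M1" "prob_space M2"
    and [measurable]: "X1 \<in> borel_measurable M1" "W1 \<in> borel_measurable M1"
      "X2 \<in> borel_measurable M2" "W2 \<in> borel_measurable M2" "A \<in> sets borel"
    and W1: "\<And>x. 0 \<le> W1 x \<and> W1 x \<le> K" and W2: "\<And>x. 0 \<le> W2 x \<and> W2 x \<le> K"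
    and eq: "\<And>s b. (\<integral>x. W1 x * cos (s * X1 x + b) \<partial>M1) = (\<integral>x. W2 x * cos (s * X2 x + b) \<partial>M2)"
  shows "(\<integral>x. W1 x * indicator A (X1 x) \<partial>M1) = (\<integral>x. W2 x * indicator A (X2 x) \<partial>M2)"
proof -
  interpret P1: prob_space M1 by fact
  interpret P2: prob_space M2 by fact
  define c where "c = (\<integral>x. W1 x \<partial>M1)"
  have c2: "c = (\<integral>x. W2 x \<partial>M2)" using eq[of 0 0] by (simp add: c_def)
  have i1: "integrable M1 W1" by (rule P1.integrable_const_bound[of _ K]) (use W1 in auto)
  have i2: "integrable M2 W2" by (rule P2.integrable_const_bound[of _ K]) (use W2 in auto)
  have c0: "c \<ge> 0" using W1 by (auto simp: c_def intro: integral_nonneg)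
  show ?thesis
  proof (cases "c = 0")
    case True
    have "(\<integral>x. W1 x * indicator A (X1 x) \<partial>M1) = 0"
    proof (rule antisym)
      have "(\<integral>x. W1 x * indicator A (X1 x) \<partial>M1) \<le> (\<integral>x. W1 x \<partial>M1)"
        by (rule integral_mono'[OF i1]) (use W1 in \<open>auto split: split_indicator\<close>)
      then show "(\<integral>x. W1 x * indicator A (X1 x) \<partial>M1) \<le> 0" using True by (simp add: c_def)
    qed (use W1 in \<open>auto intro: integral_nonneg\<close>)
    moreover have "(\<integral>x. W2 x * indicator A (X2 x) \<partial>M2) = 0"
    proof (rule antisym)
      have "(\<integral>x. W2 x * indicator A (X2 x) \<partial>M2) \<le> (\<integral>x. W2 x \<partial>M2)"
        by (rule integral_mono'[OF i2]) (use W2 in \<open>auto split: split_indicator\<close>)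
      then show "(\<integral>x. W2 x * indicator A (X2 x) \<partial>M2) \<le> 0" using True by (simp add: c2)
    qed (use W2 in \<open>auto intro: integral_nonneg\<close>)
    ultimately show ?thesis by simp
  next
    case False
    then have c: "c > 0" using c0 by simp
    define D1 where "D1 = distr (density M1 (\<lambda>x. ennreal (W1 x / c))) borel X1"
    define D2 where "D2 = distr (density M2 (\<lambda>x. ennreal (W2 x / c))) borel X2"
    have int1: "integral\<^sup>L D1 f = (\<integral>x. (W1 x / c) *\<^sub>R f (X1 x) \<partial>M1)"
      if [measurable]: "f \<in> borel_measurable borel" for f :: "real \<Rightarrow> 'z::{banach,second_countable_topology}"
      unfolding D1_def using W1 c
      by (subst integral_distr) (auto intro!: integral_density)
    have int2: "integral\<^sup>L D2 f = (\<integral>x. (W2 x / c) *\<^sub>R f (X2 x) \<partial>M2)"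
      if [measurable]: "f \<in> borel_measurable borel" for f :: "real \<Rightarrow> 'z::{banach,second_countable_topology}"
      unfolding D2_def using W2 c
      by (subst integral_distr) (auto intro!: integral_density)
    have p1: "prob_space (density M1 (\<lambda>x. ennreal (W1 x / c)))"
    proof
      have "(\<integral>\<^sup>+x. ennreal (W1 x / c) \<partial>M1) = ennreal (\<integral>x. W1 x / c \<partial>M1)"
        using W1 c i1 by (intro nn_integral_eq_integral) auto
      then show "emeasure (density M1 (\<lambda>x. ennreal (W1 x / c))) (space (density M1 (\<lambda>x. ennreal (W1 x / c)))) = 1"
        using c by (simp add: emeasure_density c_def[symmetric] cong: nn_integral_cong)
    qed
    have p2: "prob_space (density M2 (\<lambda>x. ennreal (W2 x / c)))"
    proof
      have "(\<integral>\<^sup>+x. ennreal (W2 x / c) \<partial>M2) = ennreal (\<integral>x. W2 x / c \<partial>M2)"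
        using W2 c i2 by (intro nn_integral_eq_integral) auto
      then show "emeasure (density M2 (\<lambda>x. ennreal (W2 x / c))) (space (density M2 (\<lambda>x. ennreal (W2 x / c)))) = 1"
        using c by (simp add: emeasure_density c2[symmetric] cong: nn_integral_cong)
    qed
    have r1: "real_distribution D1" unfolding D1_def
      by (intro prob_space.real_distribution_distr p1) simp
    have r2: "real_distribution D2" unfolding D2_def
      by (intro prob_space.real_distribution_distr p2) simp
    have "char D1 = char D2"
    proof
      fix s
      have cs: "(\<integral>x. cos (s * x + b) \<partial>D1) = (\<integral>x. cos (s * x + b) \<partial>D2)" for b
        using eq[of s b] by (subst int1, simp, subst int2) auto
      interpret D1: real_distribution D1 by (rule r1)
      interpret D2: real_distribution D2 by (rule r2)
      have "integrable D1 (\<lambda>x. exp (\<i> * complex_of_real (s * x)))"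
        by (rule D1.integrable_iexp) auto
      note 1 = integral_Re[OF this] integral_Im[OF this]
      have "integrable D2 (\<lambda>x. exp (\<i> * complex_of_real (s * x)))"
        by (rule D2.integrable_iexp) auto
      note 2 = integral_Re[OF this] integral_Im[OF this]
      have sn: "cos (s * x - pi / 2) = sin (s * x)" for x :: real
        by (simp add: cos_diff)
      have "Re (char D1 s) = Re (char D2 s)"
        unfolding char_def using 1(1) 2(1) cs[of 0] by (simp add: Re_exp)
      moreover have "Im (char D1 s) = Im (char D2 s)"
        unfolding char_def using 1(2) 2(2) cs[of "- (pi / 2)"] by (simp add: Im_exp sn)
      ultimately show "char D1 s = char D2 s" by (rule complex_eqI)
    qed
    then have "D1 = D2" by (intro Levy_uniqueness r1 r2)
    then have "(\<integral>x. indicator A x \<partial>D1) = (\<integral>x. indicator A x \<partial>D2 :: real)" by simp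
    then show ?thesis
      using c by (subst (asm) int1, simp, subst (asm) int2) auto
  qed
qed

text \<open>Laws on \<open>\<real>\<^sup>N\<close> are identified one coordinate at a time: the first \<open>j\<close> coordinates are restricted to
  Borel sets, the later ones only enter through a phase, and weighting by \<open>1 + cos\<close> of that phase
  makes the one-dimensional uniqueness theorem applicable to coordinate \<open>j\<close>.\<close>

definition cylinder_cos ::
  "'a measure \<Rightarrow> nat \<Rightarrow> (nat \<Rightarrow> 'a \<Rightarrow> real) \<Rightarrow> nat \<Rightarrow> (nat \<Rightarrow> real set) \<Rightarrow> (nat \<Rightarrow> real) \<Rightarrow> real \<Rightarrow> real" where
  "cylinder_cos M N X j A \<xi> b =
     (\<integral>\<omega>. (\<Prod>i<j. indicator (A i) (X i \<omega>)) * cos ((\<Sum>i\<in>{j..<N}. \<xi> i * X i \<omega>) + b) \<partial>M)"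

lemma prod_indicator_bounds: "0 \<le> (\<Prod>i<j. indicator (A i) (f i) :: real) \<and> (\<Prod>i<j. indicator (A i) (f i) :: real) \<le> 1"
  by (auto intro!: prod_nonneg prod_le_1)

lemma measurable_prod_indicator:
  assumes "\<And>i. i < j \<Longrightarrow> X i \<in> borel_measurable M" "\<And>i. i < j \<Longrightarrow> A i \<in> sets borel"
  shows "(\<lambda>\<omega>. \<Prod>i<j. indicator (A i) (X i \<omega>) :: real) \<in> borel_measurable M"
proof (rule borel_measurable_prod)
  fix i assume "i \<in> {..<j}"
  then have X: "X i \<in> borel_measurable M" and A: "A i \<in> sets borel" using assms by auto
  show "(\<lambda>\<omega>. indicator (A i) (X i \<omega>) :: real) \<in> borel_measurable M"
    by (rule measurable_compose[OF X borel_measurable_indicator[OF A]])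
qed

text \<open>The product-to-sum formula expresses the weighted integral by three values of
  \<open>cylinder_cos\<close> at the same level \<open>j\<close>. The hypothesis of
  \<open>weighted_uniqueness\<close> for coordinate \<open>j\<close> is thus the induction
  hypothesis in \<open>cylinder_cos_eq\<close>.\<close>

lemma cylinder_cos_weight:
  assumes "prob_space M" and [measurable]: "\<And>i. i < N \<Longrightarrow> X i \<in> borel_measurable M" "\<And>i. A i \<in> sets borel"
    and j: "j < N"
  shows "(\<integral>\<omega>. ((\<Prod>i<j. indicator (A i) (X i \<omega>)) * (1 + cos ((\<Sum>i\<in>{Suc j..<N}. \<xi> i * X i \<omega>) + b)))
            * cos (s * X j \<omega> + \<beta>) \<partial>M) =
     cylinder_cos M N X j A ((\<lambda>_. 0)(j := s)) \<beta> +
     (cylinder_cos M N X j A (\<xi>(j := s)) (\<beta> + b) + cylinder_cos M N X j A ((\<lambda>i. - \<xi> i)(j := s)) (\<beta> - b)) / 2"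
proof -
  interpret prob_space M by fact
  let ?w = "\<lambda>\<omega>. (\<Prod>i<j. indicator (A i) (X i \<omega>)) :: real"
  have [measurable]: "?w \<in> borel_measurable M"
    by (rule measurable_prod_indicator) (use j assms in auto)
  have int: "integrable M (\<lambda>\<omega>. ?w \<omega> * cos ((\<Sum>i\<in>{j..<N}. \<eta> i * X i \<omega>) + \<theta>))" for \<eta> \<theta>
  proof (rule integrable_const_bound[of _ 1])
    show "AE \<omega> in M. norm (?w \<omega> * cos ((\<Sum>i\<in>{j..<N}. \<eta> i * X i \<omega>) + \<theta>)) \<le> 1"
    proof (rule AE_I2)
      fix \<omega>
      have "\<bar>?w \<omega>\<bar> * \<bar>cos ((\<Sum>i\<in>{j..<N}. \<eta> i * X i \<omega>) + \<theta>)\<bar> \<le> 1 * 1"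
        using prod_indicator_bounds[of A "\<lambda>i. X i \<omega>" j] by (intro mult_mono) auto
      then show "norm (?w \<omega> * cos ((\<Sum>i\<in>{j..<N}. \<eta> i * X i \<omega>) + \<theta>)) \<le> 1" by (simp add: abs_mult)
    qed
  qed measurable
  have sp: "{j..<N} = insert j {Suc j..<N}" using j by auto
  have S0: "(\<Sum>i\<in>{j..<N}. ((\<lambda>_. 0)(j := s)) i * X i \<omega>) = s * X j \<omega>"
    and S1: "(\<Sum>i\<in>{j..<N}. (\<xi>(j := s)) i * X i \<omega>) = s * X j \<omega> + (\<Sum>i\<in>{Suc j..<N}. \<xi> i * X i \<omega>)"
    and S2: "(\<Sum>i\<in>{j..<N}. ((\<lambda>i. - \<xi> i)(j := s)) i * X i \<omega>) = s * X j \<omega> - (\<Sum>i\<in>{Suc j..<N}. \<xi> i * X i \<omega>)" for \<omega>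
    unfolding sp by (simp_all add: sum_negf)
  have alg: "W * (1 + cV) * cU = W * cU + (W * c1 + W * c2) / 2" if "2 * (cV * cU) = c1 + c2" for W cV cU c1 c2 :: real
  proof -
    have "W * c1 + W * c2 = W * (2 * (cV * cU))" unfolding that by (rule distrib_left[symmetric])
    then show ?thesis by (simp add: distrib_left distrib_right)
  qed
  have cs: "2 * (cos (V + b) * cos (U + \<beta>)) = cos (U + V + (\<beta> + b)) + cos (U - V + (\<beta> - b))" for U V
  proof -
    have "cos (U + V + (\<beta> + b)) = cos ((U + \<beta>) + (V + b))"
      and "cos (U - V + (\<beta> - b)) = cos ((U + \<beta>) - (V + b))" by (simp_all add: algebra_simps)
    then show ?thesis by (simp only: cos_add[of "U + \<beta>" "V + b"] cos_diff[of "U + \<beta>" "V + b"]) (simp add: mult.commute)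
  qed
  note pt = alg[OF cs]
  show ?thesis
    unfolding pt cylinder_cos_def S0 S1 S2
    using int[of "(\<lambda>_. 0)(j := s)" \<beta>, unfolded S0] int[of "\<xi>(j := s)" "\<beta> + b", unfolded S1]
      int[of "(\<lambda>i. - \<xi> i)(j := s)" "\<beta> - b", unfolded S2]
    by (simp only: Bochner_Integration.integral_add Bochner_Integration.integrable_add
        integral_divide_zero integrable_divide)
qed

lemma cylinder_cos_eq:
  assumes "prob_space M1" "prob_space M2"
    and m1: "\<And>i. i < N \<Longrightarrow> X1 i \<in> borel_measurable M1"
    and m2: "\<And>i. i < N \<Longrightarrow> X2 i \<in> borel_measurable M2"
    and eq: "\<And>c b. (\<integral>\<omega>. cos ((\<Sum>i<N. c i * X1 i \<omega>) + b) \<partial>M1) = (\<integral>\<omega>. cos ((\<Sum>i<N. c i * X2 i \<omega>) + b) \<partial>M2)"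
    and A: "\<And>i. A i \<in> sets borel"
  shows "j \<le> N \<Longrightarrow> cylinder_cos M1 N X1 j A \<xi> b = cylinder_cos M2 N X2 j A \<xi> b"
proof (induction j arbitrary: \<xi> b)
  case 0
  then show ?case using eq by (simp add: cylinder_cos_def atLeast0LessThan)
next
  case (Suc j)
  then have j: "j < N" by simp
  note [measurable] = m1 m2 A
  let ?w1 = "\<lambda>\<omega>. (\<Prod>i<j. indicator (A i) (X1 i \<omega>)) :: real"
  let ?w2 = "\<lambda>\<omega>. (\<Prod>i<j. indicator (A i) (X2 i \<omega>)) :: real"
  have [measurable]: "X1 j \<in> borel_measurable M1" "X2 j \<in> borel_measurable M2"
    using j by auto
  have [measurable]: "?w1 \<in> borel_measurable M1" "?w2 \<in> borel_measurable M2"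
    by (rule measurable_prod_indicator; use j m1 m2 A in auto)+
  let ?v1 = "\<lambda>\<xi> b \<omega>. ?w1 \<omega> * (1 + cos ((\<Sum>i\<in>{Suc j..<N}. \<xi> i * X1 i \<omega>) + b))"
  let ?v2 = "\<lambda>\<xi> b \<omega>. ?w2 \<omega> * (1 + cos ((\<Sum>i\<in>{Suc j..<N}. \<xi> i * X2 i \<omega>) + b))"
  have wb: "0 \<le> w * (1 + cos y) \<and> w * (1 + cos y) \<le> 2" if "0 \<le> w \<and> w \<le> 1" for w y :: real
  proof -
    have "0 \<le> 1 + cos y" "1 + cos y \<le> 2" using cos_ge_minus_one[of y] cos_le_one[of y] by linarith+
    then show ?thesis using that mult_mono[of w 1 "1 + cos y" 2] by simp
  qed
  have key: "(\<integral>\<omega>. ?v1 \<xi> b \<omega> * indicator (A j) (X1 j \<omega>) \<partial>M1) = (\<integral>\<omega>. ?v2 \<xi> b \<omega> * indicator (A j) (X2 j \<omega>) \<partial>M2)" for \<xi> b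
  proof (rule weighted_uniqueness[where K = 2])
    show "0 \<le> ?v1 \<xi> b \<omega> \<and> ?v1 \<xi> b \<omega> \<le> 2" for \<omega> by (intro wb prod_indicator_bounds)
    show "0 \<le> ?v2 \<xi> b \<omega> \<and> ?v2 \<xi> b \<omega> \<le> 2" for \<omega> by (intro wb prod_indicator_bounds)
    fix s \<beta>
    show "(\<integral>\<omega>. ?v1 \<xi> b \<omega> * cos (s * X1 j \<omega> + \<beta>) \<partial>M1) = (\<integral>\<omega>. ?v2 \<xi> b \<omega> * cos (s * X2 j \<omega> + \<beta>) \<partial>M2)"
      using cylinder_cos_weight[of M1 N X1 A j \<xi> b s \<beta>] cylinder_cos_weight[of M2 N X2 A j \<xi> b s \<beta>]
        assms(1,2) m1 m2 A Suc.IH j by (simp del: fun_upd_apply)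
  qed (use assms in auto)
  interpret P1: prob_space M1 by fact
  interpret P2: prob_space M2 by fact
  have ub: "norm (w * (1 + cos y) * indicator B z) \<le> 2" if "0 \<le> w \<and> w \<le> 1" for w y z :: real and B
    using wb[OF that, of y] by (auto split: split_indicator)
  have i1: "integrable M1 (\<lambda>\<omega>. ?v1 \<xi> b \<omega> * indicator (A j) (X1 j \<omega>))" for \<xi> b
  proof (rule P1.integrable_const_bound[of _ 2], rule AE_I2)
    show "norm (?v1 \<xi> b \<omega> * indicator (A j) (X1 j \<omega>)) \<le> 2" for \<omega>
      using ub[OF prod_indicator_bounds[of A "\<lambda>i. X1 i \<omega>" j], of "(\<Sum>i\<in>{Suc j..<N}. \<xi> i * X1 i \<omega>) + b" "A j" "X1 j \<omega>"] .
  qed measurable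
  have i2: "integrable M2 (\<lambda>\<omega>. ?v2 \<xi> b \<omega> * indicator (A j) (X2 j \<omega>))" for \<xi> b
  proof (rule P2.integrable_const_bound[of _ 2], rule AE_I2)
    show "norm (?v2 \<xi> b \<omega> * indicator (A j) (X2 j \<omega>)) \<le> 2" for \<omega>
      using ub[OF prod_indicator_bounds[of A "\<lambda>i. X2 i \<omega>" j], of "(\<Sum>i\<in>{Suc j..<N}. \<xi> i * X2 i \<omega>) + b" "A j" "X2 j \<omega>"] .
  qed measurable
  \<comment> \<open>The summand \<open>1\<close> was only there to keep the weight nonnegative. With
    zero phase the factor \<open>1 + cos\<close> is the constant \<open>2\<close>, so half of that
    instance removes it.\<close>
  have "cylinder_cos M1 N X1 (Suc j) A \<xi> b =
     (\<integral>\<omega>. ?v1 \<xi> b \<omega> * indicator (A j) (X1 j \<omega>) - 1/2 * (?v1 (\<lambda>_. 0) 0 \<omega> * indicator (A j) (X1 j \<omega>)) \<partial>M1)"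
    unfolding cylinder_cos_def by (intro Bochner_Integration.integral_cong) (auto simp: algebra_simps)
  also have "\<dots> = (\<integral>\<omega>. ?v2 \<xi> b \<omega> * indicator (A j) (X2 j \<omega>) - 1/2 * (?v2 (\<lambda>_. 0) 0 \<omega> * indicator (A j) (X2 j \<omega>)) \<partial>M2)"
    using key i1 i2 by (simp only: Bochner_Integration.integral_diff integrable_mult_right integral_mult_right_zero)
  also have "\<dots> = cylinder_cos M2 N X2 (Suc j) A \<xi> b"
    unfolding cylinder_cos_def by (intro Bochner_Integration.integral_cong) (auto simp: algebra_simps)
  finally show ?case .
qed

lemma law_eqI:
  fixes N :: nat and X1 :: "nat \<Rightarrow> 'a \<Rightarrow> real" and X2 :: "nat \<Rightarrow> 'b \<Rightarrow> real"
  assumes "prob_space M1" "prob_space M2"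
    and m1[measurable]: "\<And>i. i < N \<Longrightarrow> X1 i \<in> borel_measurable M1"
    and m2[measurable]: "\<And>i. i < N \<Longrightarrow> X2 i \<in> borel_measurable M2"
    and eq: "\<And>c b. (\<integral>\<omega>. cos ((\<Sum>i<N. c i * X1 i \<omega>) + b) \<partial>M1) = (\<integral>\<omega>. cos ((\<Sum>i<N. c i * X2 i \<omega>) + b) \<partial>M2)"
  shows "distr M1 (PiM {..<N} (\<lambda>_. borel)) (\<lambda>\<omega>. \<lambda>i\<in>{..<N}. X1 i \<omega>) =
         distr M2 (PiM {..<N} (\<lambda>_. borel)) (\<lambda>\<omega>. \<lambda>i\<in>{..<N}. X2 i \<omega>)" (is "?D1 = ?D2")
proof -
  interpret P1: prob_space M1 by fact
  interpret P2: prob_space M2 by fact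
  have [measurable]: "(\<lambda>\<omega>. \<lambda>i\<in>{..<N}. X1 i \<omega>) \<in> measurable M1 (PiM {..<N} (\<lambda>_. borel))"
    "(\<lambda>\<omega>. \<lambda>i\<in>{..<N}. X2 i \<omega>) \<in> measurable M2 (PiM {..<N} (\<lambda>_. borel))"
    by (auto intro!: measurable_restrict)
  \<comment> \<open>Once all \<open>N\<close> coordinates are restricted the phase is an empty sum,
    and \<open>cylinder_cos\<close> is the probability of a box.\<close>
  have box: "emeasure (distr M (PiM {..<N} (\<lambda>_. borel)) (\<lambda>\<omega>. \<lambda>i\<in>{..<N}. X i \<omega>)) (PiE {..<N} A) =
      ennreal (cylinder_cos M N X N A' \<xi> 0)"
    if "prob_space M" and [measurable]: "\<And>i. i < N \<Longrightarrow> X i \<in> borel_measurable M" "\<And>i. A' i \<in> sets borel"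
      and A: "\<And>i. i < N \<Longrightarrow> A' i = A i" for M :: "'z measure" and X A A' \<xi>
  proof -
    interpret prob_space M by fact
    have [measurable]: "(\<lambda>\<omega>. \<lambda>i\<in>{..<N}. X i \<omega>) \<in> measurable M (PiM {..<N} (\<lambda>_. borel))"
      by (auto intro!: measurable_restrict)
    have [measurable]: "PiE {..<N} A \<in> sets (PiM {..<N} (\<lambda>_. borel))"
      using A that(3) by (intro sets_PiM_I_finite) (auto simp: A[symmetric])
    let ?B = "(\<lambda>\<omega>. \<lambda>i\<in>{..<N}. X i \<omega>) -` PiE {..<N} A \<inter> space M"
    have "emeasure (distr M (PiM {..<N} (\<lambda>_. borel)) (\<lambda>\<omega>. \<lambda>i\<in>{..<N}. X i \<omega>)) (PiE {..<N} A) = emeasure M ?B"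
      by (rule emeasure_distr) auto
    also have "\<dots> = ennreal (measure M ?B)" by (simp add: emeasure_eq_measure)
    also have "measure M ?B = (\<integral>\<omega>. indicator ?B \<omega> \<partial>M)" by simp
    also have "\<dots> = cylinder_cos M N X N A' \<xi> 0"
      unfolding cylinder_cos_def
    proof (rule Bochner_Integration.integral_cong)
      fix \<omega> assume w: "\<omega> \<in> space M"
      have "(indicator ?B \<omega> :: real) = (\<Prod>i<N. indicator (A' i) (X i \<omega>))"
      proof (cases "\<forall>i<N. X i \<omega> \<in> A i")
        case True
        then show ?thesis using w A by (auto simp: indicator_def PiE_iff)
      next
        case False
        then obtain i where "i < N" "X i \<omega> \<notin> A i" by auto
        then have "(\<Prod>i<N. indicator (A' i) (X i \<omega>) :: real) = 0"
          using A by (intro prod_zero bexI[of _ i]) auto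
        then show ?thesis using \<open>i < N\<close> \<open>X i \<omega> \<notin> A i\<close> by (auto simp: indicator_def PiE_iff)
      qed
      then show "indicator ?B \<omega> = (\<Prod>i<N. indicator (A' i) (X i \<omega>)) * cos ((\<Sum>i\<in>{N..<N}. \<xi> i * X i \<omega>) + 0)"
        by simp
    qed simp
    finally show ?thesis .
  qed
  show "?D1 = ?D2"
  proof (rule measure_eqI_PiM_finite[where I = "{..<N}" and M = "\<lambda>_. borel :: real measure" and A = "\<lambda>_::nat. space (PiM {..<N} (\<lambda>_. borel :: real measure))"])
    fix A :: "nat \<Rightarrow> real set" assume A: "\<And>i. i \<in> {..<N} \<Longrightarrow> A i \<in> sets borel"
    let ?A' = "\<lambda>i. if i < N then A i else {}"
    have A': "\<And>i. ?A' i \<in> sets borel" using A by auto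
    have "emeasure ?D1 (PiE {..<N} A) = ennreal (cylinder_cos M1 N X1 N ?A' (\<lambda>_. 0) 0)"
      by (rule box[OF assms(1) m1 A']) simp_all
    moreover have "emeasure ?D2 (PiE {..<N} A) = ennreal (cylinder_cos M2 N X2 N ?A' (\<lambda>_. 0) 0)"
      by (rule box[OF assms(2) m2 A']) simp_all
    moreover have "cylinder_cos M1 N X1 N ?A' (\<lambda>_. 0) 0 = cylinder_cos M2 N X2 N ?A' (\<lambda>_. 0) 0"
      by (rule cylinder_cos_eq[OF assms(1,2) m1 m2 eq A']) simp_all
    ultimately show "emeasure ?D1 (PiE {..<N} A) = emeasure ?D2 (PiE {..<N} A)" by simp
  next
    show "range (\<lambda>_::nat. space (PiM {..<N} (\<lambda>_. borel :: real measure))) \<subseteq> prod_algebra {..<N} (\<lambda>_. borel)"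
      by (auto simp: space_PiM intro!: prod_algebraI_finite)
    interpret D1: prob_space ?D1 by (rule P1.prob_space_distr) measurable
    show "emeasure ?D1 (space (PiM {..<N} (\<lambda>_. borel :: real measure))) \<noteq> \<infinity>" for i :: nat
      by simp
  qed auto
qed

text \<open>A negative \<open>v\<close> is not excluded by \<open>centered_gaussian_rv\<close>. As
  the real \<open>sqrt\<close> is odd and the density depends only on the square of its parameter,
  \<open>v\<close> and \<open>\<bar>v\<bar>\<close> describe the same law;
  \<open>quad_nonneg\<close> later removes the absolute value.\<close>

lemma centered_gaussian_integral:
  assumes "prob_space M" "centered_gaussian_rv M V v" and [measurable]: "h \<in> borel_measurable borel"
  shows "V \<in> borel_measurable M"
    and "(\<integral>\<omega>. h (V \<omega>) \<partial>M) = (\<integral>x. h (sqrt \<bar>v\<bar> * x) \<partial>std_normal_distribution :: real)"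
    and "integrable std_normal_distribution (\<lambda>x. h (sqrt \<bar>v\<bar> * x)) \<Longrightarrow> integrable M (\<lambda>\<omega>. h (V \<omega>))"
proof -
  interpret prob_space M by fact
  interpret SN: prob_space std_normal_distribution by (rule std_normal_prob_space)
  have "V \<in> borel_measurable M \<and> (\<integral>\<omega>. h (V \<omega>) \<partial>M) = (\<integral>x. h (sqrt \<bar>v\<bar> * x) \<partial>std_normal_distribution) \<and>
    (integrable std_normal_distribution (\<lambda>x. h (sqrt \<bar>v\<bar> * x)) \<longrightarrow> integrable M (\<lambda>\<omega>. h (V \<omega>)))"
  proof (cases "v = 0")
    case True
    then have [measurable]: "V \<in> borel_measurable M" and ae: "AE \<omega> in M. V \<omega> = 0"
      using assms(2) by (auto simp: centered_gaussian_rv_def)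
    have "AE \<omega> in M. h (V \<omega>) = h 0" using ae by eventually_elim simp
    note ae = this
    have "(\<integral>\<omega>. h (V \<omega>) \<partial>M) = (\<integral>\<omega>. h 0 \<partial>M)"
      by (rule integral_cong_AE[OF _ _ ae]) simp_all
    moreover have "integrable M (\<lambda>\<omega>. h (V \<omega>)) = integrable M (\<lambda>\<omega>. h 0)"
      by (rule integrable_cong_AE[OF _ _ ae]) simp_all
    ultimately show ?thesis using True SN.prob_space by (simp add: prob_space)
  next
    case False
    define s where "s = sqrt \<bar>v\<bar>"
    have s: "s > 0" using False by (simp add: s_def)
    have "(sqrt v)\<^sup>2 = s\<^sup>2"
      by (cases "v \<ge> 0") (simp_all add: s_def real_sqrt_minus[of "- v", simplified])
    then have "normal_density 0 (sqrt v) = normal_density 0 s"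
      by (simp add: normal_density_def[abs_def])
    then have "distributed M lborel V (normal_density 0 s)"
      using assms(2) False by (simp add: centered_gaussian_rv_def)
    then have d: "distributed M lborel (\<lambda>\<omega>. V \<omega> / s) std_normal_density"
      using normal_standard_normal_convert[OF s, of V 0] by simp
    have "distr M lborel (\<lambda>\<omega>. V \<omega> / s) = std_normal_distribution"
      by (rule distributed_distr_eq_density[OF d])
    moreover have mV: "(\<lambda>\<omega>. V \<omega> / s) \<in> measurable M lborel" by (rule distributed_measurable[OF d])
    moreover have hs: "(\<lambda>x. h (s * x)) \<in> borel_measurable lborel" by simp
    ultimately have "(\<integral>x. h (s * x) \<partial>std_normal_distribution) = (\<integral>\<omega>. h (s * (V \<omega> / s)) \<partial>M)"
      and "integrable std_normal_distribution (\<lambda>x. h (s * x)) = integrable M (\<lambda>\<omega>. h (s * (V \<omega> / s)))"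
      using integral_distr[OF mV hs] integrable_distr_eq[OF mV hs] by simp_all
    moreover have "V \<in> borel_measurable M"
    proof -
      have "(\<lambda>\<omega>. V \<omega> / s) \<in> borel_measurable M" using mV by simp
      then have "(\<lambda>\<omega>. s * (V \<omega> / s)) \<in> borel_measurable M" by (intro borel_measurable_times borel_measurable_const)
      moreover have "(\<lambda>\<omega>. s * (V \<omega> / s)) = V" using s by auto
      ultimately show ?thesis by simp
    qed
    moreover have "h (s * (V \<omega> / s)) = h (V \<omega>)" for \<omega> using s by simp
    ultimately show ?thesis unfolding s_def[symmetric] by (simp only: simp_thms)
  qed
  then show "V \<in> borel_measurable M"
    and "(\<integral>\<omega>. h (V \<omega>) \<partial>M) = (\<integral>x. h (sqrt \<bar>v\<bar> * x) \<partial>std_normal_distribution)"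
    and "integrable std_normal_distribution (\<lambda>x. h (sqrt \<bar>v\<bar> * x)) \<Longrightarrow> integrable M (\<lambda>\<omega>. h (V \<omega>))"
    by auto
qed

section \<open>Gaussian vectors with prescribed variances of linear combinations\<close>

locale gaussian_family = prob_space M for M :: "'a measure" +
  fixes N :: nat and X :: "nat \<Rightarrow> 'a \<Rightarrow> real" and R :: "nat \<Rightarrow> nat \<Rightarrow> real"
  assumes X_measurable [measurable]: "\<And>i. i < N \<Longrightarrow> X i \<in> borel_measurable M"
    and R_diag: "\<And>i. R i i = 1" and R_sym: "\<And>i j. R i j = R j i"
    and gaussian: "\<And>c. centered_gaussian_rv M (\<lambda>\<omega>. \<Sum>i<N. c i * X i \<omega>) (\<Sum>i<N. \<Sum>j<N. c i * c j * R i j)"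
begin

definition quad :: "(nat \<Rightarrow> real) \<Rightarrow> real" where
  "quad c = (\<Sum>i<N. \<Sum>j<N. c i * c j * R i j)"

lemma combination_second_moment:
  "integrable M (\<lambda>\<omega>. (\<Sum>i<N. c i * X i \<omega>)\<^sup>2)" "(\<integral>\<omega>. (\<Sum>i<N. c i * X i \<omega>)\<^sup>2 \<partial>M) = \<bar>quad c\<bar>"
proof -
  have i: "integrable std_normal_distribution (\<lambda>x. (sqrt \<bar>quad c\<bar> * x)\<^sup>2)"
    using integrable_std_normal_abs_power[of 2] by (simp add: power_mult_distrib)
  note g = centered_gaussian_integral[OF prob_space_axioms gaussian, folded quad_def, of "\<lambda>x. x\<^sup>2"]
  show "integrable M (\<lambda>\<omega>. (\<Sum>i<N. c i * X i \<omega>)\<^sup>2)" by (rule g(3)) (use i in simp_all)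
  have "(\<integral>\<omega>. (\<Sum>i<N. c i * X i \<omega>)\<^sup>2 \<partial>M) = \<bar>quad c\<bar> * (\<integral>x. x\<^sup>2 \<partial>std_normal_distribution)"
    by (subst g(2)) (simp_all add: power_mult_distrib)
  also have "(\<integral>x. x\<^sup>2 \<partial>std_normal_distribution) = (1::real)"
    using std_normal_distribution_even_moments(1)[of 1] by (simp add: fact_numeral)
  finally show "(\<integral>\<omega>. (\<Sum>i<N. c i * X i \<omega>)\<^sup>2 \<partial>M) = \<bar>quad c\<bar>" by simp
qed

lemma X_moments: assumes "i < N" shows "integrable M (\<lambda>\<omega>. \<bar>X i \<omega>\<bar> ^ m)"
proof -
  have e: "(\<Sum>l<N. (if l = i then 1 else 0) * g l) = g i" for g :: "nat \<Rightarrow> real"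
    using assms by (simp add: if_distrib[of "\<lambda>x. x * _"] cong: if_cong)
  have "quad (\<lambda>l. if l = i then 1 else 0) = 1"
    unfolding quad_def by (simp only: mult.assoc e sum_distrib_left[symmetric] R_diag)
  then have "centered_gaussian_rv M (\<lambda>\<omega>. X i \<omega>) 1"
    using gaussian[of "\<lambda>l. if l = i then 1 else 0"] by (simp only: quad_def e)
  from centered_gaussian_integral(3)[OF prob_space_axioms this, of "\<lambda>x. \<bar>x\<bar> ^ m"]
  show ?thesis using integrable_std_normal_abs_power[of m] by simp
qed

lemma two_point_sum:
  assumes "i < N" "j < N"
  shows "(\<Sum>l<N. (\<alpha> * of_bool (l = i) + \<beta> * of_bool (l = j)) * g l) = \<alpha> * g i + \<beta> * (g j :: real)"
  using assms by (simp add: distrib_right sum.distrib of_bool_def if_distrib[of "\<lambda>x. x * _"] if_distrib[of "\<lambda>x. _ * x"] cong: if_cong)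

lemma quad_two_point:
  assumes "i < N" "j < N"
  shows "quad (\<lambda>l. \<alpha> * of_bool (l = i) + \<beta> * of_bool (l = j)) = \<alpha>\<^sup>2 + 2 * \<alpha> * \<beta> * R i j + \<beta>\<^sup>2"
  unfolding quad_def
  by (simp only: mult.assoc sum_distrib_left[symmetric] two_point_sum[OF assms] R_diag)
     (simp add: R_sym[of j i] power2_eq_square algebra_simps)

lemma integrable_XX: assumes "i < N" "j < N" shows "integrable M (\<lambda>\<omega>. X i \<omega> * X j \<omega>)"
proof (rule Bochner_Integration.integrable_bound)
  show "integrable M (\<lambda>\<omega>. (X i \<omega>)\<^sup>2 + (X j \<omega>)\<^sup>2)"
    using X_moments[OF assms(1), of 2] X_moments[OF assms(2), of 2] by simp
  show "AE \<omega> in M. norm (X i \<omega> * X j \<omega>) \<le> norm ((X i \<omega>)\<^sup>2 + (X j \<omega>)\<^sup>2)"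
  proof (rule AE_I2)
    fix \<omega>
    have "\<bar>X i \<omega>\<bar> * \<bar>X j \<omega>\<bar> \<le> (X i \<omega>)\<^sup>2 + (X j \<omega>)\<^sup>2"
    proof -
      have "0 \<le> \<bar>X i \<omega>\<bar> * \<bar>X j \<omega>\<bar>" by simp
      then show ?thesis
        using sum_squares_bound[of "\<bar>X i \<omega>\<bar>" "\<bar>X j \<omega>\<bar>"] unfolding power2_abs by linarith
    qed
    then show "norm (X i \<omega> * X j \<omega>) \<le> norm ((X i \<omega>)\<^sup>2 + (X j \<omega>)\<^sup>2)" by (simp add: abs_mult)
  qed
qed (use assms in measurable)

text \<open>Only second moments of linear combinations are known, and only up to the sign of the
  quadratic form, so that \<open>R\<close> is the covariance has to be derived. Polarisation with
  \<open>X i + X j\<close> and \<open>X i - X j\<close> does it, and nonnegativity of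
  \<open>quad\<close> follows.\<close>

lemma covariance: assumes "i < N" "j < N" shows "(\<integral>\<omega>. X i \<omega> * X j \<omega> \<partial>M) = R i j"
proof -
  have i2: "integrable M (\<lambda>\<omega>. (X i \<omega>)\<^sup>2)" "integrable M (\<lambda>\<omega>. (X j \<omega>)\<^sup>2)"
    using X_moments[OF assms(1), of 2] X_moments[OF assms(2), of 2] by simp_all
  have e: "(\<integral>\<omega>. (\<alpha> * X i \<omega> + \<beta> * X j \<omega>)\<^sup>2 \<partial>M) = \<bar>\<alpha>\<^sup>2 + 2 * \<alpha> * \<beta> * R i j + \<beta>\<^sup>2\<bar>" for \<alpha> \<beta>
    using combination_second_moment(2)[of "\<lambda>l. \<alpha> * of_bool (l = i) + \<beta> * of_bool (l = j)"]
    by (simp only: two_point_sum[OF assms] quad_two_point[OF assms])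
  have x: "(\<integral>\<omega>. (\<alpha> * X i \<omega> + \<beta> * X j \<omega>)\<^sup>2 \<partial>M) =
      \<alpha>\<^sup>2 * (\<integral>\<omega>. (X i \<omega>)\<^sup>2 \<partial>M) + 2 * \<alpha> * \<beta> * (\<integral>\<omega>. X i \<omega> * X j \<omega> \<partial>M) + \<beta>\<^sup>2 * (\<integral>\<omega>. (X j \<omega>)\<^sup>2 \<partial>M)" for \<alpha> \<beta>
  proof -
    have "(\<integral>\<omega>. (\<alpha> * X i \<omega> + \<beta> * X j \<omega>)\<^sup>2 \<partial>M) =
      (\<integral>\<omega>. \<alpha>\<^sup>2 * (X i \<omega>)\<^sup>2 + 2 * \<alpha> * \<beta> * (X i \<omega> * X j \<omega>) + \<beta>\<^sup>2 * (X j \<omega>)\<^sup>2 \<partial>M)"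
      by (intro Bochner_Integration.integral_cong) (simp_all add: power2_eq_square algebra_simps)
    then show ?thesis using i2 integrable_XX[OF assms] by simp
  qed
  let ?c = "\<integral>\<omega>. X i \<omega> * X j \<omega> \<partial>M"
  have "(\<integral>\<omega>. (X i \<omega>)\<^sup>2 \<partial>M) = 1" "(\<integral>\<omega>. (X j \<omega>)\<^sup>2 \<partial>M) = 1"
    using e[of 1 0] e[of 0 1] by simp_all
  then have "2 + 2 * ?c = \<bar>2 + 2 * R i j\<bar>" "2 - 2 * ?c = \<bar>2 - 2 * R i j\<bar>"
    using e[of 1 1] x[of 1 1] e[of 1 "-1"] x[of 1 "-1"] by simp_all
  then show ?thesis by linarith
qed

lemma quad_nonneg: "quad c \<ge> 0"
proof -
  have "(\<integral>\<omega>. (\<Sum>i<N. c i * X i \<omega>)\<^sup>2 \<partial>M) = (\<integral>\<omega>. (\<Sum>i<N. \<Sum>j<N. (c i * c j) * (X i \<omega> * X j \<omega>)) \<partial>M)"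
    by (intro Bochner_Integration.integral_cong) (simp_all add: power2_eq_square sum_product mult_ac)
  also have "\<dots> = quad c"
  proof -
    have "(\<integral>\<omega>. (\<Sum>i<N. \<Sum>j<N. (c i * c j) * (X i \<omega> * X j \<omega>)) \<partial>M) =
        (\<Sum>i<N. \<integral>\<omega>. (\<Sum>j<N. (c i * c j) * (X i \<omega> * X j \<omega>)) \<partial>M)"
      by (intro Bochner_Integration.integral_sum Bochner_Integration.integrable_sum integrable_mult_right integrable_XX; simp)
    also have "\<dots> = (\<Sum>i<N. \<Sum>j<N. \<integral>\<omega>. (c i * c j) * (X i \<omega> * X j \<omega>) \<partial>M)"
      by (intro sum.cong[OF refl] Bochner_Integration.integral_sum integrable_mult_right integrable_XX; simp)
    also have "\<dots> = quad c" unfolding quad_def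
      by (intro sum.cong[OF refl]) (simp add: covariance)
    finally show ?thesis .
  qed
  finally show ?thesis using combination_second_moment(2)[of c] by simp
qed

lemma expectation_cos:
  "(\<integral>\<omega>. cos ((\<Sum>i<N. c i * X i \<omega>) + b) \<partial>M) = cos b * exp (- quad c / 2)"
proof -
  have "(\<integral>\<omega>. cos ((\<Sum>i<N. c i * X i \<omega>) + b) \<partial>M) = (\<integral>x. cos (sqrt \<bar>quad c\<bar> * x + b) \<partial>std_normal_distribution)"
    using centered_gaussian_integral(2)[OF prob_space_axioms gaussian, folded quad_def, of "\<lambda>x. cos (x + b)"] by simp
  then show ?thesis using std_normal_cos quad_nonneg by simp
qed

definition vec :: "'a \<Rightarrow> nat \<Rightarrow> real" where
  "vec \<omega> = (\<lambda>i\<in>{..<N}. X i \<omega>)"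

lemma vec_apply [simp]: "i < N \<Longrightarrow> vec \<omega> i = X i \<omega>"
  by (simp add: vec_def)

lemma vec_measurable [measurable]: "vec \<in> measurable M (PiM {..<N} (\<lambda>_. borel))"
  unfolding vec_def[abs_def] by (auto intro!: measurable_restrict)



text \<open>The vector has the same law when the part of every coordinate that is correlated with
  coordinate \<open>k\<close> is replaced by an independent copy.\<close>

lemma resampled_law:
  assumes k: "k < N"
  shows "distr M (PiM {..<N} (\<lambda>_. borel)) vec =
    distr (M \<Otimes>\<^sub>M std_normal_distribution) (PiM {..<N} (\<lambda>_. borel))
      (\<lambda>z. \<lambda>l\<in>{..<N}. X l (fst z) + R k l * (snd z - X k (fst z)))"
  unfolding vec_def[abs_def]
proof (rule law_eqI)
  interpret SN: prob_space std_normal_distribution by (rule std_normal_prob_space)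
  interpret P: pair_prob_space M std_normal_distribution ..
  show "prob_space M" by (rule prob_space_axioms)
  show "prob_space (M \<Otimes>\<^sub>M std_normal_distribution)" by unfold_locales
  show "X i \<in> borel_measurable M" if "i < N" for i using that by simp
  note [measurable] = X_measurable[OF k]
  show m: "(\<lambda>z. X l (fst z) + R k l * (snd z - X k (fst z))) \<in> borel_measurable (M \<Otimes>\<^sub>M std_normal_distribution)"
    if "l < N" for l
  proof -
    note [measurable] = X_measurable[OF that]
    show ?thesis by measurable
  qed
  fix c b
  let ?Y = "\<lambda>l z. X l (fst z) + R k l * (snd z - X k (fst z))"
  define r where "r = (\<Sum>l<N. c l * R k l)"
  define c' where "c' = (\<lambda>l. c l + (- r) * of_bool (l = k))"
  have i: "integrable (M \<Otimes>\<^sub>M std_normal_distribution) (\<lambda>z. cos ((\<Sum>l<N. c l * ?Y l z) + b))"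
    by (rule P.integrable_const_bound[of _ 1]) (use m in auto)
  have sk: "(\<Sum>l<N. of_bool (l = k) * g l) = g k" for g :: "nat \<Rightarrow> real"
    using two_point_sum[OF k k, of 1 0 g] by simp
  have e: "(\<Sum>l<N. c l * ?Y l (\<omega>, x)) + b = r * x + ((\<Sum>l<N. c' l * X l \<omega>) + b)" for \<omega> x
  proof -
    have "(\<Sum>l<N. c' l * X l \<omega>) = (\<Sum>l<N. c l * X l \<omega>) - r * X k \<omega>"
      using sk[of "\<lambda>l. - r * X l \<omega>"] unfolding c'_def
      by (simp add: algebra_simps sum.distrib sum_subtractf sum_negf)
    moreover have "(\<Sum>l<N. c l * ?Y l (\<omega>, x)) = (\<Sum>l<N. c l * X l \<omega>) + r * x - r * X k \<omega>"
      unfolding r_def by (simp add: algebra_simps sum.distrib sum_subtractf sum_distrib_left sum_distrib_right)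
    ultimately show ?thesis by (simp add: algebra_simps)
  qed
  \<comment> \<open>\<open>r\<close> is the covariance of the linear combination with
    \<open>X k\<close>. Projecting \<open>X k\<close> out lowers the variance by \<open>r^2\<close>,
    and the independent copy puts it back as the factor \<open>exp (- r^2 / 2)\<close>.\<close>
  have q: "quad c' = quad c - r\<^sup>2"
  proof -
    have inner: "(\<Sum>j<N. c' j * R i j) = (\<Sum>j<N. c j * R i j) - r * R i k" for i
      using sk[of "\<lambda>l. - r * R i l"] unfolding c'_def
      by (simp add: algebra_simps sum.distrib sum_subtractf sum_negf)
    have "quad c' = (\<Sum>i<N. c' i * ((\<Sum>j<N. c j * R i j) - r * R i k))"
      unfolding quad_def by (simp only: mult.assoc sum_distrib_left[symmetric] inner)
    also have "\<dots> = (\<Sum>i<N. c i * ((\<Sum>j<N. c j * R i j) - r * R i k)) - r * ((\<Sum>j<N. c j * R k j) - r * R k k)"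
      using sk[of "\<lambda>i. - r * ((\<Sum>j<N. c j * R i j) - r * R i k)"] unfolding c'_def
      by (simp only: distrib_right sum.distrib mult_ac)
    also have "(\<Sum>i<N. c i * ((\<Sum>j<N. c j * R i j) - r * R i k)) = quad c - r * r"
      unfolding quad_def r_def
      by (simp add: algebra_simps sum_subtractf sum_distrib_left sum_distrib_right R_sym[of k])
    also have "(\<Sum>j<N. c j * R k j) - r * R k k = 0" by (simp add: R_diag r_def)
    finally show ?thesis by (simp add: power2_eq_square)
  qed
  have "(\<integral>z. cos ((\<Sum>l<N. c l * ?Y l z) + b) \<partial>(M \<Otimes>\<^sub>M std_normal_distribution)) =
     (\<integral>\<omega>. (\<integral>x. cos (r * x + ((\<Sum>l<N. c' l * X l \<omega>) + b)) \<partial>std_normal_distribution) \<partial>M)"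
    using P.integral_fst'[OF i] by (simp only: e)
  also have "\<dots> = (\<integral>\<omega>. cos ((\<Sum>l<N. c' l * X l \<omega>) + b) * exp (- r\<^sup>2 / 2) \<partial>M)"
    by (simp only: std_normal_cos)
  also have "\<dots> = cos b * exp (- quad c' / 2) * exp (- r\<^sup>2 / 2)"
    by (simp add: expectation_cos)
  also have "\<dots> = cos b * exp (- quad c / 2)"
    by (simp add: q flip: exp_add) (simp add: field_simps)
  finally show "(\<integral>\<omega>. cos ((\<Sum>i<N. c i * X i \<omega>) + b) \<partial>M) =
    (\<integral>z. cos ((\<Sum>l<N. c l * ?Y l z) + b) \<partial>(M \<Otimes>\<^sub>M std_normal_distribution))"
    by (simp add: expectation_cos)
qed

end

section \<open>Functions of polynomial growth and the multivariate integration by parts\<close>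

definition poly_growth :: "nat \<Rightarrow> ((nat \<Rightarrow> real) \<Rightarrow> real) \<Rightarrow> bool" where
  "poly_growth N \<psi> \<longleftrightarrow> \<psi> \<in> borel_measurable (PiM {..<N} (\<lambda>_. borel)) \<and>
     (\<exists>C m. C \<ge> 0 \<and> (\<forall>x. \<bar>\<psi> x\<bar> \<le> C * (1 + (\<Sum>i<N. \<bar>x i\<bar>)) ^ m))"

lemma poly_growth_measurable: "poly_growth N \<psi> \<Longrightarrow> \<psi> \<in> borel_measurable (PiM {..<N} (\<lambda>_. borel))"
  by (simp add: poly_growth_def)

lemma poly_growth_const: "poly_growth N (\<lambda>_. c)"
  unfolding poly_growth_def by (intro conjI exI[of _ "\<bar>c\<bar>"] exI[of _ 0]) auto

lemma poly_growth_mult: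
  assumes "poly_growth N f" "poly_growth N g" shows "poly_growth N (\<lambda>x. f x * g x)"
proof -
  obtain C m D n where f: "f \<in> borel_measurable (PiM {..<N} (\<lambda>_. borel))" "C \<ge> 0" "\<And>x. \<bar>f x\<bar> \<le> C * (1 + (\<Sum>i<N. \<bar>x i\<bar>)) ^ m"
    and g: "g \<in> borel_measurable (PiM {..<N} (\<lambda>_. borel))" "D \<ge> 0" "\<And>x. \<bar>g x\<bar> \<le> D * (1 + (\<Sum>i<N. \<bar>x i\<bar>)) ^ n"
    using assms unfolding poly_growth_def by blast
  have "\<bar>f x * g x\<bar> \<le> (C * D) * (1 + (\<Sum>i<N. \<bar>x i\<bar>)) ^ (m + n)" for x
    using mult_mono[OF f(3)[of x] g(3)[of x]] f(2) g(2)
    by (simp add: abs_mult power_add mult_ac sum_nonneg)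
  then show ?thesis unfolding poly_growth_def using f g by (intro conjI exI[of _ "C * D"] exI[of _ "m + n"]) auto
qed

lemma poly_growth_add:
  assumes "poly_growth N f" "poly_growth N g" shows "poly_growth N (\<lambda>x. f x + g x)"
proof -
  obtain C m D n where f: "f \<in> borel_measurable (PiM {..<N} (\<lambda>_. borel))" "C \<ge> 0" "\<And>x. \<bar>f x\<bar> \<le> C * (1 + (\<Sum>i<N. \<bar>x i\<bar>)) ^ m"
    and g: "g \<in> borel_measurable (PiM {..<N} (\<lambda>_. borel))" "D \<ge> 0" "\<And>x. \<bar>g x\<bar> \<le> D * (1 + (\<Sum>i<N. \<bar>x i\<bar>)) ^ n"
    using assms unfolding poly_growth_def by blast
  have "\<bar>f x + g x\<bar> \<le> (C + D) * (1 + (\<Sum>i<N. \<bar>x i\<bar>)) ^ (m + n)" for x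
  proof -
    let ?y = "1 + (\<Sum>i<N. \<bar>x i\<bar>)"
    have y: "?y \<ge> 1" by (simp add: sum_nonneg)
    have "?y ^ m \<le> ?y ^ (m + n)" "?y ^ n \<le> ?y ^ (m + n)" using y by (intro power_increasing; simp)+
    then have "C * ?y ^ m \<le> C * ?y ^ (m + n)" "D * ?y ^ n \<le> D * ?y ^ (m + n)"
      using f(2) g(2) by (auto intro: mult_left_mono)
    then show ?thesis using f(3)[of x] g(3)[of x] by (simp add: distrib_right)
  qed
  then show ?thesis unfolding poly_growth_def using f g by (intro conjI exI[of _ "C + D"] exI[of _ "m + n"]) auto
qed

lemma poly_growth_sum:
  assumes "finite A" "\<And>i. i \<in> A \<Longrightarrow> poly_growth N (f i)" shows "poly_growth N (\<lambda>x. \<Sum>i\<in>A. f i x)"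
  using assms by (induction A rule: finite_induct) (auto intro: poly_growth_const poly_growth_add)

lemma poly_growth_hermite: assumes "k < N" shows "poly_growth N (\<lambda>x. hermite n (x k))"
proof -
  obtain C where C: "C \<ge> 0" "\<And>x. \<bar>hermite n x\<bar> \<le> C * (1 + \<bar>x\<bar>) ^ n" using hermite_growth by blast
  have "\<bar>hermite n (x k)\<bar> \<le> C * (1 + (\<Sum>i<N. \<bar>x i\<bar>)) ^ n" for x
  proof -
    have "\<bar>x k\<bar> \<le> (\<Sum>i<N. \<bar>x i\<bar>)" using assms by (intro member_le_sum) auto
    then have "C * (1 + \<bar>x k\<bar>) ^ n \<le> C * (1 + (\<Sum>i<N. \<bar>x i\<bar>)) ^ n"
      using C(1) by (intro mult_left_mono power_mono) auto
    then show ?thesis using C(2)[of "x k"] by linarith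
  qed
  then show ?thesis unfolding poly_growth_def using C(1) assms by (intro conjI exI[of _ C] exI[of _ n]) auto
qed

lemma poly_growth_coord: "k < N \<Longrightarrow> poly_growth N (\<lambda>x. x k)"
  using poly_growth_hermite[of k N 1] by (simp add: hermite_Suc[of 0, simplified])

lemma poly_growth_bounded:
  assumes "f \<in> borel_measurable (PiM {..<N} (\<lambda>_. borel))" "\<And>x. \<bar>f x\<bar> \<le> C"
  shows "poly_growth N f"
proof -
  have "C \<ge> 0" using assms(2)[of undefined] by linarith
  then show ?thesis unfolding poly_growth_def using assms by (intro conjI exI[of _ C] exI[of _ 0]) auto
qed

context gaussian_family
begin

lemma integrable_poly_growth:
  assumes "poly_growth N \<psi>" shows "integrable M (\<lambda>\<omega>. \<psi> (vec \<omega>))"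
proof -
  obtain C m where [measurable]: "\<psi> \<in> borel_measurable (PiM {..<N} (\<lambda>_. borel))" and C: "C \<ge> 0"
    and b: "\<And>x. \<bar>\<psi> x\<bar> \<le> C * (1 + (\<Sum>i<N. \<bar>x i\<bar>)) ^ m"
    using assms unfolding poly_growth_def by blast
  have "integrable M (\<lambda>\<omega>. C * (2 ^ m * (2 + real N ^ m * (\<Sum>i<N. \<bar>X i \<omega>\<bar> ^ m))))"
    by (intro integrable_mult_right Bochner_Integration.integrable_add Bochner_Integration.integrable_sum X_moments) auto
  then show ?thesis
  proof (rule Bochner_Integration.integrable_bound)
    show "AE \<omega> in M. norm (\<psi> (vec \<omega>)) \<le> norm (C * (2 ^ m * (2 + real N ^ m * (\<Sum>i<N. \<bar>X i \<omega>\<bar> ^ m))))"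
    proof (rule AE_I2)
      fix \<omega>
      \<comment> \<open>The summand \<open>1\<close> is for \<open>N = 0\<close> and
        \<open>m = 0\<close>, where the left side is \<open>0 ^ 0 = 1\<close>.\<close>
      have "(\<Sum>i<N. \<bar>X i \<omega>\<bar>) ^ m \<le> 1 + real N ^ m * (\<Sum>i<N. \<bar>X i \<omega>\<bar> ^ m)"
      proof (cases "N = 0")
        case False
        define B where "B = Max ((\<lambda>i. \<bar>X i \<omega>\<bar>) ` {..<N})"
        have "B \<in> (\<lambda>i. \<bar>X i \<omega>\<bar>) ` {..<N}" unfolding B_def using False by (intro Max_in) auto
        then obtain j where j: "j < N" "B = \<bar>X j \<omega>\<bar>" by auto
        have "(\<Sum>i<N. \<bar>X i \<omega>\<bar>) \<le> (\<Sum>i<N. B)" by (intro sum_mono) (auto simp: B_def)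
        then have "(\<Sum>i<N. \<bar>X i \<omega>\<bar>) ^ m \<le> (real N * B) ^ m" by (intro power_mono) (auto simp: sum_nonneg)
        also have "\<dots> = real N ^ m * \<bar>X j \<omega>\<bar> ^ m" by (simp add: power_mult_distrib j)
        also have "\<dots> \<le> real N ^ m * (\<Sum>i<N. \<bar>X i \<omega>\<bar> ^ m)"
          using j by (intro mult_left_mono member_le_sum) auto
        finally show ?thesis by simp
      qed (cases m; simp)
      then have "2 ^ m * (1 + (\<Sum>i<N. \<bar>X i \<omega>\<bar>) ^ m) \<le> 2 ^ m * (2 + real N ^ m * (\<Sum>i<N. \<bar>X i \<omega>\<bar> ^ m))"
        by (intro mult_left_mono) auto
      from order_trans[OF one_plus_power_le this]
      have "(1 + (\<Sum>i<N. \<bar>X i \<omega>\<bar>)) ^ m \<le> 2 ^ m * (2 + real N ^ m * (\<Sum>i<N. \<bar>X i \<omega>\<bar> ^ m))"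
        by (simp only: sum_nonneg abs_ge_zero)
      then have "C * (1 + (\<Sum>i<N. \<bar>X i \<omega>\<bar>)) ^ m \<le> C * (2 ^ m * (2 + real N ^ m * (\<Sum>i<N. \<bar>X i \<omega>\<bar> ^ m)))"
        using C by (rule mult_left_mono)
      then show "norm (\<psi> (vec \<omega>)) \<le> norm (C * (2 ^ m * (2 + real N ^ m * (\<Sum>i<N. \<bar>X i \<omega>\<bar> ^ m))))"
        using b[of "vec \<omega>"] by simp
    qed
  qed measurable
qed

text \<open>\<open>\<psi>'\<close> is the derivative of \<open>\<psi>\<close> along row
  \<open>k\<close> of \<open>R\<close>, that is \<open>\<Sum>l. R k l * \<partial>_l \<psi>\<close>.
  In the resampled form of \<open>resampled_law\<close> the vector is, for fixed
  \<open>\<omega>\<close>, a line \<open>y + R k * \<tau>\<close> with standard normal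
  \<open>\<tau>\<close>, and since \<open>R k k = 1\<close> its \<open>k\<close>-th coordinate is
  \<open>\<tau>\<close> itself. The one-dimensional formula then applies on each line, so partial
  derivatives never appear.\<close>

lemma integration_by_parts:
  assumes k: "k < N" and \<psi>: "poly_growth N \<psi>" and \<psi>': "poly_growth N \<psi>'"
    and d: "\<And>y \<tau>. ((\<lambda>\<tau>. \<psi> (\<lambda>l\<in>{..<N}. y l + R k l * \<tau>)) has_real_derivative
                \<psi>' (\<lambda>l\<in>{..<N}. y l + R k l * \<tau>)) (at \<tau>)"
    and c: "\<And>y. continuous_on UNIV (\<lambda>\<tau>. \<psi>' (\<lambda>l\<in>{..<N}. y l + R k l * \<tau>))"
  shows "(\<integral>\<omega>. X k \<omega> * \<psi> (vec \<omega>) \<partial>M) = (\<integral>\<omega>. \<psi>' (vec \<omega>) \<partial>M)"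
proof -
  interpret SN: prob_space std_normal_distribution by (rule std_normal_prob_space)
  interpret P: pair_prob_space M std_normal_distribution ..
  let ?Q = "M \<Otimes>\<^sub>M std_normal_distribution"
  let ?Y = "\<lambda>z. \<lambda>l\<in>{..<N}. X l (fst z) + R k l * (snd z - X k (fst z))"
  note [measurable] = X_measurable[OF k]
  have Ym[measurable]: "?Y \<in> measurable ?Q (PiM {..<N} (\<lambda>_. borel))"
  proof (rule measurable_restrict)
    fix l assume "l \<in> {..<N}"
    then have [measurable]: "X l \<in> borel_measurable M" by simp
    show "(\<lambda>z. X l (fst z) + R k l * (snd z - X k (fst z))) \<in> borel_measurable ?Q" by measurable
  qed
  note [measurable] = poly_growth_measurable[OF \<psi>] poly_growth_measurable[OF \<psi>']
  have tr: "(\<integral>\<omega>. g (vec \<omega>) \<partial>M) = (\<integral>\<omega>. (\<integral>x. g (?Y (\<omega>, x)) \<partial>std_normal_distribution) \<partial>M)"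
    if g: "poly_growth N g" for g
  proof -
    note mg = poly_growth_measurable[OF g]
    have "integrable (distr M (PiM {..<N} (\<lambda>_. borel)) vec) g"
      using integrable_distr_eq[OF vec_measurable mg] integrable_poly_growth[OF g] by blast
    then have "integrable ?Q (\<lambda>z. g (?Y z))"
      unfolding resampled_law[OF k] integrable_distr_eq[OF Ym mg] .
    from P.integral_fst'[OF this]
    have "(\<integral>\<omega>. (\<integral>x. g (?Y (\<omega>, x)) \<partial>std_normal_distribution) \<partial>M) = (\<integral>z. g (?Y z) \<partial>?Q)" .
    also have "\<dots> = integral\<^sup>L (distr ?Q (PiM {..<N} (\<lambda>_. borel)) ?Y) g"
      by (rule integral_distr[OF Ym mg, symmetric])
    also have "\<dots> = (\<integral>\<omega>. g (vec \<omega>) \<partial>M)"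
      unfolding resampled_law[OF k, symmetric] by (rule integral_distr[OF vec_measurable mg])
    finally show ?thesis by simp
  qed
  have "(\<integral>\<omega>. X k \<omega> * \<psi> (vec \<omega>) \<partial>M) = (\<integral>\<omega>. vec \<omega> k * \<psi> (vec \<omega>) \<partial>M)"
    using k by simp
  also have "\<dots> = (\<integral>\<omega>. (\<integral>x. ?Y (\<omega>, x) k * \<psi> (?Y (\<omega>, x)) \<partial>std_normal_distribution) \<partial>M)"
    by (rule tr) (intro poly_growth_mult poly_growth_coord k \<psi>)
  also have "\<dots> = (\<integral>\<omega>. (\<integral>x. \<psi>' (?Y (\<omega>, x)) \<partial>std_normal_distribution) \<partial>M)"
  proof (rule Bochner_Integration.integral_cong[OF refl])
    fix \<omega>
    define y where "y = (\<lambda>l. X l \<omega> - R k l * X k \<omega>)"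
    have Y: "?Y (\<omega>, x) = (\<lambda>l\<in>{..<N}. y l + R k l * x)" for x
      by (rule ext) (simp add: y_def algebra_simps)
    obtain C m where C: "C \<ge> 0" "\<And>x. \<bar>\<psi> x\<bar> \<le> C * (1 + (\<Sum>i<N. \<bar>x i\<bar>)) ^ m"
      using \<psi> unfolding poly_growth_def by blast
    obtain D n where D: "D \<ge> 0" "\<And>x. \<bar>\<psi>' x\<bar> \<le> D * (1 + (\<Sum>i<N. \<bar>x i\<bar>)) ^ n"
      using \<psi>' unfolding poly_growth_def by blast
    define K where "K = 1 + (\<Sum>l<N. \<bar>y l\<bar>) + (\<Sum>l<N. \<bar>R k l\<bar>)"
    have K: "K \<ge> 1" by (simp add: K_def sum_nonneg add_nonneg_nonneg)
    have lin: "1 + (\<Sum>i<N. \<bar>(\<lambda>l\<in>{..<N}. y l + R k l * x) i\<bar>) \<le> K * (1 + \<bar>x\<bar>)" for x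
    proof -
      have "(\<Sum>i<N. \<bar>(\<lambda>l\<in>{..<N}. y l + R k l * x) i\<bar>) \<le> (\<Sum>i<N. \<bar>y i\<bar> + \<bar>R k i\<bar> * \<bar>x\<bar>)"
        by (intro sum_mono) (simp add: abs_triangle_ineq[THEN order_trans] abs_mult)
      also have "\<dots> = (\<Sum>l<N. \<bar>y l\<bar>) + (\<Sum>l<N. \<bar>R k l\<bar>) * \<bar>x\<bar>"
        by (simp add: sum.distrib sum_distrib_right)
      finally have le: "(\<Sum>i<N. \<bar>(\<lambda>l\<in>{..<N}. y l + R k l * x) i\<bar>) \<le> (\<Sum>l<N. \<bar>y l\<bar>) + (\<Sum>l<N. \<bar>R k l\<bar>) * \<bar>x\<bar>" .
      have "0 \<le> (\<Sum>l<N. \<bar>y l\<bar>) * \<bar>x\<bar>" "0 \<le> (\<Sum>l<N. \<bar>R k l\<bar>)" by (simp_all add: sum_nonneg)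
      moreover have "K * (1 + \<bar>x\<bar>) = 1 + (\<Sum>l<N. \<bar>y l\<bar>) + (\<Sum>l<N. \<bar>R k l\<bar>) + \<bar>x\<bar>
          + (\<Sum>l<N. \<bar>y l\<bar>) * \<bar>x\<bar> + (\<Sum>l<N. \<bar>R k l\<bar>) * \<bar>x\<bar>"
        unfolding K_def by (simp add: distrib_left distrib_right)
      ultimately show ?thesis using le abs_ge_zero[of x] by linarith
    qed
    have grow: "E * (1 + (\<Sum>i<N. \<bar>(\<lambda>l\<in>{..<N}. y l + R k l * x) i\<bar>)) ^ j
        \<le> (C + D) * K ^ (m + n) * (1 + \<bar>x\<bar>) ^ (m + n)"
      if "0 \<le> E" "E \<le> C + D" "j \<le> m + n" for E j x
    proof -
      have "(1 + (\<Sum>i<N. \<bar>(\<lambda>l\<in>{..<N}. y l + R k l * x) i\<bar>)) ^ j \<le> (K * (1 + \<bar>x\<bar>)) ^ j"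
        using lin by (intro power_mono) (auto simp: sum_nonneg add_nonneg_nonneg)
      also have "\<dots> \<le> (K * (1 + \<bar>x\<bar>)) ^ (m + n)"
        using K mult_mono[of 1 K 1 "1 + \<bar>x\<bar>"] that by (intro power_increasing) auto
      finally have "E * (1 + (\<Sum>i<N. \<bar>(\<lambda>l\<in>{..<N}. y l + R k l * x) i\<bar>)) ^ j \<le> (C + D) * (K * (1 + \<bar>x\<bar>)) ^ (m + n)"
        using that by (intro mult_mono) (auto simp: sum_nonneg add_nonneg_nonneg)
      then show ?thesis by (simp add: power_mult_distrib mult.assoc)
    qed
    have "(\<integral>x. x * \<psi> (\<lambda>l\<in>{..<N}. y l + R k l * x) \<partial>std_normal_distribution) =
       (\<integral>x. \<psi>' (\<lambda>l\<in>{..<N}. y l + R k l * x) \<partial>std_normal_distribution)"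
    proof (rule gaussian_ibp[OF d c])
      show "\<bar>\<psi> (\<lambda>l\<in>{..<N}. y l + R k l * x)\<bar> \<le> (C + D) * K ^ (m + n) * (1 + \<bar>x\<bar>) ^ (m + n)" for x
        by (rule order_trans[OF C(2) grow]) (use C D in auto)
      show "\<bar>\<psi>' (\<lambda>l\<in>{..<N}. y l + R k l * x)\<bar> \<le> (C + D) * K ^ (m + n) * (1 + \<bar>x\<bar>) ^ (m + n)" for x
        by (rule order_trans[OF D(2) grow]) (use C D in auto)
    qed
    moreover have "(\<lambda>l\<in>{..<N}. y l + R k l * x) k = x" for x
      using k by (simp add: y_def R_diag)
    ultimately show "(\<integral>x. ?Y (\<omega>, x) k * \<psi> (?Y (\<omega>, x)) \<partial>std_normal_distribution) =
      (\<integral>x. \<psi>' (?Y (\<omega>, x)) \<partial>std_normal_distribution)" by (simp only: Y)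
  qed
  also have "\<dots> = (\<integral>\<omega>. \<psi>' (vec \<omega>) \<partial>M)" by (rule tr[OF \<psi>', symmetric])
  finally show ?thesis .
qed

end

section \<open>Diagram bounds\<close>

definition monom6 :: "nat \<Rightarrow> nat \<Rightarrow> nat \<Rightarrow> nat \<Rightarrow> nat \<Rightarrow> nat \<Rightarrow> (nat \<Rightarrow> real) \<Rightarrow> real" where
  "monom6 e0 e1 e2 e3 e4 e5 z = z 0 ^ e0 * z 1 ^ e1 * z 2 ^ e2 * z 3 ^ e3 * z 4 ^ e4 * z 5 ^ e5"

text \<open>Polynomials in the six covariances of four variables \<open>a, b, c, d\<close> (in the order
  \<open>ab, ac, ad, bc, bd, cd\<close>) all of whose monomials are Feynman diagrams with prescribed vertex
  degrees; if the flag is set, every diagram joins \<open>{a, b}\<close> to \<open>{c, d}\<close>.\<close>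

inductive diagram_poly :: "bool \<Rightarrow> nat \<Rightarrow> nat \<Rightarrow> nat \<Rightarrow> nat \<Rightarrow> ((nat \<Rightarrow> real) \<Rightarrow> real) \<Rightarrow> bool"
  for x :: bool where
  zero: "diagram_poly x p1 p2 p3 p4 (\<lambda>z. 0)"
| monom: "e0 + e1 + e2 = p1 \<Longrightarrow> e0 + e3 + e4 = p2 \<Longrightarrow> e1 + e3 + e5 = p3 \<Longrightarrow> e2 + e4 + e5 = p4 \<Longrightarrow>
     (x \<Longrightarrow> e1 + e2 + e3 + e4 > 0) \<Longrightarrow>
     diagram_poly x p1 p2 p3 p4 (\<lambda>z. \<kappa> * monom6 e0 e1 e2 e3 e4 e5 z)"
| add: "diagram_poly x p1 p2 p3 p4 f \<Longrightarrow> diagram_poly x p1 p2 p3 p4 g \<Longrightarrow>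
     diagram_poly x p1 p2 p3 p4 (\<lambda>z. f z + g z)"

text \<open>A new edge raises the degrees of its two end points. The edges \<open>1\<close> to
  \<open>4\<close> cross from \<open>{a, b}\<close> to \<open>{c, d}\<close>, so they establish the
  flag whatever it was before, while \<open>0\<close> and \<open>5\<close> preserve it.\<close>

lemma diagram_poly_mult_edge:
  assumes "diagram_poly x p1 p2 p3 p4 f"
  shows "diagram_poly x (Suc p1) (Suc p2) p3 p4 (\<lambda>z. z 0 * c * f z)"
    and "diagram_poly x' (Suc p1) p2 (Suc p3) p4 (\<lambda>z. z 1 * c * f z)"
    and "diagram_poly x' (Suc p1) p2 p3 (Suc p4) (\<lambda>z. z 2 * c * f z)"
    and "diagram_poly x' p1 (Suc p2) (Suc p3) p4 (\<lambda>z. z 3 * c * f z)"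
    and "diagram_poly x' p1 (Suc p2) p3 (Suc p4) (\<lambda>z. z 4 * c * f z)"
    and "diagram_poly x p1 p2 (Suc p3) (Suc p4) (\<lambda>z. z 5 * c * f z)"
  using assms
proof (induction rule: diagram_poly.induct)
  case (zero p1 p2 p3 p4)
  { case 1 show ?case using diagram_poly.zero by simp next
    case 2 show ?case using diagram_poly.zero by simp next
    case 3 show ?case using diagram_poly.zero by simp next
    case 4 show ?case using diagram_poly.zero by simp next
    case 5 show ?case using diagram_poly.zero by simp next
    case 6 show ?case using diagram_poly.zero by simp }
next
  case (monom e0 e1 e2 p1 e3 e4 p2 e5 p3 p4 \<kappa>)
  { case 1 show ?case
      using diagram_poly.monom[of "Suc e0" e1 e2 "Suc p1" e3 e4 "Suc p2" e5 p3 p4 x "\<kappa> * c"] monom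
      by (simp add: monom6_def mult_ac) next
    case 2 show ?case
      using diagram_poly.monom[of e0 "Suc e1" e2 "Suc p1" e3 e4 p2 e5 "Suc p3" p4 x' "\<kappa> * c"] monom
      by (simp add: monom6_def mult_ac) next
    case 3 show ?case
      using diagram_poly.monom[of e0 e1 "Suc e2" "Suc p1" e3 e4 p2 e5 p3 "Suc p4" x' "\<kappa> * c"] monom
      by (simp add: monom6_def mult_ac) next
    case 4 show ?case
      using diagram_poly.monom[of e0 e1 e2 p1 "Suc e3" e4 "Suc p2" e5 "Suc p3" p4 x' "\<kappa> * c"] monom
      by (simp add: monom6_def mult_ac) next
    case 5 show ?case
      using diagram_poly.monom[of e0 e1 e2 p1 e3 "Suc e4" "Suc p2" e5 p3 "Suc p4" x' "\<kappa> * c"] monom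
      by (simp add: monom6_def mult_ac) next
    case 6 show ?case
      using diagram_poly.monom[of e0 e1 e2 p1 e3 e4 p2 "Suc e5" "Suc p3" "Suc p4" x "\<kappa> * c"] monom
      by (simp add: monom6_def mult_ac) }
next
  case (add p1 p2 p3 p4 f g)
  { case 1 show ?case using diagram_poly.add[OF add.IH(1,7)] by (simp add: distrib_left) next
    case 2 show ?case using diagram_poly.add[OF add.IH(2,8)] by (simp add: distrib_left) next
    case 3 show ?case using diagram_poly.add[OF add.IH(3,9)] by (simp add: distrib_left) next
    case 4 show ?case using diagram_poly.add[OF add.IH(4,10)] by (simp add: distrib_left) next
    case 5 show ?case using diagram_poly.add[OF add.IH(5,11)] by (simp add: distrib_left) next
    case 6 show ?case using diagram_poly.add[OF add.IH(6,12)] by (simp add: distrib_left) }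
qed

text \<open>The expectation of a product of four Hermite polynomials: one leg of the first vertex of
  positive degree is contracted with every leg of the later vertices. There are no loops at a
  vertex, which is the effect of Hermite polynomials as opposed to powers. Truncated subtraction is
  harmless because its term then has the factor \<open>0\<close>.\<close>

fun wick :: "nat \<Rightarrow> nat \<Rightarrow> nat \<Rightarrow> nat \<Rightarrow> (nat \<Rightarrow> real) \<Rightarrow> real" where
  "wick (Suc p1) p2 p3 p4 z = z 0 * real p2 * wick p1 (p2 - 1) p3 p4 z
     + z 1 * real p3 * wick p1 p2 (p3 - 1) p4 z + z 2 * real p4 * wick p1 p2 p3 (p4 - 1) z"
| "wick 0 (Suc p2) p3 p4 z = z 3 * real p3 * wick 0 p2 (p3 - 1) p4 z + z 4 * real p4 * wick 0 p2 p3 (p4 - 1) z"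
| "wick 0 0 (Suc p3) p4 z = z 5 * real p4 * wick 0 0 p3 (p4 - 1) z"
| "wick 0 0 0 (Suc p4) z = 0"
| "wick 0 0 0 0 z = 1"

lemma diagram_poly_wick: "diagram_poly False p1 p2 p3 p4 (wick p1 p2 p3 p4)"
proof (induction "p1 + p2 + p3 + p4" arbitrary: p1 p2 p3 p4 rule: less_induct)
  case less
  note z = diagram_poly.zero
  show ?case
  proof (cases p1)
    case (Suc n)
    have 0: "diagram_poly False p1 p2 p3 p4 (\<lambda>z. z 0 * real p2 * wick n (p2 - 1) p3 p4 z)"
    proof (cases p2)
      case (Suc m)
      then show ?thesis using diagram_poly_mult_edge(1)[OF less[of n m p3 p4]] \<open>p1 = Suc n\<close> by simp
    qed (use z in simp)
    have 1: "diagram_poly False p1 p2 p3 p4 (\<lambda>z. z 1 * real p3 * wick n p2 (p3 - 1) p4 z)"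
    proof (cases p3)
      case (Suc m)
      then show ?thesis using diagram_poly_mult_edge(2)[OF less[of n p2 m p4]] \<open>p1 = Suc n\<close> by simp
    qed (use z in simp)
    have 2: "diagram_poly False p1 p2 p3 p4 (\<lambda>z. z 2 * real p4 * wick n p2 p3 (p4 - 1) z)"
    proof (cases p4)
      case (Suc m)
      then show ?thesis using diagram_poly_mult_edge(3)[OF less[of n p2 p3 m]] \<open>p1 = Suc n\<close> by simp
    qed (use z in simp)
    have "wick p1 p2 p3 p4 = (\<lambda>z. z 0 * real p2 * wick n (p2 - 1) p3 p4 z
     + z 1 * real p3 * wick n p2 (p3 - 1) p4 z + z 2 * real p4 * wick n p2 p3 (p4 - 1) z)"
      using Suc by auto
    then show ?thesis using diagram_poly.add[OF diagram_poly.add[OF 0 1] 2] by simp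
  next
    case p1: 0
    show ?thesis
    proof (cases p2)
      case (Suc n)
      have 1: "diagram_poly False 0 p2 p3 p4 (\<lambda>z. z 3 * real p3 * wick 0 n (p3 - 1) p4 z)"
      proof (cases p3)
        case (Suc m)
        then show ?thesis using diagram_poly_mult_edge(4)[OF less[of 0 n m p4]] \<open>p2 = Suc n\<close> p1 by simp
      qed (use z in simp)
      have 2: "diagram_poly False 0 p2 p3 p4 (\<lambda>z. z 4 * real p4 * wick 0 n p3 (p4 - 1) z)"
      proof (cases p4)
        case (Suc m)
        then show ?thesis using diagram_poly_mult_edge(5)[OF less[of 0 n p3 m]] \<open>p2 = Suc n\<close> p1 by simp
      qed (use z in simp)
      have "wick p1 p2 p3 p4 = (\<lambda>z. z 3 * real p3 * wick 0 n (p3 - 1) p4 z + z 4 * real p4 * wick 0 n p3 (p4 - 1) z)"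
        using Suc p1 by auto
      then show ?thesis using diagram_poly.add[OF 1 2] p1 by simp
    next
      case p2: 0
      show ?thesis
      proof (cases p3)
        case (Suc n)
        have 1: "diagram_poly False 0 0 p3 p4 (\<lambda>z. z 5 * real p4 * wick 0 0 n (p4 - 1) z)"
        proof (cases p4)
          case (Suc m)
          then show ?thesis using diagram_poly_mult_edge(6)[OF less[of 0 0 n m]] \<open>p3 = Suc n\<close> p1 p2 by simp
        qed (use z in simp)
        have "wick p1 p2 p3 p4 = (\<lambda>z. z 5 * real p4 * wick 0 0 n (p4 - 1) z)"
          using Suc p1 p2 by auto
        then show ?thesis using 1 p1 p2 by simp
      next
        case p3: 0
        show ?thesis
        proof (cases p4)
          case 0
          have "wick 0 0 0 0 = (\<lambda>z. 1 * monom6 0 0 0 0 0 0 z)" by (auto simp: monom6_def)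
          then show ?thesis using diagram_poly.monom[of 0 0 0 0 0 0 0 0 0 0 False 1] 0 p1 p2 p3 by simp
        next
          case (Suc n)
          have "wick 0 0 0 (Suc n) = (\<lambda>z. 0)" by auto
          then show ?thesis using z p1 p2 p3 Suc by simp
        qed
      qed
    qed
  qed
qed

text \<open>Contracting \<open>a\<close> with \<open>b\<close> reproduces the same difference in
  lower degree, because the product of the two pair expectations obeys the same recursion along this
  edge. Every other contraction of \<open>a\<close> or \<open>b\<close> is a crossing edge. Without
  legs at \<open>a\<close> and \<open>b\<close> the difference is \<open>0\<close>.\<close>

lemma diagram_poly_wick_cov:
  "diagram_poly True p1 p2 p3 p4 (\<lambda>z. wick p1 p2 p3 p4 z - wick p1 p2 0 0 z * wick 0 0 p3 p4 z)"
proof (induction "p1 + p2" arbitrary: p1 p2 rule: less_induct)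
  case less
  note z = diagram_poly.zero
  show ?case
  proof (cases p1)
    case (Suc n)
    have 0: "diagram_poly True p1 p2 p3 p4 (\<lambda>z. z 0 * real p2 *
       (wick n (p2 - 1) p3 p4 z - wick n (p2 - 1) 0 0 z * wick 0 0 p3 p4 z))"
    proof (cases p2)
      case (Suc m)
      then show ?thesis using diagram_poly_mult_edge(1)[OF less[of n m]] \<open>p1 = Suc n\<close> by simp
    qed (use z in simp)
    have 1: "diagram_poly True p1 p2 p3 p4 (\<lambda>z. z 1 * real p3 * wick n p2 (p3 - 1) p4 z)"
    proof (cases p3)
      case (Suc m)
      then show ?thesis using diagram_poly_mult_edge(2)[OF diagram_poly_wick[of n p2 m p4]] \<open>p1 = Suc n\<close> by simp
    qed (use z in simp)
    have 2: "diagram_poly True p1 p2 p3 p4 (\<lambda>z. z 2 * real p4 * wick n p2 p3 (p4 - 1) z)"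
    proof (cases p4)
      case (Suc m)
      then show ?thesis using diagram_poly_mult_edge(3)[OF diagram_poly_wick[of n p2 p3 m]] \<open>p1 = Suc n\<close> by simp
    qed (use z in simp)
    have "(\<lambda>z. wick p1 p2 p3 p4 z - wick p1 p2 0 0 z * wick 0 0 p3 p4 z) =
      (\<lambda>z. z 0 * real p2 * (wick n (p2 - 1) p3 p4 z - wick n (p2 - 1) 0 0 z * wick 0 0 p3 p4 z)
     + z 1 * real p3 * wick n p2 (p3 - 1) p4 z + z 2 * real p4 * wick n p2 p3 (p4 - 1) z)"
      using Suc by (auto simp: algebra_simps)
    then show ?thesis using diagram_poly.add[OF diagram_poly.add[OF 0 1] 2] by simp
  next
    case p1: 0
    show ?thesis
    proof (cases p2)
      case (Suc n)
      have 1: "diagram_poly True 0 p2 p3 p4 (\<lambda>z. z 3 * real p3 * wick 0 n (p3 - 1) p4 z)"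
      proof (cases p3)
        case (Suc m)
        then show ?thesis using diagram_poly_mult_edge(4)[OF diagram_poly_wick[of 0 n m p4]] \<open>p2 = Suc n\<close> p1 by simp
      qed (use z in simp)
      have 2: "diagram_poly True 0 p2 p3 p4 (\<lambda>z. z 4 * real p4 * wick 0 n p3 (p4 - 1) z)"
      proof (cases p4)
        case (Suc m)
        then show ?thesis using diagram_poly_mult_edge(5)[OF diagram_poly_wick[of 0 n p3 m]] \<open>p2 = Suc n\<close> p1 by simp
      qed (use z in simp)
      have "(\<lambda>z. wick p1 p2 p3 p4 z - wick p1 p2 0 0 z * wick 0 0 p3 p4 z) =
         (\<lambda>z. z 3 * real p3 * wick 0 n (p3 - 1) p4 z + z 4 * real p4 * wick 0 n p3 (p4 - 1) z)"
        using Suc p1 by auto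
      then show ?thesis using diagram_poly.add[OF 1 2] p1 by simp
    next
      case 0
      then have "(\<lambda>z. wick p1 p2 p3 p4 z - wick p1 p2 0 0 z * wick 0 0 p3 p4 z) = (\<lambda>z. 0)"
        using p1 by auto
      then show ?thesis using z by simp
    qed
  qed
qed

lemma wick_pair: "wick p p 0 0 z = fact p * z 0 ^ p"
  by (induction p) (simp_all add: algebra_simps)

lemma wick_pair': "wick 0 0 p p z = fact p * z 5 ^ p"
  by (induction p) (simp_all add: algebra_simps)

text \<open>For fixed total degree \<open>x^e y^w\<close> is log-convex in \<open>e\<close>, hence
  dominated by its values at the extremes \<open>e = 1\<close> and \<open>w = 1\<close>. The proof
  moves all surplus factors of the smaller number to the larger one.\<close>

lemma power_interpolation:
  fixes x y :: real
  assumes "0 \<le> x" "0 \<le> y" "1 \<le> e" "1 \<le> w"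
  shows "x ^ e * y ^ w \<le> x * y ^ (e + w - 1) + x ^ (e + w - 1) * y"
proof (cases "x \<le> y")
  case True
  have "x ^ e * y ^ w = x * x ^ (e - 1) * y ^ w" using assms by (metis power_eq_if not_one_le_zero)
  also have "\<dots> \<le> x * y ^ (e - 1) * y ^ w"
    using True assms by (intro mult_right_mono mult_left_mono power_mono) auto
  also have "\<dots> = x * y ^ (e + w - 1)" using assms by (simp add: mult.assoc flip: power_add)
  finally show ?thesis using assms by (smt (verit) mult_nonneg_nonneg zero_le_power)
next
  case False
  have "x ^ e * y ^ w = x ^ e * (y * y ^ (w - 1))" using assms by (metis power_eq_if not_one_le_zero)
  also have "\<dots> \<le> x ^ e * (y * x ^ (w - 1))"
    using False assms by (intro mult_left_mono power_mono) auto
  also have "\<dots> = x ^ (e + w - 1) * y" using assms by (simp add: mult_ac flip: power_add)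
  finally show ?thesis using assms by (smt (verit) mult_nonneg_nonneg zero_le_power)
qed

lemma power_mult_le_add:
  fixes x y :: real
  assumes "0 \<le> x" "0 \<le> y"
  shows "x ^ u * y ^ v \<le> x ^ (u + v) + y ^ (u + v)"
proof -
  have "x ^ u * y ^ v \<le> max x y ^ u * max x y ^ v" using assms by (intro mult_mono power_mono) auto
  also have "\<dots> = max x y ^ (u + v)" by (simp add: power_add)
  also have "\<dots> \<le> x ^ (u + v) + y ^ (u + v)" using assms by (auto simp: max_def)
  finally show ?thesis .
qed

text \<open>\<open>x\<close>, \<open>u\<close>, \<open>v\<close> belong to the three perfect
  matchings of the four vertices. The union of two matchings is a four-cycle, and
  \<open>x * u ^ p\<close> puts the weights \<open>\<rho>\<close> and \<open>\<rho>^p\<close>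
  alternately on its edges.\<close>

definition cycle_bound :: "nat \<Rightarrow> (nat \<Rightarrow> real) \<Rightarrow> real" where
  "cycle_bound p z = (let x = \<bar>z 0 * z 5\<bar>; u = \<bar>z 1 * z 4\<bar>; v = \<bar>z 2 * z 3\<bar> in
     x * u ^ p + x ^ p * u + x * v ^ p + x ^ p * v)"

text \<open>Equal degrees at all four vertices force opposite edges to have equal multiplicity, so a
  monomial is \<open>x^e0 u^e1 v^e2\<close> with \<open>e0 + e1 + e2 = p\<close>. The flag excludes
  \<open>e0 = p\<close>, the disconnected diagram. The extra factor \<open>z 0 * z 5\<close> raises
  the power of \<open>x\<close> to at least one; merging \<open>u\<close> and \<open>v\<close> and
  then interpolating leaves only four-cycles.\<close>

lemma diagram_poly_bound:
  assumes "diagram_poly True p1 p2 p3 p4 f" "p1 = p" "p2 = p" "p3 = p" "p4 = p"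
  shows "\<exists>K\<ge>0. \<forall>z. \<bar>z 0 * z 5 * f z\<bar> \<le> K * cycle_bound p z"
  using assms
proof (induction rule: diagram_poly.induct)
  case (zero p1 p2 p3 p4)
  then show ?case by (auto intro!: exI[of _ 0])
next
  case (monom e0 e1 e2 p1 e3 e4 p2 e5 p3 p4 \<kappa>)
  then have e: "e5 = e0" "e4 = e1" "e3 = e2" "p = e0 + (e1 + e2)" "e1 + e2 > 0" by auto
  have "\<bar>z 0 * z 5 * (\<kappa> * monom6 e0 e1 e2 e3 e4 e5 z)\<bar> \<le> \<bar>\<kappa>\<bar> * cycle_bound p z" for z
  proof -
    define x u v where "x = \<bar>z 0 * z 5\<bar>" "u = \<bar>z 1 * z 4\<bar>" "v = \<bar>z 2 * z 3\<bar>"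
    note xuv = this
    have "\<bar>z 0 * z 5 * (\<kappa> * monom6 e0 e1 e2 e3 e4 e5 z)\<bar> = \<bar>\<kappa>\<bar> * (x ^ Suc e0 * (u ^ e1 * v ^ e2))"
      unfolding xuv e(1-3) monom6_def by (simp add: abs_mult power_mult_distrib power_abs mult_ac)
    also have "x ^ Suc e0 * (u ^ e1 * v ^ e2) \<le> x ^ Suc e0 * (u ^ (e1 + e2) + v ^ (e1 + e2))"
      by (intro mult_left_mono power_mult_le_add) (auto simp: xuv)
    also have "\<dots> \<le> cycle_bound p z"
    proof -
      have "x ^ Suc e0 * u ^ (e1 + e2) \<le> x * u ^ p + x ^ p * u" "x ^ Suc e0 * v ^ (e1 + e2) \<le> x * v ^ p + x ^ p * v"
        using power_interpolation[of x u "Suc e0" "e1 + e2"] power_interpolation[of x v "Suc e0" "e1 + e2"] e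
        by (auto simp: xuv)
      moreover have "cycle_bound p z = x * u ^ p + x ^ p * u + x * v ^ p + x ^ p * v"
        by (simp add: cycle_bound_def Let_def xuv)
      ultimately show ?thesis by (simp only: distrib_left)
    qed
    finally show ?thesis by (simp add: mult_left_mono)
  qed
  then show ?case by (intro exI[of _ "\<bar>\<kappa>\<bar>"]) auto
next
  case (add p1 p2 p3 p4 f g)
  then obtain K L where K: "K \<ge> 0" "\<And>z. \<bar>z 0 * z 5 * f z\<bar> \<le> K * cycle_bound p z"
    and L: "L \<ge> 0" "\<And>z. \<bar>z 0 * z 5 * g z\<bar> \<le> L * cycle_bound p z" by blast
  have "\<bar>z 0 * z 5 * (f z + g z)\<bar> \<le> (K + L) * cycle_bound p z" for z
    using K(2)[of z] L(2)[of z] by (simp add: distrib_left distrib_right)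
  then show ?case using K L by (intro exI[of _ "K + L"]) auto
qed

lemma wick_covariance_bound:
  "\<exists>K\<ge>0. \<forall>z. \<bar>z 0 * z 5 * (wick p p p p z - fact p * z 0 ^ p * (fact p * z 5 ^ p))\<bar> \<le> K * cycle_bound p z"
  using diagram_poly_bound[OF diagram_poly_wick_cov refl refl refl refl, of p]
  by (simp add: wick_pair wick_pair')

text \<open>The inequality \<open>2 f(a,b) f(c,d) \<le> f(a,b)\<^sup>2 + f(c,d)\<^sup>2\<close> opens the four-cycle into trees.\<close>

lemma cycle_sum_bound:
  fixes f g :: "nat \<Rightarrow> nat \<Rightarrow> real"
  assumes f: "\<And>a b. 0 \<le> f a b" and g: "\<And>a b. 0 \<le> g a b"
    and fs: "\<And>a b. f a b = f b a" and gs: "\<And>a b. g a b = g b a"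
    and A: "\<And>a. a < N \<Longrightarrow> (\<Sum>b<N. (f a b)\<^sup>2) \<le> A" and B: "\<And>a. a < N \<Longrightarrow> (\<Sum>b<N. g a b) \<le> B"
  shows "(\<Sum>a<N. \<Sum>b<N. \<Sum>c<N. \<Sum>d<N. f a b * f c d * (g a c * g b d)) \<le> real N * A * B\<^sup>2"
proof (cases "N = 0")
  case False
  have B0: "B \<ge> 0" using B[of 0] False g by (meson order_trans sum_nonneg neq0_conv)
  have A0: "A \<ge> 0" using A[of 0] False by (meson order_trans sum_nonneg neq0_conv zero_le_power2)
  have T: "(\<Sum>a<N. \<Sum>b<N. \<Sum>c<N. \<Sum>d<N. (f a b)\<^sup>2 * (g a c * g b d)) \<le> real N * A * B\<^sup>2"
  proof -
    have "(\<Sum>a<N. \<Sum>b<N. \<Sum>c<N. \<Sum>d<N. (f a b)\<^sup>2 * (g a c * g b d)) =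
       (\<Sum>a<N. \<Sum>b<N. (f a b)\<^sup>2 * ((\<Sum>c<N. g a c) * (\<Sum>d<N. g b d)))"
      by (simp only: sum_product) (simp only: sum_distrib_left)
    also have "\<dots> \<le> (\<Sum>a<N. \<Sum>b<N. (f a b)\<^sup>2 * (B * B))"
      using B B0 by (intro sum_mono mult_left_mono mult_mono) (auto intro: sum_nonneg g)
    also have "\<dots> = (\<Sum>a<N. (\<Sum>b<N. (f a b)\<^sup>2) * (B * B))"
      by (simp only: sum_distrib_right)
    also have "\<dots> \<le> (\<Sum>a<N. A * (B * B))"
      using A B0 by (intro sum_mono mult_right_mono) auto
    finally show ?thesis by (simp add: power2_eq_square mult_ac)
  qed
  have sw: "(\<Sum>a<N. \<Sum>b<N. \<Sum>c<N. \<Sum>d<N. h c d a b) = (\<Sum>a<N. \<Sum>b<N. \<Sum>c<N. \<Sum>d<N. h a b c d)"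
    for h :: "nat \<Rightarrow> nat \<Rightarrow> nat \<Rightarrow> nat \<Rightarrow> real"
  proof -
    have "(\<Sum>a<N. \<Sum>b<N. \<Sum>c<N. \<Sum>d<N. h c d a b) = (\<Sum>a<N. \<Sum>c<N. \<Sum>b<N. \<Sum>d<N. h c d a b)"
      by (rule sum.cong[OF refl], rule sum.swap)
    also have "\<dots> = (\<Sum>c<N. \<Sum>a<N. \<Sum>b<N. \<Sum>d<N. h c d a b)" by (rule sum.swap)
    also have "\<dots> = (\<Sum>c<N. \<Sum>a<N. \<Sum>d<N. \<Sum>b<N. h c d a b)"
      by (rule sum.cong[OF refl], rule sum.cong[OF refl], rule sum.swap)
    also have "\<dots> = (\<Sum>c<N. \<Sum>d<N. \<Sum>a<N. \<Sum>b<N. h c d a b)"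
      by (rule sum.cong[OF refl], rule sum.swap)
    finally show ?thesis .
  qed
  have "(\<Sum>a<N. \<Sum>b<N. \<Sum>c<N. \<Sum>d<N. f a b * f c d * (g a c * g b d)) \<le>
     (\<Sum>a<N. \<Sum>b<N. \<Sum>c<N. \<Sum>d<N. ((f a b)\<^sup>2 * (g a c * g b d) + (f c d)\<^sup>2 * (g c a * g d b)) / 2)"
  proof (intro sum_mono)
    fix a b c d
    have "f a b * f c d \<le> ((f a b)\<^sup>2 + (f c d)\<^sup>2) / 2"
      using sum_squares_bound[of "f a b" "f c d"] by simp
    then have "f a b * f c d * (g a c * g b d) \<le> ((f a b)\<^sup>2 + (f c d)\<^sup>2) / 2 * (g a c * g b d)"
      using g by (intro mult_right_mono) auto
    then show "f a b * f c d * (g a c * g b d) \<le> ((f a b)\<^sup>2 * (g a c * g b d) + (f c d)\<^sup>2 * (g c a * g d b)) / 2"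
      using gs[of a c] gs[of b d] by (simp add: field_simps)
  qed
  also have "\<dots> = ((\<Sum>a<N. \<Sum>b<N. \<Sum>c<N. \<Sum>d<N. (f a b)\<^sup>2 * (g a c * g b d)) +
       (\<Sum>a<N. \<Sum>b<N. \<Sum>c<N. \<Sum>d<N. (f c d)\<^sup>2 * (g c a * g d b))) / 2"
    by (simp only: sum_divide_distrib[symmetric] sum.distrib)
  also have "\<dots> = (\<Sum>a<N. \<Sum>b<N. \<Sum>c<N. \<Sum>d<N. (f a b)\<^sup>2 * (g a c * g b d))"
    using sw[of "\<lambda>a b c d. (f a b)\<^sup>2 * (g a c * g b d)"] by simp
  finally show ?thesis using T by linarith
qed simp

lemma has_derivative_hermite [derivative_intros]:
  "(f has_real_derivative D) (at x) \<Longrightarrow>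
   ((\<lambda>x. hermite n (f x)) has_real_derivative real n * hermite (n - 1) (f x) * D) (at x)"
  by (rule DERIV_chain2[OF hermite_deriv])

section \<open>Moments of four Hermite polynomials, and the formula for one Hermite polynomial
  against a sine\<close>

context gaussian_family
begin

definition moment4 where
  "moment4 a p1 b p2 c p3 e p4 =
     (\<integral>\<omega>. hermite p1 (X a \<omega>) * (hermite p2 (X b \<omega>) * hermite p3 (X c \<omega>) * hermite p4 (X e \<omega>)) \<partial>M)"

text \<open>Integration by parts also differentiates the factor at \<open>a\<close> itself, but this
  term \<open>\<psi>1\<close> is exactly what the recursion for \<open>hermite (Suc p1)\<close>
  subtracts. Nothing requires the four indices to be distinct.\<close>

lemma moment4_Suc:
  assumes a: "a < N" and b: "b < N" and c: "c < N" and e: "e < N"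
  shows "moment4 a (Suc p1) b p2 c p3 e p4 =
     R a b * real p2 * moment4 a p1 b (p2 - 1) c p3 e p4 +
     R a c * real p3 * moment4 a p1 b p2 c (p3 - 1) e p4 +
     R a e * real p4 * moment4 a p1 b p2 c p3 e (p4 - 1)"
proof -
  let ?h = "hermite"
  define \<psi> where "\<psi> = (\<lambda>x. ?h p1 (x a) * (?h p2 (x b) * ?h p3 (x c) * ?h p4 (x e)))"
  define \<psi>1 where "\<psi>1 = (\<lambda>x. real p1 * (?h (p1 - 1) (x a) * (?h p2 (x b) * ?h p3 (x c) * ?h p4 (x e))))"
  define \<psi>2 where "\<psi>2 = (\<lambda>x. (R a b * real p2) * (?h p1 (x a) * (?h (p2 - 1) (x b) * ?h p3 (x c) * ?h p4 (x e))))"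
  define \<psi>3 where "\<psi>3 = (\<lambda>x. (R a c * real p3) * (?h p1 (x a) * (?h p2 (x b) * ?h (p3 - 1) (x c) * ?h p4 (x e))))"
  define \<psi>4 where "\<psi>4 = (\<lambda>x. (R a e * real p4) * (?h p1 (x a) * (?h p2 (x b) * ?h p3 (x c) * ?h (p4 - 1) (x e))))"
  note defs = \<psi>_def \<psi>1_def \<psi>2_def \<psi>3_def \<psi>4_def
  note pg = poly_growth_mult poly_growth_hermite poly_growth_const a b c e
  have g: "poly_growth N \<psi>" "poly_growth N \<psi>1" "poly_growth N \<psi>2" "poly_growth N \<psi>3" "poly_growth N \<psi>4"
    unfolding defs by (intro pg)+
  note int = g[THEN integrable_poly_growth]
  have gX: "poly_growth N (\<lambda>x. x a * \<psi> x)" by (intro poly_growth_mult poly_growth_coord a g)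
  note intX = integrable_poly_growth[OF gX]
  have ibp: "(\<integral>\<omega>. X a \<omega> * \<psi> (vec \<omega>) \<partial>M) = (\<integral>\<omega>. \<psi>1 (vec \<omega>) + \<psi>2 (vec \<omega>) + \<psi>3 (vec \<omega>) + \<psi>4 (vec \<omega>) \<partial>M)"
  proof (rule integration_by_parts[OF a g(1)])
    show "poly_growth N (\<lambda>x. \<psi>1 x + \<psi>2 x + \<psi>3 x + \<psi>4 x)" by (intro poly_growth_add g)
    fix y :: "nat \<Rightarrow> real"
    let ?l = "\<lambda>\<tau>. \<lambda>l\<in>{..<N}. y l + R a l * \<tau>"
    show "((\<lambda>\<tau>. \<psi> (?l \<tau>)) has_real_derivative \<psi>1 (?l \<tau>) + \<psi>2 (?l \<tau>) + \<psi>3 (?l \<tau>) + \<psi>4 (?l \<tau>)) (at \<tau>)" for \<tau>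
      unfolding defs using a b c e
      by (auto intro!: derivative_eq_intros simp: R_diag algebra_simps)
    show "continuous_on UNIV (\<lambda>\<tau>. \<psi>1 (?l \<tau>) + \<psi>2 (?l \<tau>) + \<psi>3 (?l \<tau>) + \<psi>4 (?l \<tau>))"
      unfolding defs using a b c e by (auto intro!: continuous_intros)
  qed
  have "moment4 a (Suc p1) b p2 c p3 e p4 = (\<integral>\<omega>. X a \<omega> * \<psi> (vec \<omega>) - \<psi>1 (vec \<omega>) \<partial>M)"
    unfolding moment4_def defs using a b c e
    by (intro Bochner_Integration.integral_cong) (simp_all add: hermite_Suc algebra_simps)
  also have "\<dots> = (\<integral>\<omega>. \<psi>2 (vec \<omega>) \<partial>M) + (\<integral>\<omega>. \<psi>3 (vec \<omega>) \<partial>M) + (\<integral>\<omega>. \<psi>4 (vec \<omega>) \<partial>M)"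
    using ibp int intX a by simp
  also have "(\<integral>\<omega>. \<psi>2 (vec \<omega>) \<partial>M) = R a b * real p2 * moment4 a p1 b (p2 - 1) c p3 e p4"
    using a b c e by (simp add: \<psi>2_def moment4_def)
  also have "(\<integral>\<omega>. \<psi>3 (vec \<omega>) \<partial>M) = R a c * real p3 * moment4 a p1 b p2 c (p3 - 1) e p4"
    using a b c e by (simp add: \<psi>3_def moment4_def)
  also have "(\<integral>\<omega>. \<psi>4 (vec \<omega>) \<partial>M) = R a e * real p4 * moment4 a p1 b p2 c p3 e (p4 - 1)"
    using a b c e by (simp add: \<psi>4_def moment4_def)
  finally show ?thesis .
qed

definition edges :: "nat \<Rightarrow> nat \<Rightarrow> nat \<Rightarrow> nat \<Rightarrow> nat \<Rightarrow> real" where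
  "edges a b c e n = [R a b, R a c, R a e, R b c, R b e, R c e] ! n"

lemma edges_simps [simp]:
  "edges a b c e 0 = R a b" "edges a b c e 1 = R a c" "edges a b c e (Suc 0) = R a c" "edges a b c e 2 = R a e"
  "edges a b c e 3 = R b c" "edges a b c e 4 = R b e" "edges a b c e 5 = R c e"
  by (simp_all add: edges_def numeral_eq_Suc)

lemma moment4_wick:
  assumes "a < N" "b < N" "c < N" "e < N"
  shows "moment4 a p1 b p2 c p3 e p4 = wick p1 p2 p3 p4 (edges a b c e)"
proof (induction "p1 + p2 + p3 + p4" arbitrary: p1 p2 p3 p4 rule: less_induct)
  case less
  have sub: "real m * moment4 a q1 b q2 c q3 e q4 = real m * wick q1 q2 q3 q4 (edges a b c e)"
    if "m > 0 \<Longrightarrow> q1 + q2 + q3 + q4 < p1 + p2 + p3 + p4" for m q1 q2 q3 q4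
    using less[OF that] by (cases "m = 0") auto
  show ?case
  proof (cases p1)
    case (Suc n)
    have "moment4 a (Suc n) b p2 c p3 e p4 = R a b * (real p2 * moment4 a n b (p2 - 1) c p3 e p4) +
     R a c * (real p3 * moment4 a n b p2 c (p3 - 1) e p4) + R a e * (real p4 * moment4 a n b p2 c p3 e (p4 - 1))"
      using moment4_Suc[OF assms, of n p2 p3 p4] by (simp only: mult.assoc)
    also have "\<dots> = R a b * (real p2 * wick n (p2 - 1) p3 p4 (edges a b c e)) +
     R a c * (real p3 * wick n p2 (p3 - 1) p4 (edges a b c e)) + R a e * (real p4 * wick n p2 p3 (p4 - 1) (edges a b c e))"
      using Suc by (subst (1 2 3) sub) auto
    finally show ?thesis using Suc by (simp add: mult.assoc)
  next
    case p1: 0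
    show ?thesis
    proof (cases p2)
      case (Suc n)
      \<comment> \<open>A vertex of degree \<open>0\<close> may be replaced by any other:
        \<open>b\<close> moves to the front and a copy of \<open>b\<close> with degree
        \<open>0\<close> fills its place, contributing nothing to
        \<open>moment4_Suc\<close>.\<close>
      have "moment4 a 0 b (Suc n) c p3 e p4 = moment4 b (Suc n) b 0 c p3 e p4"
        by (simp add: moment4_def mult.assoc)
      also have "\<dots> = R b c * (real p3 * moment4 a 0 b n c (p3 - 1) e p4) + R b e * (real p4 * moment4 a 0 b n c p3 e (p4 - 1))"
        using moment4_Suc[OF assms(2) assms(2-4), of n 0 p3 p4] by (simp add: moment4_def mult.assoc)
      also have "\<dots> = R b c * (real p3 * wick 0 n (p3 - 1) p4 (edges a b c e)) + R b e * (real p4 * wick 0 n p3 (p4 - 1) (edges a b c e))"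
        using Suc p1 by (subst (1 2) sub) auto
      finally show ?thesis using Suc p1 by (simp add: mult.assoc)
    next
      case p2: 0
      show ?thesis
      proof (cases p3)
        case (Suc n)
        have "moment4 a 0 b 0 c (Suc n) e p4 = moment4 c (Suc n) c 0 c 0 e p4"
          by (simp add: moment4_def)
        also have "\<dots> = R c e * (real p4 * moment4 a 0 b 0 c n e (p4 - 1))"
          using moment4_Suc[OF assms(3) assms(3) assms(3-4), of n 0 0 p4] by (simp add: moment4_def mult.assoc)
        also have "\<dots> = R c e * (real p4 * wick 0 0 n (p4 - 1) (edges a b c e))"
          using Suc p1 p2 by (subst sub) auto
        finally show ?thesis using Suc p1 p2 by (simp add: mult.assoc)
      next
        case p3: 0
        show ?thesis
        proof (cases p4)
          case 0
          then show ?thesis using p1 p2 p3 by (simp add: moment4_def prob_space)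
        next
          case (Suc n)
          have "moment4 a 0 b 0 c 0 e (Suc n) = moment4 e (Suc n) e 0 e 0 e 0"
            by (simp add: moment4_def)
          also have "\<dots> = 0"
            using moment4_Suc[OF assms(4) assms(4) assms(4) assms(4), of n 0 0 0] by simp
          finally show ?thesis using Suc p1 p2 p3 by simp
        qed
      qed
    qed
  qed
qed

lemma hermite_covariance:
  assumes "a < N" "b < N"
  shows "(\<integral>\<omega>. hermite p (X a \<omega>) * hermite p (X b \<omega>) \<partial>M) = fact p * R a b ^ p"
  using moment4_wick[OF assms assms, of p p 0 0] by (simp add: moment4_def wick_pair)

text \<open>The Stein kernel identity for a single Hermite summand. Differentiating the phase along
  row \<open>k\<close> gives the cosine terms; the derivative of the factor
  \<open>hermite p (X k)\<close> cancels against the Hermite recursion.\<close>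

lemma hermite_sin_ibp:
  assumes k: "k < N"
  shows "(\<integral>\<omega>. hermite (Suc p) (X k \<omega>) * sin ((\<Sum>l<N. \<alpha> l * hermite (Suc p) (X l \<omega>)) + \<beta>) \<partial>M) =
    (\<Sum>l<N. \<alpha> l * R k l * real (Suc p) *
       (\<integral>\<omega>. hermite p (X k \<omega>) * hermite p (X l \<omega>) * cos ((\<Sum>l<N. \<alpha> l * hermite (Suc p) (X l \<omega>)) + \<beta>) \<partial>M))"
proof -
  define P where "P = (\<lambda>x::nat \<Rightarrow> real. (\<Sum>l<N. \<alpha> l * hermite (Suc p) (x l)) + \<beta>)"
  define \<psi> where "\<psi> = (\<lambda>x. hermite p (x k) * sin (P x))"
  define \<psi>1 where "\<psi>1 = (\<lambda>x. real p * (hermite (p - 1) (x k) * sin (P x)))"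
  define \<psi>2 where "\<psi>2 = (\<lambda>x. \<Sum>l<N. (\<alpha> l * R k l * real (Suc p)) * (hermite p (x k) * hermite p (x l) * cos (P x)))"
  have Pm: "P \<in> borel_measurable (PiM {..<N} (\<lambda>_. borel))"
    unfolding P_def
  proof (intro borel_measurable_add borel_measurable_sum borel_measurable_times borel_measurable_const)
    fix l assume "l \<in> {..<N}"
    then show "(\<lambda>x. hermite (Suc p) (x l)) \<in> borel_measurable (PiM {..<N} (\<lambda>_. borel))"
      using poly_growth_measurable[OF poly_growth_hermite] by blast
  qed
  have gs: "poly_growth N (\<lambda>x. sin (P x))" "poly_growth N (\<lambda>x. cos (P x))"
    by (rule poly_growth_bounded[of _ _ 1]; use Pm in simp)+
  have g: "poly_growth N \<psi>" "poly_growth N \<psi>1" unfolding \<psi>_def \<psi>1_def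
    by (intro poly_growth_mult poly_growth_const poly_growth_hermite gs k)+
  have gl: "poly_growth N (\<lambda>x. hermite p (x k) * hermite p (x l) * cos (P x))" if "l < N" for l
    using that by (intro poly_growth_mult poly_growth_hermite gs k)
  have g2: "poly_growth N \<psi>2" unfolding \<psi>2_def
    by (intro poly_growth_sum poly_growth_mult[OF poly_growth_const] gl) auto
  have vP: "P (vec \<omega>) = (\<Sum>l<N. \<alpha> l * hermite (Suc p) (X l \<omega>)) + \<beta>" for \<omega>
    unfolding P_def by simp
  have ibp: "(\<integral>\<omega>. X k \<omega> * \<psi> (vec \<omega>) \<partial>M) = (\<integral>\<omega>. \<psi>1 (vec \<omega>) + \<psi>2 (vec \<omega>) \<partial>M)"
  proof (rule integration_by_parts[OF k g(1) poly_growth_add[OF g(2) g2]])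
    fix y :: "nat \<Rightarrow> real"
    let ?l = "\<lambda>\<tau>. \<lambda>l\<in>{..<N}. y l + R k l * \<tau>"
    have Pl: "P (?l \<tau>) = (\<Sum>l<N. \<alpha> l * hermite (Suc p) (y l + R k l * \<tau>)) + \<beta>" for \<tau>
      unfolding P_def by simp
    have dP: "((\<lambda>\<tau>. P (?l \<tau>)) has_real_derivative (\<Sum>l<N. \<alpha> l * R k l * real (Suc p) * hermite p (?l \<tau> l))) (at \<tau>)" for \<tau>
    proof -
      have "((\<lambda>\<tau>. \<alpha> l * hermite (Suc p) (y l + R k l * \<tau>)) has_real_derivative
          \<alpha> l * R k l * real (Suc p) * hermite p (y l + R k l * \<tau>)) (at \<tau>)" for l
        by (auto intro!: derivative_eq_intros simp: algebra_simps)
      then have "((\<lambda>\<tau>. (\<Sum>l<N. \<alpha> l * hermite (Suc p) (y l + R k l * \<tau>)) + \<beta>) has_real_derivative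
          (\<Sum>l<N. \<alpha> l * R k l * real (Suc p) * hermite p (y l + R k l * \<tau>)) + 0) (at \<tau>)"
        by (intro DERIV_add DERIV_sum DERIV_const)
      then show ?thesis unfolding Pl by simp
    qed
    have dk: "((\<lambda>\<tau>. hermite p (?l \<tau> k)) has_real_derivative real p * hermite (p - 1) (?l \<tau> k)) (at \<tau>)" for \<tau>
      using k by (auto intro!: derivative_eq_intros simp: R_diag)
    show "((\<lambda>\<tau>. \<psi> (?l \<tau>)) has_real_derivative \<psi>1 (?l \<tau>) + \<psi>2 (?l \<tau>)) (at \<tau>)" for \<tau>
    proof -
      have "((\<lambda>\<tau>. hermite p (?l \<tau> k) * sin (P (?l \<tau>))) has_real_derivative
          real p * hermite (p - 1) (?l \<tau> k) * sin (P (?l \<tau>)) +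
          cos (P (?l \<tau>)) * (\<Sum>l<N. \<alpha> l * R k l * real (Suc p) * hermite p (?l \<tau> l)) * hermite p (?l \<tau> k)) (at \<tau>)"
        by (intro DERIV_mult dk DERIV_chain2[OF DERIV_sin dP])
      moreover have "real p * hermite (p - 1) (?l \<tau> k) * sin (P (?l \<tau>)) +
          cos (P (?l \<tau>)) * (\<Sum>l<N. \<alpha> l * R k l * real (Suc p) * hermite p (?l \<tau> l)) * hermite p (?l \<tau> k)
          = \<psi>1 (?l \<tau>) + \<psi>2 (?l \<tau>)"
        unfolding \<psi>1_def \<psi>2_def by (simp only: sum_distrib_left sum_distrib_right mult_ac)
      ultimately show ?thesis unfolding \<psi>_def by simp
    qed
    have cP: "continuous_on UNIV (\<lambda>\<tau>. P (?l \<tau>))"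
      using dP by (meson DERIV_isCont continuous_at_imp_continuous_on)
    have ch: "continuous_on UNIV (\<lambda>\<tau>. hermite m (?l \<tau> l))" if "l < N" for m l
      using that by (auto intro!: continuous_intros)
    show "continuous_on UNIV (\<lambda>\<tau>. \<psi>1 (?l \<tau>) + \<psi>2 (?l \<tau>))"
      unfolding \<psi>1_def \<psi>2_def
      by (intro continuous_on_add continuous_on_sum continuous_on_mult continuous_on_const continuous_on_sin continuous_on_cos ch k cP) auto
  qed
  have gX: "poly_growth N (\<lambda>x. x k * \<psi> x)" by (intro poly_growth_mult poly_growth_coord k g)
  have "(\<integral>\<omega>. hermite (Suc p) (X k \<omega>) * sin ((\<Sum>l<N. \<alpha> l * hermite (Suc p) (X l \<omega>)) + \<beta>) \<partial>M) =
     (\<integral>\<omega>. X k \<omega> * \<psi> (vec \<omega>) - \<psi>1 (vec \<omega>) \<partial>M)"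
    unfolding \<psi>_def \<psi>1_def vP using k
    by (intro Bochner_Integration.integral_cong) (simp_all add: hermite_Suc left_diff_distrib mult.assoc)
  also have "\<dots> = (\<integral>\<omega>. \<psi>2 (vec \<omega>) \<partial>M)"
    using ibp integrable_poly_growth[OF g(2)] integrable_poly_growth[OF g2] integrable_poly_growth[OF gX] k by simp
  also have "\<dots> = (\<Sum>l<N. \<integral>\<omega>. (\<alpha> l * R k l * real (Suc p)) * (hermite p (vec \<omega> k) * hermite p (vec \<omega> l) * cos (P (vec \<omega>))) \<partial>M)"
    unfolding \<psi>2_def
    by (intro Bochner_Integration.integral_sum integrable_mult_right integrable_poly_growth[OF gl]) simp
  also have "\<dots> = (\<Sum>l<N. \<alpha> l * R k l * real (Suc p) *
       (\<integral>\<omega>. hermite p (X k \<omega>) * hermite p (X l \<omega>) * cos ((\<Sum>l<N. \<alpha> l * hermite (Suc p) (X l \<omega>)) + \<beta>) \<partial>M))"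
    using k by (intro sum.cong refl) (simp add: vP)
  finally show ?thesis .
qed

end

section \<open>Trigonometric polynomials under the Gaussian law\<close>

lemma std_gauss_prob: "product_prob_space (\<lambda>_::nat. std_normal_distribution)"
  by (intro product_prob_spaceI std_normal_prob_space)

lemma prob_space_std_gauss: "prob_space (std_gauss d)"
proof -
  interpret product_prob_space "\<lambda>_::nat. std_normal_distribution" by (rule std_gauss_prob)
  show ?thesis unfolding std_gauss_def by (rule prob_space_PiM) (rule std_normal_prob_space)
qed

lemma sets_std_gauss [measurable_cong]: "sets (std_gauss d) = sets (PiM {..<d} (\<lambda>_. borel))"
  unfolding std_gauss_def by (intro sets_PiM_cong) auto

lemma space_std_gauss: "space (std_gauss d) = PiE {..<d} (\<lambda>_. UNIV)"
  unfolding std_gauss_def by (simp add: space_PiM)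

lemma std_gauss_component:
  assumes "i < d" and [measurable]: "f \<in> borel_measurable borel"
  shows "(\<integral>z. f (z i) \<partial>std_gauss d) = (\<integral>x. f x \<partial>std_normal_distribution :: real)"
    and "integrable std_normal_distribution f \<Longrightarrow> integrable (std_gauss d) (\<lambda>z. f (z i))"
proof -
  interpret product_prob_space "\<lambda>_::nat. std_normal_distribution" by (rule std_gauss_prob)
  have c: "distr (std_gauss d) std_normal_distribution (\<lambda>z. z i) = std_normal_distribution"
    unfolding std_gauss_def
    by (rule distr_PiM_component) (use std_normal_prob_space assms in auto)
  have m: "(\<lambda>z. z i) \<in> measurable (std_gauss d) std_normal_distribution" and f: "f \<in> borel_measurable std_normal_distribution"
    using assms by auto
  show "(\<integral>z. f (z i) \<partial>std_gauss d) = (\<integral>x. f x \<partial>std_normal_distribution)"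
    using integral_distr[OF m f] c by simp
  show "integrable (std_gauss d) (\<lambda>z. f (z i))" if "integrable std_normal_distribution f"
    using integrable_distr_eq[OF m f] c that by simp
qed

lemma std_gauss_abs:
  assumes "i < d"
  shows "integrable (std_gauss d) (\<lambda>z. \<bar>z i\<bar>)" "(\<integral>z. \<bar>z i\<bar> \<partial>std_gauss d) \<le> 1"
    "integrable (std_gauss d) (\<lambda>z. (z i)\<^sup>2)" "(\<integral>z. (z i)\<^sup>2 \<partial>std_gauss d) = 1"
proof -
  interpret prob_space "std_gauss d" by (rule prob_space_std_gauss)
  show i1: "integrable (std_gauss d) (\<lambda>z. \<bar>z i\<bar>)"
    using std_gauss_component(2)[OF assms, of abs] integrable_std_normal_abs_power[of 1] by simp
  show i2: "integrable (std_gauss d) (\<lambda>z. (z i)\<^sup>2)"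
    using std_gauss_component(2)[OF assms, of "\<lambda>x. x\<^sup>2"] integrable_std_normal_abs_power[of 2] by simp
  show e2: "(\<integral>z. (z i)\<^sup>2 \<partial>std_gauss d) = 1"
    using std_gauss_component(1)[OF assms, of "\<lambda>x. x\<^sup>2"] std_normal_distribution_even_moments(1)[of 1]
    by (simp add: fact_numeral)
  have "(\<integral>z. \<bar>z i\<bar> \<partial>std_gauss d) \<le> (\<integral>z. (1 + (z i)\<^sup>2) / 2 \<partial>std_gauss d)"
  proof (rule integral_mono[OF i1])
    show "\<bar>z i\<bar> \<le> (1 + (z i)\<^sup>2) / 2" for z :: "nat \<Rightarrow> real"
      using sum_squares_bound[of 1 "\<bar>z i\<bar>"] by simp
  qed (use i2 in simp)
  also have "\<dots> = 1" using i2 e2 by (simp add: prob_space)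
  finally show "(\<integral>z. \<bar>z i\<bar> \<partial>std_gauss d) \<le> 1" .
qed

lemma std_gauss_cos:
  "(\<integral>z. cos ((\<Sum>i<d. \<xi> i * z i) + b) \<partial>std_gauss d) = cos b * exp (- (\<Sum>i<d. (\<xi> i)\<^sup>2) / 2)"
proof -
  interpret product_prob_space "\<lambda>_::nat. std_normal_distribution" by (rule std_gauss_prob)
  interpret G: prob_space "std_gauss d" by (rule prob_space_std_gauss)
  let ?e = "\<lambda>z. \<Prod>i<d. exp (\<i> * complex_of_real (\<xi> i * z i))"
  have "(\<integral>z. ?e z \<partial>std_gauss d) = (\<Prod>i<d. complex_of_real (exp (- (\<xi> i)\<^sup>2 / 2)))"
    unfolding std_gauss_def
  proof (subst product_integral_prod)
    show "integrable std_normal_distribution (\<lambda>x. exp (\<i> * complex_of_real (\<xi> i * x)))" for i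
      by (rule finite_measure.integrable_const_bound[of _ _ 1])
        (auto intro: prob_space.finite_measure std_normal_prob_space)
  qed (auto simp: std_normal_char[simplified])
  also have "\<dots> = complex_of_real (exp (- (\<Sum>i<d. (\<xi> i)\<^sup>2) / 2))"
    by (simp add: sum_negf sum_divide_distrib flip: of_real_prod exp_sum)
  finally have 1: "(\<integral>z. ?e z * exp (\<i> * complex_of_real b) \<partial>std_gauss d) =
      complex_of_real (exp (- (\<Sum>i<d. (\<xi> i)\<^sup>2) / 2)) * exp (\<i> * complex_of_real b)"
    by simp
  have pr: "?e z * exp (\<i> * complex_of_real b) = exp (\<i> * complex_of_real ((\<Sum>i<d. \<xi> i * z i) + b))" for z
    by (simp add: exp_sum[symmetric] sum_distrib_left[symmetric] exp_add distrib_left)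
  have int: "integrable (std_gauss d) (\<lambda>z. exp (\<i> * complex_of_real ((\<Sum>i<d. \<xi> i * z i) + b)))"
    by (rule G.integrable_const_bound[of _ 1]) auto
  have "Re (\<integral>z. exp (\<i> * complex_of_real ((\<Sum>i<d. \<xi> i * z i) + b)) \<partial>std_gauss d) =
      exp (- (\<Sum>i<d. (\<xi> i)\<^sup>2) / 2) * cos b"
    using 1 unfolding pr by (simp add: Re_exp)
  then show ?thesis using integral_Re[OF int] by (simp add: Re_exp mult.commute)
qed

lemma integrable_mult_bounded:
  fixes W h :: "'a \<Rightarrow> real"
  assumes "integrable M W" "h \<in> borel_measurable M" "\<And>\<omega>. \<bar>h \<omega>\<bar> \<le> K"
  shows "integrable M (\<lambda>\<omega>. W \<omega> * h \<omega>)"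
proof (rule Bochner_Integration.integrable_bound[of M "\<lambda>\<omega>. K * W \<omega>"])
  show "AE \<omega> in M. norm (W \<omega> * h \<omega>) \<le> norm (K * W \<omega>)"
  proof (rule AE_I2)
    fix \<omega>
    have "\<bar>W \<omega>\<bar> * \<bar>h \<omega>\<bar> \<le> \<bar>W \<omega>\<bar> * \<bar>K\<bar>" using assms(3)[of \<omega>] by (intro mult_left_mono) auto
    then show "norm (W \<omega> * h \<omega>) \<le> norm (K * W \<omega>)" by (simp add: abs_mult mult.commute)
  qed
qed (use assms in auto)

lemma cos_second_order: "\<bar>cos (y + t) - cos y + t * sin y\<bar> \<le> t\<^sup>2" for t y :: real
proof -
  have s: "\<bar>sin t - t\<bar> \<le> t\<^sup>2 / 2"
    using Maclaurin_sin_bound[of t 2] by (simp add: numeral_2_eq_2 sin_coeff_def field_simps)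
  have c: "\<bar>cos t - 1\<bar> \<le> t\<^sup>2 / 2"
  proof -
    have "1 - cos t = 2 * (sin (t / 2))\<^sup>2"
      using cos_double_sin[of "t / 2"] by simp
    moreover have "(sin (t / 2))\<^sup>2 \<le> (t / 2)\<^sup>2"
      using abs_sin_x_le_abs_x[of "t / 2"] by (simp only: abs_le_square_iff)
    ultimately show ?thesis by (simp add: power_divide field_simps)
  qed
  have "cos (y + t) - cos y + t * sin y = cos y * (cos t - 1) - sin y * (sin t - t)"
    by (simp add: cos_add algebra_simps)
  also have "\<bar>\<dots>\<bar> \<le> \<bar>cos y\<bar> * \<bar>cos t - 1\<bar> + \<bar>sin y\<bar> * \<bar>sin t - t\<bar>"
    by (metis abs_mult abs_triangle_ineq4)
  also have "\<dots> \<le> 1 * (t\<^sup>2 / 2) + 1 * (t\<^sup>2 / 2)"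
    by (intro add_mono mult_mono s c) auto
  finally show ?thesis by simp
qed

text \<open>The quadratic remainder of the cosine bounds the error of the difference quotient by
  \<open>\<bar>h\<bar>\<close> times the second moment of \<open>Y\<close>, so no limit theorem for
  integrals is invoked.\<close>

lemma (in prob_space) expectation_cos_deriv:
  fixes Y V :: "'a \<Rightarrow> real"
  assumes [measurable]: "Y \<in> borel_measurable M" "V \<in> borel_measurable M" and Y2: "integrable M (\<lambda>\<omega>. (Y \<omega>)\<^sup>2)"
  shows "((\<lambda>s. \<integral>\<omega>. cos (s * Y \<omega> + V \<omega>) \<partial>M) has_real_derivative - (\<integral>\<omega>. Y \<omega> * sin (s * Y \<omega> + V \<omega>) \<partial>M)) (at s)"
    and "integrable M (\<lambda>\<omega>. Y \<omega> * sin (s * Y \<omega> + V \<omega>))"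
proof -
  have ic: "integrable M (\<lambda>\<omega>. cos (s * Y \<omega> + V \<omega>))" for s
    by (rule integrable_const_bound[of _ 1]) auto
  show isn: "integrable M (\<lambda>\<omega>. Y \<omega> * sin (s * Y \<omega> + V \<omega>))"
    by (rule integrable_mult_bounded[OF square_integrable_imp_integrable[OF _ Y2], of _ 1]) auto
  let ?f = "\<lambda>s. \<integral>\<omega>. cos (s * Y \<omega> + V \<omega>) \<partial>M" and ?D = "- (\<integral>\<omega>. Y \<omega> * sin (s * Y \<omega> + V \<omega>) \<partial>M)"
  have bd: "\<bar>(?f (s + h) - ?f s) / h - ?D\<bar> \<le> \<bar>h\<bar> * (\<integral>\<omega>. (Y \<omega>)\<^sup>2 \<partial>M)" if "h \<noteq> 0" for h
  proof -
    have "(?f (s + h) - ?f s) / h - ?D =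
       (\<integral>\<omega>. (cos ((s + h) * Y \<omega> + V \<omega>) - cos (s * Y \<omega> + V \<omega>)) / h + Y \<omega> * sin (s * Y \<omega> + V \<omega>) \<partial>M)"
      using ic isn by simp
    also have "\<bar>\<dots>\<bar> \<le> (\<integral>\<omega>. \<bar>h\<bar> * (Y \<omega>)\<^sup>2 \<partial>M)"
    proof (rule integral_abs_bound[THEN order_trans], rule integral_mono)
      fix \<omega>
      let ?y = "s * Y \<omega> + V \<omega>" and ?t = "h * Y \<omega>"
      have "(cos ((s + h) * Y \<omega> + V \<omega>) - cos ?y) / h + Y \<omega> * sin ?y = (cos (?y + ?t) - cos ?y + ?t * sin ?y) / h"
        using that by (simp add: field_simps)
      also have "\<bar>\<dots>\<bar> \<le> (h * Y \<omega>)\<^sup>2 / \<bar>h\<bar>"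
        using cos_second_order[of ?y ?t] by (simp add: abs_divide divide_right_mono)
      also have "\<dots> = \<bar>h\<bar> * (Y \<omega>)\<^sup>2"
        using that by (simp add: power2_eq_square field_simps)
      finally show "\<bar>(cos ((s + h) * Y \<omega> + V \<omega>) - cos ?y) / h + Y \<omega> * sin ?y\<bar> \<le> \<bar>h\<bar> * (Y \<omega>)\<^sup>2" .
    qed (use ic isn Y2 in simp_all)
    finally show ?thesis by simp
  qed
  have "((\<lambda>h. (?f (s + h) - ?f s) / h - ?D) \<longlongrightarrow> 0) (at 0)"
  proof (rule Lim_null_comparison)
    show "\<forall>\<^sub>F h in at 0. norm ((?f (s + h) - ?f s) / h - ?D) \<le> \<bar>h\<bar> * (\<integral>\<omega>. (Y \<omega>)\<^sup>2 \<partial>M)"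
      by (rule eventually_mono[OF eventually_neq_at_within[of 0]]) (use bd in simp)
    show "((\<lambda>h. \<bar>h\<bar> * (\<integral>\<omega>. (Y \<omega>)\<^sup>2 \<partial>M)) \<longlongrightarrow> 0) (at 0)"
      by (auto intro!: tendsto_eq_intros)
  qed
  then show "(?f has_real_derivative ?D) (at s)"
    unfolding DERIV_def by (rule LIM_zero_cancel)
qed

text \<open>Differentiate \<open>std_gauss_cos\<close> in the \<open>j\<close>-th frequency;
  \<open>Q\<close> collects the frequencies that stay fixed.\<close>

lemma std_gauss_sin_weight:
  assumes j: "j < d"
  shows "(\<integral>z. z j * sin ((\<Sum>i<d. \<xi> i * z i) + b) \<partial>std_gauss d) = \<xi> j * cos b * exp (- (\<Sum>i<d. (\<xi> i)\<^sup>2) / 2)"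
proof -
  interpret G: prob_space "std_gauss d" by (rule prob_space_std_gauss)
  have m: "(\<lambda>z. z j) \<in> borel_measurable (std_gauss d)" using j by simp
  have d1: "((\<lambda>s. \<integral>z. cos (s * z j + ((\<Sum>i<d. \<xi> i * z i) + b)) \<partial>std_gauss d) has_real_derivative
     - (\<integral>z. z j * sin (0 * z j + ((\<Sum>i<d. \<xi> i * z i) + b)) \<partial>std_gauss d)) (at 0)"
  proof (rule G.expectation_cos_deriv(1)[OF m _ std_gauss_abs(3)[OF j]])
    show "(\<lambda>z. (\<Sum>i<d. \<xi> i * z i) + b) \<in> borel_measurable (std_gauss d)"
      by (intro borel_measurable_add borel_measurable_sum borel_measurable_times borel_measurable_const; simp)
  qed
  have sp: "{..<d} = insert j ({..<d} - {j})" using j by auto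
  have sum_upd: "(\<Sum>i<d. h i ((\<xi>(j := \<xi> j + s)) i)) = h j (\<xi> j + s) + (\<Sum>i\<in>{..<d} - {j}. h i (\<xi> i))"
    for s and h :: "nat \<Rightarrow> real \<Rightarrow> real"
    by (subst sp, subst sum.insert) auto
  have sum_j: "(\<Sum>i<d. h i) = h j + (\<Sum>i\<in>{..<d} - {j}. h i)" for h :: "nat \<Rightarrow> real"
    by (subst sp, subst sum.insert) auto
  define Q where "Q = (\<Sum>i\<in>{..<d} - {j}. (\<xi> i)\<^sup>2)"
  have "(\<integral>z. cos (s * z j + ((\<Sum>i<d. \<xi> i * z i) + b)) \<partial>std_gauss d) = cos b * exp (- ((\<xi> j + s)\<^sup>2 + Q) / 2)" for s
  proof -
    have "s * z j + ((\<Sum>i<d. \<xi> i * z i) + b) = (\<Sum>i<d. (\<xi>(j := \<xi> j + s)) i * z i) + b" for z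
      using sum_upd[of "\<lambda>i x. x * z i" s] sum_j[of "\<lambda>i. \<xi> i * z i"] by (simp add: algebra_simps)
    moreover have "(\<Sum>i<d. ((\<xi>(j := \<xi> j + s)) i)\<^sup>2) = (\<xi> j + s)\<^sup>2 + Q"
      using sum_upd[of "\<lambda>i x. x\<^sup>2" s] by (simp add: Q_def)
    ultimately show ?thesis by (simp only: std_gauss_cos)
  qed
  then have "((\<lambda>s. cos b * exp (- ((\<xi> j + s)\<^sup>2 + Q) / 2)) has_real_derivative
     - (\<integral>z. z j * sin ((\<Sum>i<d. \<xi> i * z i) + b) \<partial>std_gauss d)) (at 0)"
    using d1 by simp
  moreover have "((\<lambda>s. cos b * exp (- ((\<xi> j + s)\<^sup>2 + Q) / 2)) has_real_derivative
     - (\<xi> j * cos b * exp (- ((\<xi> j)\<^sup>2 + Q) / 2))) (at 0)"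
    by (auto intro!: derivative_eq_intros)
  ultimately have "(\<integral>z. z j * sin ((\<Sum>i<d. \<xi> i * z i) + b) \<partial>std_gauss d) = \<xi> j * cos b * exp (- ((\<xi> j)\<^sup>2 + Q) / 2)"
    using DERIV_unique by fastforce
  then show ?thesis using sum_j[of "\<lambda>i. (\<xi> i)\<^sup>2"] by (simp add: Q_def)
qed

lemma std_gauss_cos_weight:
  assumes j: "j < d"
  shows "(\<integral>z. z j * cos ((\<Sum>i<d. \<xi> i * z i) + b) \<partial>std_gauss d) = - \<xi> j * sin b * exp (- (\<Sum>i<d. (\<xi> i)\<^sup>2) / 2)"
  using std_gauss_sin_weight[OF j, of \<xi> "b + pi / 2"] by (simp add: sin_add cos_add add.assoc[symmetric])

text \<open>The last argument is the gradient, built along with the function, so that identities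
  linear in the pair need checking only for a single cosine. Sines are cosines with shifted
  phase.\<close>

inductive trig_poly :: "nat \<Rightarrow> ((nat \<Rightarrow> real) \<Rightarrow> real) \<Rightarrow> (nat \<Rightarrow> (nat \<Rightarrow> real) \<Rightarrow> real) \<Rightarrow> bool"
  for d :: nat where
  cos: "trig_poly d (\<lambda>x. cos ((\<Sum>i<d. \<xi> i * x i) + b)) (\<lambda>i x. - \<xi> i * sin ((\<Sum>i<d. \<xi> i * x i) + b))"
| add: "trig_poly d f f' \<Longrightarrow> trig_poly d g g' \<Longrightarrow> trig_poly d (\<lambda>x. f x + g x) (\<lambda>i x. f' i x + g' i x)"
| scale: "trig_poly d f f' \<Longrightarrow> trig_poly d (\<lambda>x. c * f x) (\<lambda>i x. c * f' i x)"

lemma trig_poly_measurable: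
  assumes "trig_poly d f f'" and [measurable]: "\<And>i. i < d \<Longrightarrow> Y i \<in> borel_measurable M"
  shows "(\<lambda>\<omega>. f (\<lambda>i. Y i \<omega>)) \<in> borel_measurable M" "(\<lambda>\<omega>. f' j (\<lambda>i. Y i \<omega>)) \<in> borel_measurable M"
  using assms(1) by (induction rule: trig_poly.induct) simp_all

lemma trig_poly_bounded:
  assumes "trig_poly d f f'" shows "\<exists>K. \<forall>x. \<bar>f x\<bar> \<le> K \<and> (\<forall>i<d. \<bar>f' i x\<bar> \<le> K)"
  using assms
proof (induction rule: trig_poly.induct)
  case (cos \<xi> b)
  have "\<bar>\<xi> i * sin y\<bar> \<le> 1 + (\<Sum>l<d. \<bar>\<xi> l\<bar>)" if "i < d" for i y
  proof -
    have "\<bar>\<xi> i\<bar> \<le> (\<Sum>l<d. \<bar>\<xi> l\<bar>)" using that by (intro member_le_sum) auto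
    moreover have "\<bar>\<xi> i\<bar> * \<bar>sin y\<bar> \<le> \<bar>\<xi> i\<bar> * 1" by (intro mult_left_mono) auto
    ultimately show ?thesis by (simp add: abs_mult)
  qed
  moreover have "\<bar>cos y\<bar> \<le> 1 + (\<Sum>l<d. \<bar>\<xi> l\<bar>)" for y :: real
  proof -
    have "0 \<le> (\<Sum>l<d. \<bar>\<xi> l\<bar>)" by (rule sum_nonneg) simp
    then show ?thesis using abs_cos_le_one[of y] by linarith
  qed
  ultimately show ?case by (intro exI[of _ "1 + (\<Sum>l<d. \<bar>\<xi> l\<bar>)"]) auto
next
  case (add f f' g g')
  then obtain K L where "\<forall>x. \<bar>f x\<bar> \<le> K \<and> (\<forall>i<d. \<bar>f' i x\<bar> \<le> K)" "\<forall>x. \<bar>g x\<bar> \<le> L \<and> (\<forall>i<d. \<bar>g' i x\<bar> \<le> L)" by blast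
  then show ?case by (intro exI[of _ "K + L"] allI conjI impI order_trans[OF abs_triangle_ineq] add_mono) auto
next
  case (scale f f' c)
  then obtain K where "\<forall>x. \<bar>f x\<bar> \<le> K \<and> (\<forall>i<d. \<bar>f' i x\<bar> \<le> K)" by blast
  then show ?case by (intro exI[of _ "\<bar>c\<bar> * K"]) (auto simp: abs_mult intro: mult_left_mono)
qed

lemma trig_poly_integrable:
  assumes f: "trig_poly d f f'" and M: "prob_space M" and [measurable]: "\<And>i. i < d \<Longrightarrow> Y i \<in> borel_measurable M"
  shows "integrable M (\<lambda>\<omega>. f (\<lambda>i. Y i \<omega>))" "j < d \<Longrightarrow> integrable M (\<lambda>\<omega>. f' j (\<lambda>i. Y i \<omega>))"
    "integrable M W \<Longrightarrow> integrable M (\<lambda>\<omega>. W \<omega> * f (\<lambda>i. Y i \<omega>))"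
    "j < d \<Longrightarrow> integrable M W \<Longrightarrow> integrable M (\<lambda>\<omega>. W \<omega> * f' j (\<lambda>i. Y i \<omega>))"
proof -
  interpret prob_space M by fact
  obtain K where K: "\<forall>x. \<bar>f x\<bar> \<le> K \<and> (\<forall>i<d. \<bar>f' i x\<bar> \<le> K)" using trig_poly_bounded[OF f] by blast
  note m = trig_poly_measurable[OF f, of Y M]
  show "integrable M (\<lambda>\<omega>. f (\<lambda>i. Y i \<omega>))"
    by (rule integrable_const_bound[of _ K]) (use K m in auto)
  show "integrable M (\<lambda>\<omega>. f' j (\<lambda>i. Y i \<omega>))" if "j < d"
    by (rule integrable_const_bound[of _ K]) (use that K m in auto)
  show "integrable M (\<lambda>\<omega>. W \<omega> * f (\<lambda>i. Y i \<omega>))" if "integrable M W"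
    by (rule integrable_mult_bounded[OF that, of _ K]) (use K m in auto)
  show "integrable M (\<lambda>\<omega>. W \<omega> * f' j (\<lambda>i. Y i \<omega>))" if "j < d" "integrable M W"
    by (rule integrable_mult_bounded[OF that(2), of _ K]) (use that K m in auto)
qed

lemma trig_poly_const: "\<exists>f'. trig_poly d (\<lambda>_. c) f'"
  using trig_poly.scale[OF trig_poly.cos[of d "\<lambda>_. 0" 0], of c] by auto

text \<open>Product-to-sum formula. Closure under products is what the Stone-Weierstrass argument
  needs; there the gradient does not matter, hence the existential.\<close>

lemma trig_poly_mult_cos:
  assumes "trig_poly d g g'"
  shows "\<exists>h'. trig_poly d (\<lambda>x. cos ((\<Sum>i<d. \<xi> i * x i) + b) * g x) h'"
  using assms
proof (induction rule: trig_poly.induct)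
  case (cos \<eta> c)
  have "cos ((\<Sum>i<d. \<xi> i * x i) + b) * cos ((\<Sum>i<d. \<eta> i * x i) + c) =
     1 / 2 * (cos ((\<Sum>i<d. (\<xi> i + \<eta> i) * x i) + (b + c)) + cos ((\<Sum>i<d. (\<xi> i - \<eta> i) * x i) + (b - c)))" for x
  proof -
    define U V where "U = (\<Sum>i<d. \<xi> i * x i) + b" "V = (\<Sum>i<d. \<eta> i * x i) + c"
    have "(\<Sum>i<d. (\<xi> i + \<eta> i) * x i) + (b + c) = U + V" "(\<Sum>i<d. (\<xi> i - \<eta> i) * x i) + (b - c) = U - V"
      by (simp_all add: U_V_def distrib_right left_diff_distrib sum.distrib sum_subtractf)
    moreover have "cos U * cos V = 1 / 2 * (cos (U + V) + cos (U - V))"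
      by (simp add: cos_add cos_diff)
    ultimately show ?thesis by (simp only: U_V_def[symmetric])
  qed
  then show ?case
    using trig_poly.scale[OF trig_poly.add[OF trig_poly.cos[of d "\<lambda>i. \<xi> i + \<eta> i" "b + c"] trig_poly.cos[of d "\<lambda>i. \<xi> i - \<eta> i" "b - c"]], of "1/2"]
    by (simp only:) blast
next
  case (add f f' g g')
  then show ?case by (auto simp: distrib_left intro: trig_poly.add)
next
  case (scale f f' c)
  then obtain h' where "trig_poly d (\<lambda>x. cos ((\<Sum>i<d. \<xi> i * x i) + b) * f x) h'" by blast
  from trig_poly.scale[OF this, of c] show ?case by (auto simp: mult.left_commute)
qed

lemma trig_poly_mult:
  assumes "trig_poly d f f'" "trig_poly d g g'"
  shows "\<exists>h'. trig_poly d (\<lambda>x. f x * g x) h'"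
  using assms
proof (induction rule: trig_poly.induct)
  case (cos \<xi> b)
  then show ?case using trig_poly_mult_cos by blast
next
  case (add f1 f1' f2 f2')
  then show ?case by (auto simp: distrib_right intro: trig_poly.add)
next
  case (scale f f' c)
  then obtain h' where "trig_poly d (\<lambda>x. f x * g x) h'" by blast
  from trig_poly.scale[OF this, of c] show ?case by (auto simp: mult.assoc)
qed

lemma affine_phase:
  "(\<Sum>i<d. \<xi> i * (x i + e i * z i)) + b = (\<Sum>i<d. (\<xi> i * e i) * z i) + ((\<Sum>i<d. \<xi> i * x i) + b)"
  for \<xi> x e z :: "nat \<Rightarrow> real"
  by (simp add: distrib_left sum.distrib mult.assoc)

lemma std_gauss_sin:
  "(\<integral>z. sin ((\<Sum>i<d. \<xi> i * z i) + b) \<partial>std_gauss d) = sin b * exp (- (\<Sum>i<d. (\<xi> i)\<^sup>2) / 2)"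
  using std_gauss_cos[where d = d and \<xi> = \<xi> and b = "b - pi / 2"]
  by (simp add: add_diff_eq cos_diff)

text \<open>The scale may depend on the coordinate, in order to allow \<open>e j = 0\<close>: then
  the left side is zero, a fact that centres the gradient estimate in
  \<open>trig_poly_lipschitz_approx\<close>.\<close>

lemma trig_poly_gauss_ibp:
  assumes "trig_poly d f f'" and j: "j < d"
  shows "(\<integral>z. z j * f (\<lambda>i. x i + e i * z i) \<partial>std_gauss d) = e j * (\<integral>z. f' j (\<lambda>i. x i + e i * z i) \<partial>std_gauss d)"
  using assms(1)
proof (induction rule: trig_poly.induct)
  case (cos \<xi> b)
  show ?case
    unfolding affine_phase by (simp add: std_gauss_cos_weight[OF j] std_gauss_sin)
next
  case (add f f' g g')
  have m: "(\<lambda>z. x i + e i * z i) \<in> borel_measurable (std_gauss d)" if "i < d" for i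
    using that by simp
  have z: "integrable (std_gauss d) (\<lambda>z. z j)" using std_gauss_abs(1)[OF j] j
    by (subst (asm) integrable_abs_iff) auto
  note i = trig_poly_integrable[where Y = "\<lambda>i z. x i + e i * z i", OF _ prob_space_std_gauss m]
  show ?case
    using add i(2,3)[OF add(1)] i(2,3)[OF add(2)] j z by (simp add: distrib_left)
next
  case (scale f f' c)
  then show ?case by (simp add: mult.left_commute)
qed

text \<open>Each cosine is an eigenfunction of convolution with a centred Gaussian, so smoothing
  stays inside the class and commutes with the gradient.\<close>

lemma trig_poly_smooth:
  assumes "trig_poly d f f'"
  shows "\<exists>h h'. trig_poly d h h' \<and> (\<forall>x. h x = (\<integral>z. f (\<lambda>i. x i + e * z i) \<partial>std_gauss d)) \<and>
    (\<forall>j<d. \<forall>x. h' j x = (\<integral>z. f' j (\<lambda>i. x i + e * z i) \<partial>std_gauss d))"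
  using assms
proof (induction rule: trig_poly.induct)
  case (cos \<xi> b)
  let ?E = "exp (- (\<Sum>i<d. (\<xi> i * e)\<^sup>2) / 2)"
  show ?case
  proof (intro exI conjI allI impI)
    show "trig_poly d (\<lambda>x. ?E * cos ((\<Sum>i<d. \<xi> i * x i) + b)) (\<lambda>i x. ?E * (- \<xi> i * sin ((\<Sum>i<d. \<xi> i * x i) + b)))"
      by (intro trig_poly.scale trig_poly.cos)
  qed (simp_all add: affine_phase[where e = "\<lambda>_. e"] std_gauss_cos std_gauss_sin)
next
  case (add f f' g g')
  have m: "(\<lambda>z. x i + e * z i) \<in> borel_measurable (std_gauss d)" if "i < d" for i and x :: "nat \<Rightarrow> real"
    using that by simp
  have i: "integrable (std_gauss d) (\<lambda>z. u (\<lambda>i. x i + e * z i))"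
      "j < d \<Longrightarrow> integrable (std_gauss d) (\<lambda>z. u' j (\<lambda>i. x i + e * z i))"
    if "trig_poly d u u'" for u u' j and x :: "nat \<Rightarrow> real"
    by (rule trig_poly_integrable[OF that prob_space_std_gauss], use m in blast)+
  obtain h1 h1' where h1: "trig_poly d h1 h1'" "\<forall>x. h1 x = (\<integral>z. f (\<lambda>i. x i + e * z i) \<partial>std_gauss d)"
    "\<forall>j<d. \<forall>x. h1' j x = (\<integral>z. f' j (\<lambda>i. x i + e * z i) \<partial>std_gauss d)" using add by blast
  obtain h2 h2' where h2: "trig_poly d h2 h2'" "\<forall>x. h2 x = (\<integral>z. g (\<lambda>i. x i + e * z i) \<partial>std_gauss d)"
    "\<forall>j<d. \<forall>x. h2' j x = (\<integral>z. g' j (\<lambda>i. x i + e * z i) \<partial>std_gauss d)" using add by blast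
  have "\<forall>x. h1 x + h2 x = (\<integral>z. f (\<lambda>i. x i + e * z i) + g (\<lambda>i. x i + e * z i) \<partial>std_gauss d)"
    using h1(2) h2(2) i(1)[OF add(1)] i(1)[OF add(2)] by simp
  moreover have "\<forall>j<d. \<forall>x. h1' j x + h2' j x = (\<integral>z. f' j (\<lambda>i. x i + e * z i) + g' j (\<lambda>i. x i + e * z i) \<partial>std_gauss d)"
    using h1(3) h2(3) i(2)[OF add(1)] i(2)[OF add(2)] by simp
  ultimately show ?case using trig_poly.add[OF h1(1) h2(1)] by blast
next
  case (scale f f' c)
  then obtain h h' where h: "trig_poly d h h'" "\<forall>x. h x = (\<integral>z. f (\<lambda>i. x i + e * z i) \<partial>std_gauss d)"
    "\<forall>j<d. \<forall>x. h' j x = (\<integral>z. f' j (\<lambda>i. x i + e * z i) \<partial>std_gauss d)" by blast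
  have "\<forall>x. c * h x = (\<integral>z. c * f (\<lambda>i. x i + e * z i) \<partial>std_gauss d)"
    "\<forall>j<d. \<forall>x. c * h' j x = (\<integral>z. c * f' j (\<lambda>i. x i + e * z i) \<partial>std_gauss d)" using h by simp_all
  then show ?case using trig_poly.scale[OF h(1), of c] by blast
qed

section \<open>Interpolation\<close>

text \<open>\<open>kernel\<close> is the integration by parts identity tested only on sines of
  affine functions of \<open>F\<close>. With the free phase \<open>b\<close> these include the
  cosines, which is all that trigonometric polynomials require.\<close>

locale stein_kernel = prob_space M for M :: "'a measure" +
  fixes d :: nat and F :: "nat \<Rightarrow> 'a \<Rightarrow> real" and W :: "nat \<Rightarrow> nat \<Rightarrow> 'a \<Rightarrow> real"
  assumes F_measurable [measurable]: "\<And>i. i < d \<Longrightarrow> F i \<in> borel_measurable M"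
    and F_sq: "\<And>i. i < d \<Longrightarrow> integrable M (\<lambda>\<omega>. (F i \<omega>)\<^sup>2)"
    and W_int: "\<And>i j. i < d \<Longrightarrow> j < d \<Longrightarrow> integrable M (W i j)"
    and kernel: "\<And>i \<eta> b. i < d \<Longrightarrow>
      (\<integral>\<omega>. F i \<omega> * sin ((\<Sum>j<d. \<eta> j * F j \<omega>) + b) \<partial>M) =
      (\<Sum>j<d. \<eta> j * (\<integral>\<omega>. W i j \<omega> * cos ((\<Sum>j<d. \<eta> j * F j \<omega>) + b) \<partial>M))"
begin

definition kernel_error :: "nat \<Rightarrow> nat \<Rightarrow> 'a \<Rightarrow> real" where
  "kernel_error i j \<omega> = W i j \<omega> - (if i = j then 1 else 0)"

lemma kernel_error_int: "i < d \<Longrightarrow> j < d \<Longrightarrow> integrable M (kernel_error i j)"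
  using W_int unfolding kernel_error_def[abs_def] by simp

definition interpol :: "((nat \<Rightarrow> real) \<Rightarrow> real) \<Rightarrow> real \<Rightarrow> real" where
  "interpol f \<theta> = (\<integral>\<omega>. (\<integral>z. f (\<lambda>i. sin \<theta> * F i \<omega> + cos \<theta> * z i) \<partial>std_gauss d) \<partial>M)"

definition interpol_deriv :: "(nat \<Rightarrow> (nat \<Rightarrow> real) \<Rightarrow> real) \<Rightarrow> real \<Rightarrow> real" where
  "interpol_deriv f' \<theta> = sin \<theta> * (\<Sum>i<d. \<Sum>j<d.
     (\<integral>\<omega>. kernel_error i j \<omega> * (\<integral>z. z j * f' i (\<lambda>i. sin \<theta> * F i \<omega> + cos \<theta> * z i) \<partial>std_gauss d) \<partial>M))"

lemma z_int: assumes "j < d" shows "integrable (std_gauss d) (\<lambda>z. z j)"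
  using std_gauss_abs(1)[OF assms] assms by (subst (asm) integrable_abs_iff) auto

lemma inner_int:
  assumes "trig_poly d f f'"
  shows "integrable (std_gauss d) (\<lambda>z. f (\<lambda>i. x i + c * z i))"
    "i < d \<Longrightarrow> j < d \<Longrightarrow> integrable (std_gauss d) (\<lambda>z. z j * f' i (\<lambda>i. x i + c * z i))"
proof -
  have m: "(\<lambda>z. x i + c * z i) \<in> borel_measurable (std_gauss d)" if "i < d" for i
    using that by simp
  show "integrable (std_gauss d) (\<lambda>z. f (\<lambda>i. x i + c * z i))"
    by (rule trig_poly_integrable(1)[OF assms prob_space_std_gauss m])
  show "integrable (std_gauss d) (\<lambda>z. z j * f' i (\<lambda>i. x i + c * z i))" if "i < d" "j < d"
    by (rule trig_poly_integrable(4)[OF assms prob_space_std_gauss m that(1) z_int[OF that(2)]])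
qed

lemma joint_measurable:
  assumes "trig_poly d f f'"
  shows "(\<lambda>p. f (\<lambda>i. s * F i (fst p) + c * snd p i)) \<in> borel_measurable (M \<Otimes>\<^sub>M std_gauss d)"
    "(\<lambda>p. f' i (\<lambda>i. s * F i (fst p) + c * snd p i)) \<in> borel_measurable (M \<Otimes>\<^sub>M std_gauss d)"
proof -
  have m: "(\<lambda>p. s * F i (fst p) + c * snd p i) \<in> borel_measurable (M \<Otimes>\<^sub>M std_gauss d)" if "i < d" for i
  proof -
    have "(\<lambda>p. F i (fst p)) \<in> borel_measurable (M \<Otimes>\<^sub>M std_gauss d)"
      by (rule measurable_compose[OF measurable_fst F_measurable[OF that]])
    moreover have "(\<lambda>z. z i) \<in> borel_measurable (std_gauss d)" using that by simp
    then have "(\<lambda>p. snd p i) \<in> borel_measurable (M \<Otimes>\<^sub>M std_gauss d)"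
      by (rule measurable_compose[OF measurable_snd])
    ultimately show ?thesis by simp
  qed
  show "(\<lambda>p. f (\<lambda>i. s * F i (fst p) + c * snd p i)) \<in> borel_measurable (M \<Otimes>\<^sub>M std_gauss d)"
    by (rule trig_poly_measurable(1)[OF assms m])
  show "(\<lambda>p. f' i (\<lambda>i. s * F i (fst p) + c * snd p i)) \<in> borel_measurable (M \<Otimes>\<^sub>M std_gauss d)"
    by (rule trig_poly_measurable(2)[OF assms m])
qed

lemma inner_weight_bound:
  assumes f: "trig_poly d f f'" and K: "\<And>x. \<bar>f' i x\<bar> \<le> K" and i: "i < d" and j: "j < d"
  shows "\<bar>\<integral>z. z j * f' i (\<lambda>i. x i + c * z i) \<partial>std_gauss d\<bar> \<le> K"
proof -
  have K0: "K \<ge> 0" using K[of undefined] by linarith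
  have "\<bar>\<integral>z. z j * f' i (\<lambda>i. x i + c * z i) \<partial>std_gauss d\<bar> \<le> (\<integral>z. K * \<bar>z j\<bar> \<partial>std_gauss d)"
  proof (rule integral_abs_bound[THEN order_trans], rule integral_mono)
    show "\<bar>z j * f' i (\<lambda>i. x i + c * z i)\<bar> \<le> K * \<bar>z j\<bar>" for z
      using mult_left_mono[OF K, of "\<bar>z j\<bar>" "\<lambda>i. x i + c * z i"] by (simp add: abs_mult mult.commute)
  qed (use inner_int(2)[OF f i j] std_gauss_abs(1)[OF j] in simp_all)
  also have "\<dots> \<le> K * 1"
    using std_gauss_abs(2)[OF j] K0 by (simp add: mult_left_le)
  finally show ?thesis by simp
qed

lemma outer_int:
  assumes f: "trig_poly d f f'"
  shows "integrable M (\<lambda>\<omega>. \<integral>z. f (\<lambda>i. s * F i \<omega> + c * z i) \<partial>std_gauss d)"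
    "i < d \<Longrightarrow> j < d \<Longrightarrow> integrable M (\<lambda>\<omega>. kernel_error i j \<omega> *
       (\<integral>z. z j * f' i (\<lambda>i. s * F i \<omega> + c * z i) \<partial>std_gauss d))"
proof -
  interpret G: prob_space "std_gauss d" by (rule prob_space_std_gauss)
  obtain K where K: "\<forall>x. \<bar>f x\<bar> \<le> K \<and> (\<forall>i<d. \<bar>f' i x\<bar> \<le> K)" using trig_poly_bounded[OF f] by blast
  have m1: "(\<lambda>\<omega>. \<integral>z. f (\<lambda>i. s * F i \<omega> + c * z i) \<partial>std_gauss d) \<in> borel_measurable M"
    by (rule G.borel_measurable_lebesgue_integral) (use joint_measurable(1)[OF f] in \<open>simp add: split_def\<close>)
  show "integrable M (\<lambda>\<omega>. \<integral>z. f (\<lambda>i. s * F i \<omega> + c * z i) \<partial>std_gauss d)"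
  proof (rule integrable_const_bound[of _ K, OF AE_I2 m1])
    fix \<omega>
    have "\<bar>\<integral>z. f (\<lambda>i. s * F i \<omega> + c * z i) \<partial>std_gauss d\<bar> \<le> (\<integral>z. K \<partial>std_gauss d)"
      by (rule integral_abs_bound[THEN order_trans], rule integral_mono) (use K inner_int(1)[OF f] in auto)
    then show "norm (\<integral>z. f (\<lambda>i. s * F i \<omega> + c * z i) \<partial>std_gauss d) \<le> K" by (simp add: G.prob_space)
  qed
  assume i: "i < d" and j: "j < d"
  let ?I = "\<lambda>\<omega>. \<integral>z. z j * f' i (\<lambda>i. s * F i \<omega> + c * z i) \<partial>std_gauss d"
  have mj: "(\<lambda>p. snd p j) \<in> borel_measurable (M \<Otimes>\<^sub>M std_gauss d)"
    by (rule measurable_compose[OF measurable_snd]) (use j in simp)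
  have m2: "?I \<in> borel_measurable M"
    by (rule G.borel_measurable_lebesgue_integral)
       (use borel_measurable_times[OF mj joint_measurable(2)[OF f]] in \<open>simp add: split_def\<close>)
  have b: "\<bar>?I \<omega>\<bar> \<le> K" for \<omega>
    by (rule inner_weight_bound[OF f _ i j]) (use K i in auto)
  show "integrable M (\<lambda>\<omega>. kernel_error i j \<omega> * ?I \<omega>)"
    by (rule integrable_mult_bounded[OF kernel_error_int[OF i j] m2 b])
qed

text \<open>By linearity one cosine suffices. Integrating out \<open>z\<close> leaves
  \<open>exp (- cos^2 \<theta> Q / 2)\<close> times the expectation of
  \<open>cos (sin \<theta> Y + b)\<close>. In the product rule the exponential yields the identity
  part of the kernel error, and the expectation yields the \<open>W\<close> part through
  \<open>kernel\<close> with frequencies \<open>sin \<theta> * \<xi> j\<close>.\<close>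

lemma interpol_has_derivative:
  assumes "trig_poly d f f'"
  shows "(interpol f has_real_derivative interpol_deriv f' \<theta>) (at \<theta>)"
  using assms
proof (induction rule: trig_poly.induct)
  case (cos \<xi> b)
  define Y where "Y = (\<lambda>\<omega>. \<Sum>i<d. \<xi> i * F i \<omega>)"
  define Q where "Q = (\<Sum>i<d. (\<xi> i)\<^sup>2)"
  have [measurable]: "Y \<in> borel_measurable M" unfolding Y_def
    by (intro borel_measurable_sum borel_measurable_times borel_measurable_const) simp
  have Y2: "integrable M (\<lambda>\<omega>. (Y \<omega>)\<^sup>2)"
  proof (rule Bochner_Integration.integrable_bound[of M "\<lambda>\<omega>. real d * (\<Sum>i<d. (\<xi> i * F i \<omega>)\<^sup>2)"])
    show "AE \<omega> in M. norm ((Y \<omega>)\<^sup>2) \<le> norm (real d * (\<Sum>i<d. (\<xi> i * F i \<omega>)\<^sup>2))"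
    proof (rule AE_I2)
      fix \<omega>
      show "norm ((Y \<omega>)\<^sup>2) \<le> norm (real d * (\<Sum>i<d. (\<xi> i * F i \<omega>)\<^sup>2))"
        using sum_squared_le_sum_of_squares[of "\<lambda>i. \<xi> i * F i \<omega>" "{..<d}"]
        by (simp add: Y_def sum_nonneg mult.commute)
    qed
  qed (auto simp: power_mult_distrib intro!: F_sq)
  have ph: "(\<Sum>i<d. \<xi> i * (s * F i \<omega> + c * z i)) + b = (\<Sum>i<d. (c * \<xi> i) * z i) + (s * Y \<omega> + b)" for s c z \<omega>
    by (simp add: Y_def distrib_left sum.distrib sum_distrib_left mult_ac)
  have Qc: "(\<Sum>i<d. (c * \<xi> i)\<^sup>2) = c\<^sup>2 * Q" for c
    by (simp add: Q_def power_mult_distrib sum_distrib_left)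
  have I: "interpol (\<lambda>x. cos ((\<Sum>i<d. \<xi> i * x i) + b)) =
      (\<lambda>\<theta>. exp (- (cos \<theta>)\<^sup>2 * Q / 2) * (\<integral>\<omega>. cos (sin \<theta> * Y \<omega> + b) \<partial>M))"
    unfolding interpol_def ph std_gauss_cos Qc by (simp add: mult.commute)
  let ?E = "exp (- (cos \<theta>)\<^sup>2 * Q / 2)"
  let ?C = "\<integral>\<omega>. cos (sin \<theta> * Y \<omega> + b) \<partial>M" and ?S = "\<integral>\<omega>. Y \<omega> * sin (sin \<theta> * Y \<omega> + b) \<partial>M"
  let ?W = "\<lambda>i j. \<integral>\<omega>. W i j \<omega> * cos (sin \<theta> * Y \<omega> + b) \<partial>M"
  have dc: "((\<lambda>s. \<integral>\<omega>. cos (s * Y \<omega> + b) \<partial>M) has_real_derivative - (\<integral>\<omega>. Y \<omega> * sin (s * Y \<omega> + b) \<partial>M)) (at s)" for s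
    by (rule expectation_cos_deriv(1)[OF _ _ Y2]) simp_all
  have d1: "((\<lambda>\<theta>. \<integral>\<omega>. cos (sin \<theta> * Y \<omega> + b) \<partial>M) has_real_derivative - ?S * cos \<theta>) (at \<theta>)"
    by (rule DERIV_chain2[OF dc DERIV_sin])
  have d2: "((\<lambda>\<theta>. exp (- (cos \<theta>)\<^sup>2 * Q / 2)) has_real_derivative ?E * (cos \<theta> * sin \<theta> * Q)) (at \<theta>)"
    by (auto intro!: derivative_eq_intros)
  have D: "(interpol (\<lambda>x. cos ((\<Sum>i<d. \<xi> i * x i) + b)) has_real_derivative
      ?E * (cos \<theta> * sin \<theta> * Q) * ?C + (- ?S * cos \<theta>) * ?E) (at \<theta>)"
    unfolding I by (rule DERIV_mult[OF d2 d1])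
  have Fi: "integrable M (\<lambda>\<omega>. F i \<omega> * sin (sin \<theta> * Y \<omega> + b))" if "i < d" for i
    by (rule integrable_mult_bounded[OF square_integrable_imp_integrable[OF F_measurable[OF that] F_sq[OF that]], of _ 1]) auto
  have S: "?S = sin \<theta> * (\<Sum>i<d. \<Sum>j<d. \<xi> i * \<xi> j * ?W i j)"
  proof -
    have "?S = (\<integral>\<omega>. (\<Sum>i<d. \<xi> i * (F i \<omega> * sin (sin \<theta> * Y \<omega> + b))) \<partial>M)"
      by (intro Bochner_Integration.integral_cong) (simp_all add: Y_def sum_distrib_right mult.assoc)
    also have "\<dots> = (\<Sum>i<d. \<xi> i * (\<integral>\<omega>. F i \<omega> * sin (sin \<theta> * Y \<omega> + b) \<partial>M))"
      by (subst Bochner_Integration.integral_sum) (auto intro!: Fi integrable_mult_right)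
    also have "\<dots> = (\<Sum>i<d. \<xi> i * (\<Sum>j<d. (sin \<theta> * \<xi> j) * ?W i j))"
    proof (rule sum.cong[OF refl])
      fix i assume "i \<in> {..<d}"
      then have i: "i < d" by simp
      have "sin \<theta> * Y \<omega> = (\<Sum>j<d. (sin \<theta> * \<xi> j) * F j \<omega>)" for \<omega>
        by (simp add: Y_def sum_distrib_left mult.assoc)
      then show "\<xi> i * (\<integral>\<omega>. F i \<omega> * sin (sin \<theta> * Y \<omega> + b) \<partial>M) = \<xi> i * (\<Sum>j<d. (sin \<theta> * \<xi> j) * ?W i j)"
        using kernel[OF i, of "\<lambda>j. sin \<theta> * \<xi> j" b] by simp
    qed
    also have "\<dots> = sin \<theta> * (\<Sum>i<d. \<Sum>j<d. \<xi> i * \<xi> j * ?W i j)"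
      by (simp add: sum_distrib_left mult_ac)
    finally show ?thesis .
  qed
  have ic: "integrable M (\<lambda>\<omega>. cos (sin \<theta> * Y \<omega> + b))"
    by (rule integrable_const_bound[of _ 1]) auto
  have iw: "integrable M (\<lambda>\<omega>. W i j \<omega> * cos (sin \<theta> * Y \<omega> + b))" if "i < d" "j < d" for i j
    by (rule integrable_mult_bounded[OF W_int[OF that], of _ 1]) auto
  have in1: "(\<integral>z. z j * (- \<xi> i * sin ((\<Sum>i<d. \<xi> i * (sin \<theta> * F i \<omega> + cos \<theta> * z i)) + b)) \<partial>std_gauss d) =
      - (cos \<theta> * ?E * \<xi> i * \<xi> j) * cos (sin \<theta> * Y \<omega> + b)" if "j < d" for i j \<omega>
  proof -
    have "(\<integral>z. z j * (- \<xi> i * sin ((\<Sum>i<d. \<xi> i * (sin \<theta> * F i \<omega> + cos \<theta> * z i)) + b)) \<partial>std_gauss d) =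
       - \<xi> i * (\<integral>z. z j * sin ((\<Sum>i<d. (cos \<theta> * \<xi> i) * z i) + (sin \<theta> * Y \<omega> + b)) \<partial>std_gauss d)"
      unfolding ph by (simp only: mult.left_commute[of _ "- \<xi> i"] integral_mult_right_zero)
    then show ?thesis unfolding std_gauss_sin_weight[OF that] Qc by (simp add: mult_ac)
  qed
  have E: "interpol_deriv (\<lambda>i x. - \<xi> i * sin ((\<Sum>i<d. \<xi> i * x i) + b)) \<theta> =
     sin \<theta> * (\<Sum>i<d. \<Sum>j<d. - (cos \<theta> * ?E * \<xi> i * \<xi> j) * (?W i j - (if i = j then 1 else 0) * ?C))"
    unfolding interpol_deriv_def
  proof (intro arg_cong[where f = "\<lambda>x. sin \<theta> * x"] sum.cong refl)
    fix i j assume "i \<in> {..<d}" "j \<in> {..<d}"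
    then have ij: "i < d" "j < d" by auto
    have "(\<integral>\<omega>. kernel_error i j \<omega> * (\<integral>z. z j * (- \<xi> i * sin ((\<Sum>i<d. \<xi> i * (sin \<theta> * F i \<omega> + cos \<theta> * z i)) + b)) \<partial>std_gauss d) \<partial>M)
      = (\<integral>\<omega>. - (cos \<theta> * ?E * \<xi> i * \<xi> j) * (W i j \<omega> * cos (sin \<theta> * Y \<omega> + b) - (if i = j then 1 else 0) * cos (sin \<theta> * Y \<omega> + b)) \<partial>M)"
      unfolding in1[OF ij(2)] kernel_error_def
      by (intro Bochner_Integration.integral_cong) (simp_all add: algebra_simps)
    also have "\<dots> = - (cos \<theta> * ?E * \<xi> i * \<xi> j) * (?W i j - (if i = j then 1 else 0) * ?C)"
      using iw[OF ij] ic by (simp only: integral_mult_right_zero Bochner_Integration.integral_diff integrable_mult_right)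
    finally show "(\<integral>\<omega>. kernel_error i j \<omega> * (\<integral>z. z j * (- \<xi> i * sin ((\<Sum>i<d. \<xi> i * (sin \<theta> * F i \<omega> + cos \<theta> * z i)) + b)) \<partial>std_gauss d) \<partial>M)
      = - (cos \<theta> * ?E * \<xi> i * \<xi> j) * (?W i j - (if i = j then 1 else 0) * ?C)" .
  qed
  have diag: "(\<Sum>i<d. \<Sum>j<d. \<xi> i * \<xi> j * (if i = j then 1 else 0) * ?C) = Q * ?C"
    by (simp add: Q_def power2_eq_square sum_distrib_right if_distrib[of "\<lambda>x. _ * x"] if_distrib[of "\<lambda>x. x * _"] cong: if_cong)
  have "interpol_deriv (\<lambda>i x. - \<xi> i * sin ((\<Sum>i<d. \<xi> i * x i) + b)) \<theta> =
     - sin \<theta> * cos \<theta> * ?E * ((\<Sum>i<d. \<Sum>j<d. \<xi> i * \<xi> j * ?W i j) - Q * ?C)"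
    unfolding E diag[symmetric] sum_subtractf[symmetric] sum_distrib_left
    by (intro sum.cong refl) (simp add: algebra_simps)
  also have "\<dots> = ?E * (cos \<theta> * sin \<theta> * Q) * ?C + (- ?S * cos \<theta>) * ?E"
    unfolding S by (simp add: algebra_simps)
  finally show ?case using D by simp
next
  case (add f f' g g')
  have "interpol (\<lambda>x. f x + g x) = (\<lambda>\<theta>. interpol f \<theta> + interpol g \<theta>)"
    unfolding interpol_def
    by (simp add: inner_int(1)[OF add(1)] inner_int(1)[OF add(2)] outer_int(1)[OF add(1)] outer_int(1)[OF add(2)])
  moreover have "interpol_deriv (\<lambda>i x. f' i x + g' i x) \<theta> = interpol_deriv f' \<theta> + interpol_deriv g' \<theta>"
    unfolding interpol_deriv_def distrib_left[symmetric] sum.distrib[symmetric]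
    by (intro arg_cong[where f = "\<lambda>x. sin \<theta> * x"] sum.cong refl)
       (simp add: distrib_left inner_int(2)[OF add(1)] inner_int(2)[OF add(2)] outer_int(2)[OF add(1)] outer_int(2)[OF add(2)])
  ultimately show ?case using DERIV_add[OF add(3,4)] by simp
next
  case (scale f f' c)
  have "interpol (\<lambda>x. c * f x) = (\<lambda>\<theta>. c * interpol f \<theta>)"
    unfolding interpol_def by simp
  moreover have "interpol_deriv (\<lambda>i x. c * f' i x) \<theta> = c * interpol_deriv f' \<theta>"
    unfolding interpol_deriv_def by (simp add: sum_distrib_left mult.left_commute[of _ c])
  ultimately show ?case using DERIV_cmult[OF scale(2), of c] by simp
qed

definition total_error :: real where
  "total_error = (\<Sum>i<d. \<Sum>j<d. \<integral>\<omega>. \<bar>kernel_error i j \<omega>\<bar> \<partial>M)"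

lemma trig_poly_distance:
  assumes f: "trig_poly d f f'" and K: "\<And>i x. i < d \<Longrightarrow> \<bar>f' i x\<bar> \<le> K"
  shows "\<bar>(\<integral>\<omega>. f (\<lambda>i. F i \<omega>) \<partial>M) - (\<integral>z. f z \<partial>std_gauss d)\<bar> \<le> pi / 2 * (K * total_error)"
proof -
  have b: "\<bar>interpol_deriv f' \<theta>\<bar> \<le> K * total_error" for \<theta>
  proof -
    let ?I = "\<lambda>i j \<omega>. \<integral>z. z j * f' i (\<lambda>i. sin \<theta> * F i \<omega> + cos \<theta> * z i) \<partial>std_gauss d"
    let ?S = "\<Sum>i<d. \<Sum>j<d. (\<integral>\<omega>. kernel_error i j \<omega> * ?I i j \<omega> \<partial>M)"
    have "\<bar>?S\<bar> \<le> (\<Sum>i<d. \<Sum>j<d. \<bar>\<integral>\<omega>. kernel_error i j \<omega> * ?I i j \<omega> \<partial>M\<bar>)"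
      by (rule order_trans[OF sum_abs]) (intro sum_mono sum_abs)
    also have "\<dots> \<le> (\<Sum>i<d. \<Sum>j<d. K * (\<integral>\<omega>. \<bar>kernel_error i j \<omega>\<bar> \<partial>M))"
    proof (intro sum_mono)
      fix i j assume "i \<in> {..<d}" "j \<in> {..<d}"
      then have ij: "i < d" "j < d" by auto
      have "\<bar>\<integral>\<omega>. kernel_error i j \<omega> * ?I i j \<omega> \<partial>M\<bar> \<le> (\<integral>\<omega>. K * \<bar>kernel_error i j \<omega>\<bar> \<partial>M)"
      proof (rule integral_abs_bound[THEN order_trans], rule integral_mono)
        fix \<omega>
        have "\<bar>kernel_error i j \<omega>\<bar> * \<bar>?I i j \<omega>\<bar> \<le> \<bar>kernel_error i j \<omega>\<bar> * K"
          by (intro mult_left_mono inner_weight_bound[OF f K[OF ij(1)] ij]) simp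
        then show "\<bar>kernel_error i j \<omega> * ?I i j \<omega>\<bar> \<le> K * \<bar>kernel_error i j \<omega>\<bar>"
          by (simp add: abs_mult mult.commute)
      qed (use outer_int(2)[OF f ij] kernel_error_int[OF ij] in simp_all)
      then show "\<bar>\<integral>\<omega>. kernel_error i j \<omega> * ?I i j \<omega> \<partial>M\<bar> \<le> K * (\<integral>\<omega>. \<bar>kernel_error i j \<omega>\<bar> \<partial>M)" by simp
    qed
    also have "\<dots> = K * total_error" by (simp only: total_error_def sum_distrib_left)
    finally have S: "\<bar>?S\<bar> \<le> K * total_error" .
    have "\<bar>sin \<theta>\<bar> * \<bar>?S\<bar> \<le> 1 * \<bar>?S\<bar>" by (intro mult_right_mono) auto
    then show ?thesis using S unfolding interpol_deriv_def by (simp only: abs_mult mult_1_left)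
  qed
  \<comment> \<open>At \<open>\<theta> = 0\<close> only the Gaussian vector is left, at
    \<open>\<theta> = pi / 2\<close> only \<open>F\<close>.\<close>
  have "\<exists>z>0. z < pi / 2 \<and> interpol f (pi / 2) - interpol f 0 = (pi / 2 - 0) * interpol_deriv f' z"
    by (intro MVT2 interpol_has_derivative[OF f]) auto
  then obtain \<theta> where "interpol f (pi / 2) - interpol f 0 = pi / 2 * interpol_deriv f' \<theta>" by auto
  moreover have "interpol f (pi / 2) = (\<integral>\<omega>. f (\<lambda>i. F i \<omega>) \<partial>M)"
    using prob_space.prob_space[OF prob_space_std_gauss] by (simp add: interpol_def)
  moreover have "interpol f 0 = (\<integral>z. f z \<partial>std_gauss d)"
    by (simp add: interpol_def prob_space)
  moreover have "\<bar>pi / 2 * interpol_deriv f' \<theta>\<bar> = pi / 2 * \<bar>interpol_deriv f' \<theta>\<bar>" by (simp add: abs_mult)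
  moreover have "pi / 2 * \<bar>interpol_deriv f' \<theta>\<bar> \<le> pi / 2 * (K * total_error)"
    by (rule mult_left_mono[OF b]) simp
  ultimately show ?thesis by (simp only:)
qed

end

section \<open>Approximation of Lipschitz functions\<close>

text \<open>Folding keeps the sine and replaces the cosine by its absolute value, which can only
  increase \<open>cos (a - b)\<close>. As the folded points are at most \<open>pi\<close> apart,
  where cosine is decreasing, their distance has not grown.\<close>

lemma arcsin_sin_lipschitz: "\<bar>arcsin (sin a) - arcsin (sin b)\<bar> \<le> \<bar>a - b\<bar>"
proof -
  define u v where "u = arcsin (sin a)" "v = arcsin (sin b)"
  have uv: "- (pi / 2) \<le> u" "u \<le> pi / 2" "- (pi / 2) \<le> v" "v \<le> pi / 2"
    by (simp_all only: u_v_def arcsin_lbound arcsin_ubound sin_ge_minus_one sin_le_one)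
  have s: "sin u = sin a" "sin v = sin b" by (simp_all add: u_v_def)
  have c: "cos u = \<bar>cos a\<bar>" "cos v = \<bar>cos b\<bar>"
  proof -
    have sq: "(cos u)\<^sup>2 = (cos a)\<^sup>2" "(cos v)\<^sup>2 = (cos b)\<^sup>2" by (simp_all add: cos_squared_eq s)
    have ge: "cos u \<ge> 0" "cos v \<ge> 0" using uv by (auto intro: cos_ge_zero)
    show "cos u = \<bar>cos a\<bar>" by (rule power2_eq_imp_eq) (use sq ge in simp_all)
    show "cos v = \<bar>cos b\<bar>" by (rule power2_eq_imp_eq) (use sq ge in simp_all)
  qed
  have "cos (a - b) = cos a * cos b + sin a * sin b" by (rule cos_diff)
  also have "\<dots> \<le> \<bar>cos a\<bar> * \<bar>cos b\<bar> + sin a * sin b" by (simp flip: abs_mult)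
  also have "\<dots> = cos (u - v)" by (simp add: cos_diff s c)
  finally have le: "cos \<bar>a - b\<bar> \<le> cos \<bar>u - v\<bar>" by simp
  have "\<bar>u - v\<bar> \<le> pi" using uv by linarith
  then have "\<bar>u - v\<bar> \<le> \<bar>a - b\<bar>"
    using le cos_monotone_0_pi[of "\<bar>a - b\<bar>" "\<bar>u - v\<bar>"] by force
  then show ?thesis by (simp add: u_v_def)
qed

text \<open>A triangular wave: 1-Lipschitz, a function of \<open>sin (w y)\<close>, and the identity near \<open>0\<close>, so that
  composing with it makes a Lipschitz function periodic.\<close>

definition fold_line :: "real \<Rightarrow> real \<Rightarrow> real" where
  "fold_line w y = arcsin (sin (w * y)) / w"

lemma fold_line_lipschitz: "w > 0 \<Longrightarrow> \<bar>fold_line w x - fold_line w y\<bar> \<le> \<bar>x - y\<bar>"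
  using arcsin_sin_lipschitz[of "w * x" "w * y"]
  by (simp add: fold_line_def abs_mult pos_divide_le_eq mult.commute flip: diff_divide_distrib right_diff_distrib)

text \<open>The frequency is chosen so that folding is the identity on \<open>[-R, R]\<close>;
  outside, \<open>2 \<bar>y\<bar> \<le> 2 y^2 / R\<close>. The quadratic form makes the error
  integrable using second moments only.\<close>

lemma fold_line_error:
  assumes R: "R > 0"
  shows "\<bar>fold_line (pi / (2 * R)) y - y\<bar> \<le> 2 * y\<^sup>2 / R"
proof -
  let ?w = "pi / (2 * R)"
  have w: "?w > 0" using R by simp
  show ?thesis
  proof (cases "\<bar>y\<bar> \<le> R")
    case True
    then have "?w * \<bar>y\<bar> \<le> ?w * R" using w by (intro mult_left_mono) auto
    then have "\<bar>?w * y\<bar> \<le> pi / 2" using w R by (simp add: abs_mult)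
    then have "- (pi / 2) \<le> ?w * y" "?w * y \<le> pi / 2" by linarith+
    then have "arcsin (sin (?w * y)) = ?w * y" by (rule arcsin_sin)
    then show ?thesis using R by (simp add: fold_line_def)
  next
    case False
    have "\<bar>fold_line ?w y - fold_line ?w 0\<bar> \<le> \<bar>y - 0\<bar>" by (rule fold_line_lipschitz[OF w])
    then have "\<bar>fold_line ?w y\<bar> \<le> \<bar>y\<bar>" by (simp add: fold_line_def)
    then have "\<bar>fold_line ?w y - y\<bar> \<le> 2 * \<bar>y\<bar>" by linarith
    also have "\<dots> \<le> 2 * (\<bar>y\<bar> * \<bar>y\<bar> / R)"
    proof -
      have "\<bar>y\<bar> * R \<le> \<bar>y\<bar> * \<bar>y\<bar>" using False by (intro mult_left_mono) auto
      then show ?thesis using R by (simp only: pos_le_divide_eq mult_le_cancel_left_pos zero_less_numeral)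
    qed
    finally show ?thesis by (simp add: power2_eq_square)
  qed
qed

lemma trig_poly_sin_coord:
  assumes "i < d" shows "\<exists>f'. trig_poly d (\<lambda>x. sin (w * x i)) f'"
proof -
  have "(\<Sum>l<d. (if l = i then w else 0) * x l) = w * x i" for x :: "nat \<Rightarrow> real"
    using assms by (simp add: if_distrib[of "\<lambda>y. y * _"] cong: if_cong)
  then have "(\<lambda>x. cos ((\<Sum>l<d. (if l = i then w else 0) * x l) + - (pi / 2))) = (\<lambda>x. sin (w * x i))"
    by (simp add: cos_diff)
  then show ?thesis using trig_poly.cos[of d "\<lambda>l. if l = i then w else 0" "- (pi / 2)"] by auto
qed

text \<open>After folding, \<open>G\<close> depends on \<open>x\<close> only through the sines
  \<open>sin (w x_i)\<close>, a point of a compact cube. Stone-Weierstrass on the cube therefore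
  gives an approximation uniform on the whole space.\<close>

lemma trig_poly_dense:
  fixes G :: "(nat \<Rightarrow> real) \<Rightarrow> real"
  assumes G: "\<And>x y. \<bar>G x - G y\<bar> \<le> (\<Sum>i<d. \<bar>x i - y i\<bar>)" and w: "w > 0" and \<delta>: "\<delta> > 0"
  shows "\<exists>f f'. trig_poly d f f' \<and> (\<forall>x. \<bar>f x - G (\<lambda>i. fold_line w (x i))\<bar> \<le> \<delta>)"
proof -
  \<comment> \<open>Vectors are functions on all naturals, so the cube is completed by
    \<open>{0}\<close> beyond \<open>d\<close>; it is then a product of compact sets.\<close>
  define S :: "(nat \<Rightarrow> real) set" where "S = PiE UNIV (\<lambda>i. if i < d then {-1..1} else {0})"
  let ?u = "\<lambda>x i. if i < d then sin (w * x i) else 0 :: real"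
  define A where "A = {f. continuous_on S f \<and> (\<exists>T T'. trig_poly d T T' \<and> (\<forall>x. T x = f (?u x)))}"
  interpret function_ring_on A S
  proof
    show "compact S"
      unfolding compactin_euclidean_iff[symmetric] S_def
      by (subst euclidean_product_topology[symmetric], subst compactin_PiE) auto
    show "continuous_on S f" if "f \<in> A" for f using that by (simp add: A_def)
    show "(\<lambda>x. f x + g x) \<in> A" if fg: "f \<in> A" "g \<in> A" for f g
    proof -
      from fg obtain T1 T1' T2 T2' where T: "trig_poly d T1 T1'" "\<forall>x. T1 x = f (?u x)" "trig_poly d T2 T2'" "\<forall>x. T2 x = g (?u x)"
        unfolding A_def by blast
      have "\<forall>x. T1 x + T2 x = f (?u x) + g (?u x)" using T(2,4) by simp
      with trig_poly.add[OF T(1,3)]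
      have "trig_poly d (\<lambda>x. T1 x + T2 x) (\<lambda>i x. T1' i x + T2' i x) \<and> (\<forall>x. T1 x + T2 x = f (?u x) + g (?u x))"
        by (rule conjI)
      then show ?thesis using fg unfolding A_def by (auto intro!: continuous_on_add)
    qed
    show "(\<lambda>x. f x * g x) \<in> A" if fg: "f \<in> A" "g \<in> A" for f g
    proof -
      from fg obtain T1 T1' T2 T2' where T: "trig_poly d T1 T1'" "\<forall>x. T1 x = f (?u x)" "trig_poly d T2 T2'" "\<forall>x. T2 x = g (?u x)"
        unfolding A_def by blast
      obtain h' where "trig_poly d (\<lambda>x. T1 x * T2 x) h'" using trig_poly_mult[OF T(1,3)] by blast
      moreover have "\<forall>x. T1 x * T2 x = f (?u x) * g (?u x)" using T(2,4) by simp
      ultimately have "trig_poly d (\<lambda>x. T1 x * T2 x) h' \<and> (\<forall>x. T1 x * T2 x = f (?u x) * g (?u x))"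
        by (rule conjI)
      then show ?thesis using fg unfolding A_def by (auto intro!: continuous_on_mult)
    qed
    show "(\<lambda>_. c) \<in> A" for c
      using trig_poly_const[of d c] unfolding A_def by (auto intro!: continuous_on_const)
    fix x y assume "x \<in> S" "y \<in> S" "x \<noteq> y"
    then obtain i where i: "x i \<noteq> y i" by auto
    then have id: "i < d" using \<open>x \<in> S\<close> \<open>y \<in> S\<close> unfolding S_def PiE_iff by (metis UNIV_I singletonD)
    have "continuous_on S (\<lambda>u. u i)"
      by (rule continuous_on_subset[OF continuous_on_product_coordinates subset_UNIV])
    then have "(\<lambda>u. u i) \<in> A"
      using trig_poly_sin_coord[OF id, of w] id unfolding A_def by auto
    then show "\<exists>f\<in>A. f x \<noteq> f y" using i by (intro bexI[of _ "\<lambda>u. u i"])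
  qed
  let ?k = "\<lambda>u. G (\<lambda>i. arcsin (u i) / w)"
  have "continuous_on S ?k"
    unfolding continuous_on_def
  proof
    fix u assume u: "u \<in> S"
    have b: "- 1 \<le> v i \<and> v i \<le> 1" if "v \<in> S" "i < d" for v i
      using that unfolding S_def PiE_iff by (metis UNIV_I atLeastAtMost_iff)
    have "continuous_on S (\<lambda>v. \<Sum>i<d. \<bar>arcsin (v i) / w - arcsin (u i) / w\<bar>)"
      by (intro continuous_intros continuous_on_subset[OF continuous_on_product_coordinates]) (use b w in auto)
    then have "((\<lambda>v. \<Sum>i<d. \<bar>arcsin (v i) / w - arcsin (u i) / w\<bar>) \<longlongrightarrow> 0) (at u within S)"
      using u unfolding continuous_on_def by force
    then have "((\<lambda>v. ?k v - ?k u) \<longlongrightarrow> 0) (at u within S)"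
      by (rule Lim_null_comparison[rotated]) (use G in \<open>auto intro!: always_eventually\<close>)
    then show "(?k \<longlongrightarrow> ?k u) (at u within S)" by (rule LIM_zero_cancel)
  qed
  then obtain f where f: "f \<in> A" "\<And>x. x \<in> S \<Longrightarrow> \<bar>?k x - f x\<bar> < \<delta>"
    using Stone_Weierstrass_basic[OF _ \<delta>, of ?k] by auto
  then obtain T T' where T: "trig_poly d T T'" "\<And>x. T x = f (?u x)" unfolding A_def by blast
  have "\<bar>T x - G (\<lambda>i. fold_line w (x i))\<bar> \<le> \<delta>" for x
  proof -
    have "?u x \<in> S" by (auto simp: S_def)
    moreover have "?k (?u x) = G (\<lambda>i. fold_line w (x i))"
    proof -
      have "\<bar>?k (?u x) - G (\<lambda>i. fold_line w (x i))\<bar> \<le> (\<Sum>i<d. \<bar>arcsin (?u x i) / w - fold_line w (x i)\<bar>)" by (rule G)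
      also have "\<dots> = 0" by (simp add: fold_line_def)
      finally show ?thesis by simp
    qed
    ultimately show ?thesis using f(2)[of "?u x"] T(2)[of x] by simp
  qed
  then show ?thesis using T(1) by blast
qed

text \<open>The uniform approximation \<open>f\<close> satisfies the Lipschitz bound only up to
  \<open>2 \<delta>\<close>, and its own gradient is not controlled. Smoothing at scale
  \<open>\<epsilon>\<close> bounds the gradient by \<open>1 + 2 \<delta> / \<epsilon>\<close>, which
  explains \<open>\<delta> = \<epsilon>^2\<close>. The error collects \<open>\<delta>\<close> from
  the approximation, \<open>2 \<delta> + \<epsilon> d\<close> from smoothing, and the folding
  error.\<close>

lemma trig_poly_lipschitz_approx:
  fixes G :: "(nat \<Rightarrow> real) \<Rightarrow> real"
  assumes G: "\<And>x y. \<bar>G x - G y\<bar> \<le> (\<Sum>i<d. \<bar>x i - y i\<bar>)" and R: "R > 0" and \<epsilon>: "\<epsilon> > 0"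
  shows "\<exists>h h'. trig_poly d h h' \<and> (\<forall>i<d. \<forall>x. \<bar>h' i x\<bar> \<le> 1 + 2 * \<epsilon>) \<and>
    (\<forall>x. \<bar>h x - G x\<bar> \<le> 3 * \<epsilon>\<^sup>2 + \<epsilon> * real d + (\<Sum>i<d. 2 * (x i)\<^sup>2 / R))"
proof -
  interpret prob_space "std_gauss d" by (rule prob_space_std_gauss)
  define w where "w = pi / (2 * R)"
  define \<delta> where "\<delta> = \<epsilon>\<^sup>2"
  have w: "w > 0" and \<delta>: "\<delta> > 0" using R \<epsilon> by (auto simp: w_def \<delta>_def)
  obtain f f' where f: "trig_poly d f f'" and fG: "\<And>x. \<bar>f x - G (\<lambda>i. fold_line w (x i))\<bar> \<le> \<delta>"
    using trig_poly_dense[OF G w \<delta>] by blast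
  have lip: "\<bar>f x - f y\<bar> \<le> 2 * \<delta> + (\<Sum>i<d. \<bar>x i - y i\<bar>)" for x y
  proof -
    have "\<bar>G (\<lambda>i. fold_line w (x i)) - G (\<lambda>i. fold_line w (y i))\<bar> \<le> (\<Sum>i<d. \<bar>fold_line w (x i) - fold_line w (y i)\<bar>)" by (rule G)
    also have "\<dots> \<le> (\<Sum>i<d. \<bar>x i - y i\<bar>)" by (intro sum_mono fold_line_lipschitz w)
    finally show ?thesis using fG[of x] fG[of y] by linarith
  qed
  obtain h h' where h: "trig_poly d h h'" "\<And>x. h x = (\<integral>z. f (\<lambda>i. x i + \<epsilon> * z i) \<partial>std_gauss d)"
    and h': "\<And>j x. j < d \<Longrightarrow> h' j x = (\<integral>z. f' j (\<lambda>i. x i + \<epsilon> * z i) \<partial>std_gauss d)"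
    using trig_poly_smooth[OF f, of \<epsilon>] by blast
  have mm: "(\<lambda>z. x i + e i * z i) \<in> borel_measurable (std_gauss d)" if "i < d" for i and x e :: "nat \<Rightarrow> real"
    using that by simp
  have zi: "integrable (std_gauss d) (\<lambda>z. z j)" if "j < d" for j
    using std_gauss_abs(1)[OF that] that by (subst (asm) integrable_abs_iff) auto
  have i1: "integrable (std_gauss d) (\<lambda>z. f (\<lambda>i. x i + e i * z i))" for x e
    by (rule trig_poly_integrable(1)[OF f prob_space_std_gauss mm])
  have i2: "integrable (std_gauss d) (\<lambda>z. z j * f (\<lambda>i. x i + e i * z i))" if "j < d" for x e j
    by (rule trig_poly_integrable(3)[OF f prob_space_std_gauss mm zi[OF that]])
  have "\<bar>h' j x\<bar> \<le> 1 + 2 * \<epsilon>" if j: "j < d" for j x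
  proof -
    \<comment> \<open>The comparison point carries no noise in coordinate \<open>j\<close>. Its
      integral against \<open>z j\<close> vanishes, and subtracting it leaves an increment of
      \<open>f\<close> in direction \<open>j\<close> alone, so that the sharp constant
      \<open>1\<close> comes from the second moment of \<open>z j\<close>.\<close>
    let ?e = "\<lambda>i. if i = j then 0 else \<epsilon>"
    have 1: "\<epsilon> * h' j x = (\<integral>z. z j * f (\<lambda>i. x i + \<epsilon> * z i) \<partial>std_gauss d)"
      using trig_poly_gauss_ibp[OF f j, of x "\<lambda>_. \<epsilon>"] h'[OF j, of x] by simp
    have 2: "(\<integral>z. z j * f (\<lambda>i. x i + ?e i * z i) \<partial>std_gauss d) = 0"
      using trig_poly_gauss_ibp[OF f j, of x ?e] by simp
    have "\<epsilon> * h' j x = (\<integral>z. z j * f (\<lambda>i. x i + \<epsilon> * z i) - z j * f (\<lambda>i. x i + ?e i * z i) \<partial>std_gauss d)"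
      using 1 2 i2[OF j, of x "\<lambda>_. \<epsilon>"] i2[OF j, of x ?e] by simp
    also have "\<bar>\<dots>\<bar> \<le> (\<integral>z. 2 * \<delta> * \<bar>z j\<bar> + \<epsilon> * (z j)\<^sup>2 \<partial>std_gauss d)"
    proof (rule integral_abs_bound[THEN order_trans], rule integral_mono)
      fix z :: "nat \<Rightarrow> real"
      have "(\<Sum>i<d. \<bar>x i + \<epsilon> * z i - (x i + ?e i * z i)\<bar>) = (\<Sum>i<d. if i = j then \<epsilon> * \<bar>z j\<bar> else 0)"
        using \<epsilon> by (intro sum.cong) (auto simp: abs_mult)
      also have "\<dots> = \<epsilon> * \<bar>z j\<bar>" using j by simp
      finally have "\<bar>f (\<lambda>i. x i + \<epsilon> * z i) - f (\<lambda>i. x i + ?e i * z i)\<bar> \<le> 2 * \<delta> + \<epsilon> * \<bar>z j\<bar>"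
        using lip[of "\<lambda>i. x i + \<epsilon> * z i" "\<lambda>i. x i + ?e i * z i"] by simp
      then have "\<bar>z j\<bar> * \<bar>f (\<lambda>i. x i + \<epsilon> * z i) - f (\<lambda>i. x i + ?e i * z i)\<bar> \<le> \<bar>z j\<bar> * (2 * \<delta> + \<epsilon> * \<bar>z j\<bar>)"
        by (rule mult_left_mono) simp
      also have "\<dots> = 2 * \<delta> * \<bar>z j\<bar> + \<epsilon> * (z j)\<^sup>2"
        by (simp add: distrib_left power2_eq_square mult_ac)
      finally show "\<bar>z j * f (\<lambda>i. x i + \<epsilon> * z i) - z j * f (\<lambda>i. x i + ?e i * z i)\<bar> \<le> 2 * \<delta> * \<bar>z j\<bar> + \<epsilon> * (z j)\<^sup>2"
        by (simp only: right_diff_distrib[symmetric] abs_mult)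
    qed (use i2[OF j, of x "\<lambda>_. \<epsilon>"] i2[OF j, of x ?e] std_gauss_abs(1,3)[OF j] in simp_all)
    also have "\<dots> = 2 * \<delta> * (\<integral>z. \<bar>z j\<bar> \<partial>std_gauss d) + \<epsilon>"
      using std_gauss_abs(1,3,4)[OF j] by simp
    also have "\<dots> \<le> 2 * \<delta> * 1 + \<epsilon>"
      using std_gauss_abs(2)[OF j] \<delta> by (intro add_right_mono mult_left_mono) auto
    finally have "\<epsilon> * \<bar>h' j x\<bar> \<le> \<epsilon> * (1 + 2 * \<epsilon>)"
      using \<epsilon> by (simp add: abs_mult \<delta>_def power2_eq_square algebra_simps)
    then show ?thesis using \<epsilon> by simp
  qed
  moreover have "\<bar>h x - G x\<bar> \<le> 3 * \<epsilon>\<^sup>2 + \<epsilon> * real d + (\<Sum>i<d. 2 * (x i)\<^sup>2 / R)" for x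
  proof -
    have "h x - f x = (\<integral>z. f (\<lambda>i. x i + \<epsilon> * z i) - f x \<partial>std_gauss d)"
      using h(2) i1[of x "\<lambda>_. \<epsilon>"] prob_space by simp
    also have "\<bar>\<dots>\<bar> \<le> (\<integral>z. 2 * \<delta> + (\<Sum>i<d. \<epsilon> * \<bar>z i\<bar>) \<partial>std_gauss d)"
    proof (rule integral_abs_bound[THEN order_trans], rule integral_mono)
      show "\<bar>f (\<lambda>i. x i + \<epsilon> * z i) - f x\<bar> \<le> 2 * \<delta> + (\<Sum>i<d. \<epsilon> * \<bar>z i\<bar>)" for z
        using lip[of "\<lambda>i. x i + \<epsilon> * z i" x] \<epsilon> by (simp add: abs_mult)
    qed (use i1[of x "\<lambda>_. \<epsilon>"] std_gauss_abs(1) in \<open>auto intro!: Bochner_Integration.integrable_add Bochner_Integration.integrable_sum\<close>)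
    also have "\<dots> = 2 * \<delta> + (\<Sum>i<d. \<epsilon> * (\<integral>z. \<bar>z i\<bar> \<partial>std_gauss d))"
    proof -
      have "integrable (std_gauss d) (\<lambda>z. \<Sum>i<d. \<epsilon> * \<bar>z i\<bar>)"
        by (intro Bochner_Integration.integrable_sum integrable_mult_right std_gauss_abs(1)) simp
      moreover have "(\<integral>z. (\<Sum>i<d. \<epsilon> * \<bar>z i\<bar>) \<partial>std_gauss d) = (\<Sum>i<d. \<integral>z. \<epsilon> * \<bar>z i\<bar> \<partial>std_gauss d)"
        by (intro Bochner_Integration.integral_sum integrable_mult_right std_gauss_abs(1)) simp
      ultimately show ?thesis using prob_space by simp
    qed
    also have "\<dots> \<le> 2 * \<delta> + (\<Sum>i<d. \<epsilon> * 1)"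
      using \<epsilon> by (intro add_left_mono sum_mono mult_left_mono std_gauss_abs(2)) auto
    finally have hf: "\<bar>h x - f x\<bar> \<le> 2 * \<delta> + real d * \<epsilon>" by simp
    have "\<bar>G (\<lambda>i. fold_line w (x i)) - G x\<bar> \<le> (\<Sum>i<d. \<bar>fold_line w (x i) - x i\<bar>)" by (rule G)
    also have "\<dots> \<le> (\<Sum>i<d. 2 * (x i)\<^sup>2 / R)"
      unfolding w_def by (intro sum_mono fold_line_error R)
    finally show ?thesis using hf fG[of x] unfolding \<delta>_def by (simp add: mult.commute) 
  qed
  ultimately show ?thesis using h(1) by blast
qed

section \<open>Passage from trigonometric polynomials to Lipschitz functions\<close>

context stein_kernel
begin

lemma lipschitz_distance:
  assumes g: "lip1 d g"
  shows "\<bar>(\<integral>\<omega>. g (\<lambda>i\<in>{..<d}. F i \<omega>) \<partial>M) - (\<integral>z. g z \<partial>std_gauss d)\<bar> \<le> pi / 2 * total_error"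
proof -
  interpret G: prob_space "std_gauss d" by (rule prob_space_std_gauss)
  \<comment> \<open>\<open>lip1\<close> constrains \<open>g\<close> only on extensional functions;
    composing with restriction makes it Lipschitz on all functions.\<close>
  define G where "G = (\<lambda>x. g (\<lambda>i\<in>{..<d}. x i))"
  have G: "\<bar>G x - G y\<bar> \<le> (\<Sum>i<d. \<bar>x i - y i\<bar>)" for x y
  proof -
    have "\<bar>G x - G y\<bar> \<le> sqrt (\<Sum>i<d. ((\<lambda>i\<in>{..<d}. x i) i - (\<lambda>i\<in>{..<d}. y i) i)\<^sup>2)"
      using g[unfolded lip1_def, THEN bspec, of "\<lambda>i\<in>{..<d}. x i", THEN bspec, of "\<lambda>i\<in>{..<d}. y i"]
      unfolding G_def by auto
    also have "\<dots> = sqrt (\<Sum>i<d. \<bar>x i - y i\<bar>\<^sup>2)" by simp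
    also have "\<dots> \<le> (\<Sum>i<d. \<bar>x i - y i\<bar>)"
      using L2_set_le_sum[of "{..<d}" "\<lambda>i. \<bar>x i - y i\<bar>"] by (simp add: L2_set_def)
    finally show ?thesis .
  qed
  let ?e = "\<lambda>n::nat. 1 / real (Suc n)"
  let ?Q = "\<lambda>n h h'. trig_poly d h h' \<and> (\<forall>i<d. \<forall>x. \<bar>h' i x\<bar> \<le> 1 + 2 * ?e n) \<and>
    (\<forall>x. \<bar>h x - G x\<bar> \<le> 3 * (?e n)\<^sup>2 + ?e n * real d + (\<Sum>i<d. 2 * (x i)\<^sup>2 / real (Suc n)))"
  have "\<exists>h h'. ?Q n h h'" for n
    by (rule trig_poly_lipschitz_approx[OF G]) auto
  then have "\<forall>n. \<exists>u. ?Q n (fst u) (snd u)" by simp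
  from choice[OF this] obtain u where u: "\<forall>n. ?Q n (fst (u n)) (snd (u n))" by blast
  define h h' where "h = (\<lambda>n. fst (u n))" and "h' = (\<lambda>n. snd (u n))"
  have h: "\<And>n. trig_poly d (h n) (h' n)"
    and h': "\<And>n i x. i < d \<Longrightarrow> \<bar>h' n i x\<bar> \<le> 1 + 2 * ?e n"
    and hG0: "\<And>n x. \<bar>h n x - G x\<bar> \<le> 3 * (?e n)\<^sup>2 + ?e n * real d + (\<Sum>i<d. 2 * (x i)\<^sup>2 / real (Suc n))"
    using u unfolding h_def h'_def by blast+
  have hG: "\<bar>h n x - G x\<bar> \<le> ?e n * (3 + real d + 2 * (\<Sum>i<d. (x i)\<^sup>2))" for n x
  proof -
    have "(?e n)\<^sup>2 \<le> ?e n" using power_decreasing[of 1 2 "?e n"] by simp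
    moreover have "(\<Sum>i<d. 2 * (x i)\<^sup>2 / real (Suc n)) = ?e n * (2 * (\<Sum>i<d. (x i)\<^sup>2))"
      by (simp add: sum_distrib_left sum_divide_distrib)
    ultimately show ?thesis using hG0[of n x] by (simp only: distrib_left)
  qed
  have lim0: "(\<lambda>n. ?e n * c) \<longlonglongrightarrow> 0" for c
    using tendsto_mult_left_zero[OF LIMSEQ_inverse_real_of_nat, of c] by (simp add: inverse_eq_divide)
  have conv: "(\<lambda>n. \<integral>\<omega>. h n (\<lambda>i. Y i \<omega>) \<partial>P) \<longlonglongrightarrow> (\<integral>\<omega>. G (\<lambda>i. Y i \<omega>) \<partial>P)"
    if P: "prob_space P" and m: "\<And>i. i < d \<Longrightarrow> Y i \<in> borel_measurable P"
      and sq: "\<And>i. i < d \<Longrightarrow> integrable P (\<lambda>\<omega>. (Y i \<omega>)\<^sup>2)" for P :: "'z measure" and Y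
  proof -
    interpret P: prob_space P by fact
    have hi: "integrable P (\<lambda>\<omega>. h n (\<lambda>i. Y i \<omega>))" for n
      by (rule trig_poly_integrable(1)[OF h P m])
    have pt: "(\<lambda>n. h n (\<lambda>i. Y i \<omega>)) \<longlonglongrightarrow> G (\<lambda>i. Y i \<omega>)" for \<omega>
    proof (rule LIM_zero_cancel, rule Lim_null_comparison)
      show "\<forall>\<^sub>F n in sequentially. norm (h n (\<lambda>i. Y i \<omega>) - G (\<lambda>i. Y i \<omega>)) \<le> ?e n * (3 + real d + 2 * (\<Sum>i<d. (Y i \<omega>)\<^sup>2))"
        using hG by (intro always_eventually allI) simp
    qed (rule lim0)
    \<comment> \<open>\<open>lip1\<close> contains no measurability; it is inherited from the
      trigonometric polynomials as a pointwise limit.\<close>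
    have Gm: "(\<lambda>\<omega>. G (\<lambda>i. Y i \<omega>)) \<in> borel_measurable P"
      by (rule borel_measurable_LIMSEQ_real[OF pt]) (use hi in auto)
    have Si: "integrable P (\<lambda>\<omega>. 3 + real d + 2 * (\<Sum>i<d. (Y i \<omega>)\<^sup>2))"
      by (intro Bochner_Integration.integrable_add integrable_mult_right Bochner_Integration.integrable_sum sq) auto
    have Gi: "integrable P (\<lambda>\<omega>. G (\<lambda>i. Y i \<omega>))"
    proof (rule Bochner_Integration.integrable_bound[OF _ Gm])
      show "integrable P (\<lambda>\<omega>. \<bar>h 0 (\<lambda>i. Y i \<omega>)\<bar> + (3 + real d + 2 * (\<Sum>i<d. (Y i \<omega>)\<^sup>2)))"
        by (rule Bochner_Integration.integrable_add[OF integrable_abs[OF hi] Si])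
      show "AE \<omega> in P. norm (G (\<lambda>i. Y i \<omega>)) \<le> norm (\<bar>h 0 (\<lambda>i. Y i \<omega>)\<bar> + (3 + real d + 2 * (\<Sum>i<d. (Y i \<omega>)\<^sup>2)))"
      proof (rule AE_I2)
        fix \<omega>
        show "norm (G (\<lambda>i. Y i \<omega>)) \<le> norm (\<bar>h 0 (\<lambda>i. Y i \<omega>)\<bar> + (3 + real d + 2 * (\<Sum>i<d. (Y i \<omega>)\<^sup>2)))"
          using hG[of 0 "\<lambda>i. Y i \<omega>"] by simp
      qed
    qed
    show ?thesis
    proof (rule LIM_zero_cancel, rule Lim_null_comparison)
      show "\<forall>\<^sub>F n in sequentially. norm ((\<integral>\<omega>. h n (\<lambda>i. Y i \<omega>) \<partial>P) - (\<integral>\<omega>. G (\<lambda>i. Y i \<omega>) \<partial>P)) \<le>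
          ?e n * (\<integral>\<omega>. 3 + real d + 2 * (\<Sum>i<d. (Y i \<omega>)\<^sup>2) \<partial>P)"
      proof (intro always_eventually allI)
        fix n
        have "(\<integral>\<omega>. h n (\<lambda>i. Y i \<omega>) \<partial>P) - (\<integral>\<omega>. G (\<lambda>i. Y i \<omega>) \<partial>P) = (\<integral>\<omega>. h n (\<lambda>i. Y i \<omega>) - G (\<lambda>i. Y i \<omega>) \<partial>P)"
          using hi Gi by simp
        also have "norm \<dots> \<le> (\<integral>\<omega>. ?e n * (3 + real d + 2 * (\<Sum>i<d. (Y i \<omega>)\<^sup>2)) \<partial>P)"
          unfolding real_norm_def
          by (rule order_trans[OF integral_abs_bound integral_mono[OF
                integrable_abs[OF Bochner_Integration.integrable_diff[OF hi Gi]] integrable_mult_right[OF Si] hG]])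
        also have "\<dots> = ?e n * (\<integral>\<omega>. 3 + real d + 2 * (\<Sum>i<d. (Y i \<omega>)\<^sup>2) \<partial>P)"
          by (rule integral_mult_right_zero)
        finally show "norm ((\<integral>\<omega>. h n (\<lambda>i. Y i \<omega>) \<partial>P) - (\<integral>\<omega>. G (\<lambda>i. Y i \<omega>) \<partial>P)) \<le>
          ?e n * (\<integral>\<omega>. 3 + real d + 2 * (\<Sum>i<d. (Y i \<omega>)\<^sup>2) \<partial>P)" .
      qed
    qed (rule lim0)
  qed
  have c1: "(\<lambda>n. \<integral>\<omega>. h n (\<lambda>i. F i \<omega>) \<partial>M) \<longlonglongrightarrow> (\<integral>\<omega>. g (\<lambda>i\<in>{..<d}. F i \<omega>) \<partial>M)"
    using conv[OF prob_space_axioms, of F] F_sq by (simp add: G_def)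
  have c2: "(\<lambda>n. \<integral>z. h n z \<partial>std_gauss d) \<longlonglongrightarrow> (\<integral>z. g z \<partial>std_gauss d)"
  proof -
    have "(\<lambda>n. \<integral>z. h n (\<lambda>i. z i) \<partial>std_gauss d) \<longlonglongrightarrow> (\<integral>z. G (\<lambda>i. z i) \<partial>std_gauss d)"
      by (rule conv[OF prob_space_std_gauss]) (use std_gauss_abs(3) in auto)
    moreover have "(\<integral>z. G (\<lambda>i. z i) \<partial>std_gauss d) = (\<integral>z. g z \<partial>std_gauss d)"
      by (intro Bochner_Integration.integral_cong) (auto simp: G_def space_std_gauss PiE_restrict)
    ultimately show ?thesis by simp
  qed
  have h2: "\<bar>h' n i x\<bar> \<le> 1 + ?e n * 2" if "i < d" for n i x
    using h'[OF that] by (simp only: mult.commute[of 2])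
  have "\<bar>(\<integral>\<omega>. g (\<lambda>i\<in>{..<d}. F i \<omega>) \<partial>M) - (\<integral>z. g z \<partial>std_gauss d)\<bar> \<le> pi / 2 * ((1 + 0) * total_error)"
  proof (rule LIMSEQ_le)
    show "(\<lambda>n. \<bar>(\<integral>\<omega>. h n (\<lambda>i. F i \<omega>) \<partial>M) - (\<integral>z. h n z \<partial>std_gauss d)\<bar>) \<longlonglongrightarrow>
        \<bar>(\<integral>\<omega>. g (\<lambda>i\<in>{..<d}. F i \<omega>) \<partial>M) - (\<integral>z. g z \<partial>std_gauss d)\<bar>"
      by (intro tendsto_rabs tendsto_diff c1 c2)
    show "(\<lambda>n. pi / 2 * ((1 + ?e n * 2) * total_error)) \<longlonglongrightarrow> pi / 2 * ((1 + 0) * total_error)"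
      by (intro tendsto_mult tendsto_add tendsto_const lim0)
    show "\<exists>N. \<forall>n\<ge>N. \<bar>(\<integral>\<omega>. h n (\<lambda>i. F i \<omega>) \<partial>M) - (\<integral>z. h n z \<partial>std_gauss d)\<bar> \<le> pi / 2 * ((1 + ?e n * 2) * total_error)"
      using trig_poly_distance[OF h h2] by blast
  qed
  then show ?thesis by simp
qed

end

section \<open>Normal approximation on a Wiener chaos\<close>

lemma subset_sum_of_bool:
  fixes g :: "nat \<Rightarrow> real"
  assumes "J \<subseteq> {..<N}" shows "(\<Sum>l<N. of_bool (l \<in> J) * g l) = (\<Sum>l\<in>J. g l)"
  using assms by (intro sum.mono_neutral_cong_right) auto

lemma sum4_swap:
  fixes h :: "nat \<Rightarrow> nat \<Rightarrow> nat \<Rightarrow> nat \<Rightarrow> real"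
  shows "(\<Sum>a<N. \<Sum>b<N. \<Sum>c<N. \<Sum>e<N. h a c b e) = (\<Sum>a<N. \<Sum>b<N. \<Sum>c<N. \<Sum>e<N. h a b c e)"
    and "(\<Sum>a<N. \<Sum>b<N. \<Sum>c<N. \<Sum>e<N. h a b e c) = (\<Sum>a<N. \<Sum>b<N. \<Sum>c<N. \<Sum>e<N. h a b c e)"
proof -
  show "(\<Sum>a<N. \<Sum>b<N. \<Sum>c<N. \<Sum>e<N. h a c b e) = (\<Sum>a<N. \<Sum>b<N. \<Sum>c<N. \<Sum>e<N. h a b c e)"
    by (rule sum.cong[OF refl], rule sum.swap)
  show "(\<Sum>a<N. \<Sum>b<N. \<Sum>c<N. \<Sum>e<N. h a b e c) = (\<Sum>a<N. \<Sum>b<N. \<Sum>c<N. \<Sum>e<N. h a b c e)"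
    by (rule sum.cong[OF refl], rule sum.cong[OF refl], rule sum.swap)
qed

lemma (in prob_space) expectation_abs_le_sqrt:
  fixes D :: "'a \<Rightarrow> real"
  assumes D: "integrable M D" and D2: "integrable M (\<lambda>\<omega>. (D \<omega>)\<^sup>2)"
  shows "(\<integral>\<omega>. \<bar>D \<omega>\<bar> \<partial>M) \<le> sqrt (\<integral>\<omega>. (D \<omega>)\<^sup>2 \<partial>M)"
proof -
  have "variance (\<lambda>\<omega>. \<bar>D \<omega>\<bar>) = (\<integral>\<omega>. \<bar>D \<omega>\<bar>\<^sup>2 \<partial>M) - (\<integral>\<omega>. \<bar>D \<omega>\<bar> \<partial>M)\<^sup>2"
    using D D2 by (intro variance_eq) auto
  then have "(\<integral>\<omega>. \<bar>D \<omega>\<bar> \<partial>M)\<^sup>2 \<le> (\<integral>\<omega>. (D \<omega>)\<^sup>2 \<partial>M)"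
    using variance_positive[of "\<lambda>\<omega>. \<bar>D \<omega>\<bar>"] by simp
  then show ?thesis by (rule real_le_rsqrt)
qed

context gaussian_family
begin

text \<open>After relabelling the summation variables the four terms of \<open>cycle_bound\<close>
  become one and the same sum, with \<open>\<bar>R\<bar>\<close> on two opposite edges and its
  \<open>p\<close>-th power on the others.\<close>

lemma cycle_bound_sum:
  assumes A: "\<And>a. a < N \<Longrightarrow> (\<Sum>b<N. (R a b)\<^sup>2) \<le> A" and B: "\<And>a. a < N \<Longrightarrow> (\<Sum>b<N. \<bar>R a b\<bar> ^ p) \<le> B"
  shows "(\<Sum>a<N. \<Sum>b<N. \<Sum>c<N. \<Sum>e<N. cycle_bound p (edges a b c e)) \<le> 4 * (real N * A * B\<^sup>2)"
proof -
  define f where "f = (\<lambda>a b. \<bar>R a b\<bar>)"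
  define g where "g = (\<lambda>a b. \<bar>R a b\<bar> ^ p)"
  have sym: "f a b = f b a" "g a b = g b a" for a b by (simp_all add: f_def g_def R_sym[of a b])
  let ?S = "\<lambda>h. \<Sum>a<N. \<Sum>b<N. \<Sum>c<N. \<Sum>e<N. h a b c e :: real"
  have main: "?S (\<lambda>a b c e. f a b * f c e * (g a c * g b e)) \<le> real N * A * B\<^sup>2"
    by (rule cycle_sum_bound) (use A B sym in \<open>auto simp: f_def g_def\<close>)
  have s2: "?S (\<lambda>a b c e. f a c * f b e * (g a b * g c e)) = ?S (\<lambda>a b c e. f a b * f c e * (g a c * g b e))"
    by (rule sum4_swap(1)[where h = "\<lambda>a b c e. f a b * f c e * (g a c * g b e)"])
  have s3: "?S (\<lambda>a b c e. f a b * f e c * (g a e * g b c)) = ?S (\<lambda>a b c e. f a b * f c e * (g a c * g b e))"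
    by (rule sum4_swap(2)[where h = "\<lambda>a b c e. f a b * f c e * (g a c * g b e)"])
  have s4: "?S (\<lambda>a b c e. f a e * f b c * (g a b * g e c)) = ?S (\<lambda>a b c e. f a c * f b e * (g a b * g c e))"
    by (rule sum4_swap(2)[where h = "\<lambda>a b c e. f a c * f b e * (g a b * g c e)"])
  have cb: "cycle_bound p (edges a b c e) = f a b * f c e * (g a c * g b e) + f a c * f b e * (g a b * g c e)
      + f a b * f e c * (g a e * g b c) + f a e * f b c * (g a b * g e c)" for a b c e
    by (simp add: cycle_bound_def Let_def f_def g_def abs_mult power_mult_distrib R_sym[of e c] mult_ac)
  have "?S (\<lambda>a b c e. cycle_bound p (edges a b c e)) =
      ?S (\<lambda>a b c e. f a b * f c e * (g a c * g b e)) + ?S (\<lambda>a b c e. f a c * f b e * (g a b * g c e))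
      + ?S (\<lambda>a b c e. f a b * f e c * (g a e * g b c)) + ?S (\<lambda>a b c e. f a e * f b c * (g a b * g e c))"
    by (simp only: cb sum.distrib)
  then show ?thesis using main s2 s3 s4 by linarith
qed

definition chaos :: "nat \<Rightarrow> (nat \<Rightarrow> nat set) \<Rightarrow> (nat \<Rightarrow> real) \<Rightarrow> nat \<Rightarrow> 'a \<Rightarrow> real" where
  "chaos p I s i \<omega> = s i * (\<Sum>k\<in>I i. hermite (Suc p) (X k \<omega>))"

text \<open>In the language of Malliavin calculus this is the inner product of the derivatives of
  \<open>F_i\<close> and \<open>F_j\<close> divided by the order \<open>p + 1\<close> of the
  chaos.\<close>

definition chaos_kernel :: "nat \<Rightarrow> (nat \<Rightarrow> nat set) \<Rightarrow> (nat \<Rightarrow> real) \<Rightarrow> nat \<Rightarrow> nat \<Rightarrow> 'a \<Rightarrow> real" where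
  "chaos_kernel p I s i j \<omega> = s i * s j * real (Suc p) *
     (\<Sum>k\<in>I i. \<Sum>l\<in>I j. R k l * (hermite p (X k \<omega>) * hermite p (X l \<omega>)))"

lemma pair_int:
  assumes "k < N" "l < N"
  shows "integrable M (\<lambda>\<omega>. hermite p (X k \<omega>) * hermite p (X l \<omega>))"
  using integrable_poly_growth[OF poly_growth_mult[OF poly_growth_hermite[OF assms(1), of p] poly_growth_hermite[OF assms(2), of p]]]
    assms by simp

lemma chaos_kernel_integral:
  assumes I: "I i \<subseteq> {..<N}" "I j \<subseteq> {..<N}"
    and h: "h \<in> borel_measurable M" "\<And>\<omega>. \<bar>h \<omega>\<bar> \<le> 1"
  shows "integrable M (\<lambda>\<omega>. chaos_kernel p I s i j \<omega> * h \<omega>)"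
    and "(\<integral>\<omega>. chaos_kernel p I s i j \<omega> * h \<omega> \<partial>M) = s i * s j * real (Suc p) *
     (\<Sum>k\<in>I i. \<Sum>l\<in>I j. R k l * (\<integral>\<omega>. hermite p (X k \<omega>) * hermite p (X l \<omega>) * h \<omega> \<partial>M))"
proof -
  have ih: "integrable M (\<lambda>\<omega>. hermite p (X k \<omega>) * hermite p (X l \<omega>) * h \<omega>)" if "k < N" "l < N" for k l
    using integrable_mult_bounded[OF pair_int[OF that, of p] h] by simp
  have eq: "chaos_kernel p I s i j \<omega> * h \<omega> = s i * s j * real (Suc p) *
     (\<Sum>k\<in>I i. \<Sum>l\<in>I j. R k l * (hermite p (X k \<omega>) * hermite p (X l \<omega>) * h \<omega>))" for \<omega>
    unfolding chaos_kernel_def by (simp only: sum_distrib_right sum_distrib_left mult_ac)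
  have kl: "k < N" "l < N" if "k \<in> I i" "l \<in> I j" for k l using that I by auto
  show "integrable M (\<lambda>\<omega>. chaos_kernel p I s i j \<omega> * h \<omega>)"
    unfolding eq by (intro integrable_mult_right Bochner_Integration.integrable_sum ih kl)
  have "(\<integral>\<omega>. (\<Sum>k\<in>I i. \<Sum>l\<in>I j. R k l * (hermite p (X k \<omega>) * hermite p (X l \<omega>) * h \<omega>)) \<partial>M) =
     (\<Sum>k\<in>I i. \<integral>\<omega>. (\<Sum>l\<in>I j. R k l * (hermite p (X k \<omega>) * hermite p (X l \<omega>) * h \<omega>)) \<partial>M)"
    by (intro Bochner_Integration.integral_sum integrable_mult_right Bochner_Integration.integrable_sum ih kl)
  also have "\<dots> = (\<Sum>k\<in>I i. \<Sum>l\<in>I j. \<integral>\<omega>. R k l * (hermite p (X k \<omega>) * hermite p (X l \<omega>) * h \<omega>) \<partial>M)"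
    by (intro sum.cong refl Bochner_Integration.integral_sum integrable_mult_right ih kl)
  finally show "(\<integral>\<omega>. chaos_kernel p I s i j \<omega> * h \<omega> \<partial>M) = s i * s j * real (Suc p) *
     (\<Sum>k\<in>I i. \<Sum>l\<in>I j. R k l * (\<integral>\<omega>. hermite p (X k \<omega>) * hermite p (X l \<omega>) * h \<omega> \<partial>M))"
    unfolding eq by simp
qed

lemma chaos_stein_kernel:
  assumes I: "\<And>i. i < d \<Longrightarrow> I i \<subseteq> {..<N}"
  shows "stein_kernel M d (chaos p I s) (chaos_kernel p I s)"
proof
  have pg: "poly_growth N (\<lambda>x. s i * (\<Sum>k\<in>I i. hermite (Suc p) (x k)))" if "i < d" for i
    by (intro poly_growth_mult poly_growth_const poly_growth_sum poly_growth_hermite)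
       (use I[OF that] in \<open>auto intro: finite_subset\<close>)
  have ve: "s i * (\<Sum>k\<in>I i. hermite (Suc p) (vec \<omega> k)) = chaos p I s i \<omega>" if "i < d" for i \<omega>
    unfolding chaos_def using I[OF that] by (intro arg_cong[where f = "\<lambda>x. s i * x"] sum.cong) auto
  show Fm: "chaos p I s i \<in> borel_measurable M" if "i < d" for i
    using borel_measurable_integrable[OF integrable_poly_growth[OF pg[OF that]]] ve[OF that] by (simp add: fun_eq_iff)
  show "integrable M (\<lambda>\<omega>. (chaos p I s i \<omega>)\<^sup>2)" if "i < d" for i
    using integrable_poly_growth[OF poly_growth_mult[OF pg[OF that] pg[OF that]]] ve[OF that] by (simp add: power2_eq_square)
  show "integrable M (chaos_kernel p I s i j)" if "i < d" "j < d" for i j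
    using chaos_kernel_integral(1)[OF I[OF that(1)] I[OF that(2)], of "\<lambda>_. 1" p s] by simp
  fix i \<eta> b assume i: "i < d"
  \<comment> \<open>Regroups the phase \<open>\<Sum>j. \<eta> j F j\<close> as one linear
    combination of the \<open>hermite (Suc p) (X l)\<close>, the form that
    \<open>hermite_sin_ibp\<close> handles.\<close>
  define \<alpha> where "\<alpha> = (\<lambda>l. \<Sum>j<d. \<eta> j * s j * of_bool (l \<in> I j))"
  have lin: "(\<Sum>l<N. \<alpha> l * g l) = (\<Sum>j<d. \<eta> j * s j * (\<Sum>l\<in>I j. g l))" for g :: "nat \<Rightarrow> real"
  proof -
    have "(\<Sum>l<N. \<alpha> l * g l) = (\<Sum>l<N. \<Sum>j<d. \<eta> j * s j * (of_bool (l \<in> I j) * g l))"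
      unfolding \<alpha>_def by (simp only: sum_distrib_right mult.assoc)
    also have "\<dots> = (\<Sum>j<d. \<Sum>l<N. \<eta> j * s j * (of_bool (l \<in> I j) * g l))" by (rule sum.swap)
    also have "\<dots> = (\<Sum>j<d. \<eta> j * s j * (\<Sum>l\<in>I j. g l))"
      using I by (intro sum.cong refl) (simp only: sum_distrib_left[symmetric] subset_sum_of_bool lessThan_iff)
    finally show ?thesis .
  qed
  have ph: "(\<Sum>j<d. \<eta> j * chaos p I s j \<omega>) = (\<Sum>l<N. \<alpha> l * hermite (Suc p) (X l \<omega>))" for \<omega>
    unfolding lin chaos_def by (simp only: mult.assoc)
  let ?P = "\<lambda>\<omega>. (\<Sum>l<N. \<alpha> l * hermite (Suc p) (X l \<omega>)) + b"
  have Pm: "?P \<in> borel_measurable M"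
    unfolding ph[symmetric] by (intro borel_measurable_add borel_measurable_sum borel_measurable_times borel_measurable_const Fm) simp
  let ?E = "\<lambda>k l. \<integral>\<omega>. hermite p (X k \<omega>) * hermite p (X l \<omega>) * cos (?P \<omega>) \<partial>M"
  have kN: "k < N" if "k \<in> I i" for k using I[OF i] that by auto
  have hs: "integrable M (\<lambda>\<omega>. hermite (Suc p) (X k \<omega>) * sin (?P \<omega>))" if "k < N" for k
  proof (rule integrable_mult_bounded[of _ _ _ 1])
    show "integrable M (\<lambda>\<omega>. hermite (Suc p) (X k \<omega>))"
      using integrable_poly_growth[OF poly_growth_hermite[OF that, of "Suc p"]] that by simp
    show "(\<lambda>\<omega>. sin (?P \<omega>)) \<in> borel_measurable M" by (rule measurable_compose[OF Pm borel_measurable_sin])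
  qed simp
  have "(\<integral>\<omega>. chaos p I s i \<omega> * sin (?P \<omega>) \<partial>M) = s i * (\<Sum>k\<in>I i. \<integral>\<omega>. hermite (Suc p) (X k \<omega>) * sin (?P \<omega>) \<partial>M)"
  proof -
    have "(\<integral>\<omega>. chaos p I s i \<omega> * sin (?P \<omega>) \<partial>M) = (\<integral>\<omega>. s i * (\<Sum>k\<in>I i. hermite (Suc p) (X k \<omega>) * sin (?P \<omega>)) \<partial>M)"
      unfolding chaos_def by (simp only: sum_distrib_right mult.assoc)
    also have "\<dots> = s i * (\<Sum>k\<in>I i. \<integral>\<omega>. hermite (Suc p) (X k \<omega>) * sin (?P \<omega>) \<partial>M)"
      by (subst integral_mult_right_zero, subst Bochner_Integration.integral_sum) (auto intro!: hs kN)
    finally show ?thesis .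
  qed
  also have "\<dots> = s i * (\<Sum>k\<in>I i. \<Sum>l<N. \<alpha> l * R k l * real (Suc p) * ?E k l)"
    using hermite_sin_ibp[of _ p \<alpha> b] kN by (intro arg_cong[where f = "\<lambda>x. s i * x"] sum.cong refl) blast
  also have "\<dots> = s i * (\<Sum>k\<in>I i. \<Sum>j<d. \<eta> j * s j * (\<Sum>l\<in>I j. R k l * real (Suc p) * ?E k l))"
    using lin[of "\<lambda>l. R _ l * real (Suc p) * ?E _ l"] by (simp only: mult.assoc)
  also have "\<dots> = s i * (\<Sum>j<d. \<Sum>k\<in>I i. \<eta> j * s j * (\<Sum>l\<in>I j. R k l * real (Suc p) * ?E k l))"
    by (subst sum.swap) (rule refl)
  also have "\<dots> = (\<Sum>j<d. \<eta> j * (s i * s j * real (Suc p) * (\<Sum>k\<in>I i. \<Sum>l\<in>I j. R k l * ?E k l)))"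
    by (simp only: sum_distrib_left sum_distrib_right mult_ac)
  also have "\<dots> = (\<Sum>j<d. \<eta> j * (\<integral>\<omega>. chaos_kernel p I s i j \<omega> * cos (?P \<omega>) \<partial>M))"
  proof (rule sum.cong[OF refl])
    fix j assume "j \<in> {..<d}"
    then have j: "j < d" by simp
    have "(\<lambda>\<omega>. cos (?P \<omega>)) \<in> borel_measurable M" by (rule measurable_compose[OF Pm borel_measurable_cos])
    from chaos_kernel_integral(2)[OF I[OF i] I[OF j] this, of p s]
    show "\<eta> j * (s i * s j * real (Suc p) * (\<Sum>k\<in>I i. \<Sum>l\<in>I j. R k l * ?E k l)) =
      \<eta> j * (\<integral>\<omega>. chaos_kernel p I s i j \<omega> * cos (?P \<omega>) \<partial>M)" by simp
  qed
  finally show "(\<integral>\<omega>. chaos p I s i \<omega> * sin ((\<Sum>j<d. \<eta> j * chaos p I s j \<omega>) + b) \<partial>M) =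
      (\<Sum>j<d. \<eta> j * (\<integral>\<omega>. chaos_kernel p I s i j \<omega> * cos ((\<Sum>j<d. \<eta> j * chaos p I s j \<omega>) + b) \<partial>M))"
    unfolding ph .
qed

lemma chaos_kernel_mean:
  assumes I: "I i \<subseteq> {..<N}" "I j \<subseteq> {..<N}"
  shows "(\<integral>\<omega>. chaos_kernel p I s i j \<omega> \<partial>M) = s i * s j * fact (Suc p) * (\<Sum>k\<in>I i. \<Sum>l\<in>I j. R k l ^ Suc p)"
proof -
  have "(\<integral>\<omega>. chaos_kernel p I s i j \<omega> \<partial>M) = s i * s j * real (Suc p) * (\<Sum>k\<in>I i. \<Sum>l\<in>I j. R k l * (fact p * R k l ^ p))"
  proof -
    have "(\<Sum>k\<in>I i. \<Sum>l\<in>I j. R k l * (\<integral>\<omega>. hermite p (X k \<omega>) * hermite p (X l \<omega>) \<partial>M)) =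
        (\<Sum>k\<in>I i. \<Sum>l\<in>I j. R k l * (fact p * R k l ^ p))"
      using I by (intro sum.cong refl) (simp add: hermite_covariance subset_iff)
    then show ?thesis using chaos_kernel_integral(2)[OF I, of "\<lambda>_. 1" p s] by simp
  qed
  also have "\<dots> = s i * s j * fact (Suc p) * (\<Sum>k\<in>I i. \<Sum>l\<in>I j. R k l ^ Suc p)"
    by (simp add: sum_distrib_left sum_distrib_right mult_ac)
  finally show ?thesis .
qed

lemma chaos_kernel_variance:
  fixes s :: "nat \<Rightarrow> real"
  assumes I: "I i \<subseteq> {..<N}" "I j \<subseteq> {..<N}"
    and A: "\<And>a. a < N \<Longrightarrow> (\<Sum>b<N. (R a b)\<^sup>2) \<le> A" and B: "\<And>a. a < N \<Longrightarrow> (\<Sum>b<N. \<bar>R a b\<bar> ^ p) \<le> B"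
    and K: "K \<ge> 0" "\<And>z. \<bar>z 0 * z 5 * (wick p p p p z - fact p * z 0 ^ p * (fact p * z 5 ^ p))\<bar> \<le> K * cycle_bound p z"
  defines "D \<equiv> \<lambda>\<omega>. chaos_kernel p I s i j \<omega> - (\<integral>\<omega>. chaos_kernel p I s i j \<omega> \<partial>M)"
  shows "integrable M (\<lambda>\<omega>. (D \<omega>)\<^sup>2)"
    "(\<integral>\<omega>. (D \<omega>)\<^sup>2 \<partial>M) \<le> (s i * s j * real (Suc p))\<^sup>2 * (K * (4 * (real N * A * B\<^sup>2)))"
proof -
  \<comment> \<open>The coefficients are extended by zero so that all sums run over
    \<open>{..<N}\<close> and the full cycle bound can be used.\<close>
  define w where "w = (\<lambda>k l. of_bool (k \<in> I i) * (of_bool (l \<in> I j) * R k l))"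
  define U where "U = (\<lambda>k l \<omega>. hermite p (X k \<omega>) * hermite p (X l \<omega>) - fact p * R k l ^ p)"
  let ?c = "s i * s j * real (Suc p)"
  have wsum: "(\<Sum>k<N. \<Sum>l<N. w k l * g k l) = (\<Sum>k\<in>I i. \<Sum>l\<in>I j. R k l * g k l)" for g :: "nat \<Rightarrow> nat \<Rightarrow> real"
  proof -
    have "(\<Sum>k<N. \<Sum>l<N. w k l * g k l) = (\<Sum>k<N. of_bool (k \<in> I i) * (\<Sum>l<N. of_bool (l \<in> I j) * (R k l * g k l)))"
      unfolding w_def by (simp only: sum_distrib_left mult.assoc)
    then show ?thesis by (simp only: subset_sum_of_bool[OF I(1)] subset_sum_of_bool[OF I(2)])
  qed
  have D: "D \<omega> = ?c * (\<Sum>k<N. \<Sum>l<N. w k l * U k l \<omega>)" for \<omega>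
  proof -
    have "(\<integral>\<omega>. chaos_kernel p I s i j \<omega> \<partial>M) = ?c * (\<Sum>k\<in>I i. \<Sum>l\<in>I j. R k l * (fact p * R k l ^ p))"
      unfolding chaos_kernel_mean[OF I] by (simp add: sum_distrib_left sum_distrib_right mult_ac)
    then show ?thesis
      unfolding D_def wsum U_def chaos_kernel_def
      by (simp only: right_diff_distrib sum_subtractf)
  qed
  have D2: "(D \<omega>)\<^sup>2 = ?c\<^sup>2 * (\<Sum>k<N. \<Sum>l<N. \<Sum>k'<N. \<Sum>l'<N. (w k l * w k' l') * (U k l \<omega> * U k' l' \<omega>))" for \<omega>
  proof -
    have "(\<Sum>k<N. \<Sum>l<N. w k l * U k l \<omega>)\<^sup>2 = (\<Sum>k<N. \<Sum>l<N. (w k l * U k l \<omega>) * (\<Sum>k'<N. \<Sum>l'<N. w k' l' * U k' l' \<omega>))"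
      by (simp only: power2_eq_square sum_distrib_right)
    also have "\<dots> = (\<Sum>k<N. \<Sum>l<N. \<Sum>k'<N. \<Sum>l'<N. (w k l * w k' l') * (U k l \<omega> * U k' l' \<omega>))"
      by (simp only: sum_distrib_left mult_ac)
    finally show ?thesis unfolding D power_mult_distrib by simp
  qed
  have pgU: "poly_growth N (\<lambda>x. hermite p (x k) * hermite p (x l) + - (fact p * R k l ^ p))" if "k < N" "l < N" for k l
    by (intro poly_growth_add poly_growth_mult poly_growth_hermite poly_growth_const that)
  have UU: "integrable M (\<lambda>\<omega>. U k l \<omega> * U k' l' \<omega>)" if "k < N" "l < N" "k' < N" "l' < N" for k l k' l'
    using integrable_poly_growth[OF poly_growth_mult[OF pgU[OF that(1,2)] pgU[OF that(3,4)]]] that by (simp add: U_def)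
  have cov: "(\<integral>\<omega>. U k l \<omega> * U k' l' \<omega> \<partial>M) = wick p p p p (edges k l k' l') - fact p * R k l ^ p * (fact p * R k' l' ^ p)"
    if n: "k < N" "l < N" "k' < N" "l' < N" for k l k' l'
  proof -
    let ?H = "\<lambda>k \<omega>. hermite p (X k \<omega>)" and ?m = "fact p * R k l ^ p" and ?m' = "fact p * R k' l' ^ p"
    have i4: "integrable M (\<lambda>\<omega>. ?H k \<omega> * (?H l \<omega> * ?H k' \<omega> * ?H l' \<omega>))"
      using integrable_poly_growth[OF poly_growth_mult[OF poly_growth_hermite[OF n(1), of p] poly_growth_mult[OF poly_growth_mult[OF
          poly_growth_hermite[OF n(2), of p] poly_growth_hermite[OF n(3), of p]] poly_growth_hermite[OF n(4), of p]]]] n by simp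
    have "(\<integral>\<omega>. U k l \<omega> * U k' l' \<omega> \<partial>M) = (\<integral>\<omega>. ?H k \<omega> * (?H l \<omega> * ?H k' \<omega> * ?H l' \<omega>) - ?m * (?H k' \<omega> * ?H l' \<omega>)
        - ?m' * (?H k \<omega> * ?H l \<omega>) + ?m * ?m' \<partial>M)"
      unfolding U_def by (intro Bochner_Integration.integral_cong) (simp_all add: algebra_simps)
    also have "\<dots> = moment4 k p l p k' p l' p - ?m * ?m' - ?m' * ?m + ?m * ?m'"
      using i4 pair_int[OF n(1,2), of p] pair_int[OF n(3,4), of p]
      by (simp add: moment4_def hermite_covariance n prob_space)
    finally show ?thesis by (simp add: moment4_wick n)
  qed
  show "integrable M (\<lambda>\<omega>. (D \<omega>)\<^sup>2)"
    unfolding D2 by (intro integrable_mult_right Bochner_Integration.integrable_sum UU) auto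
  have "(\<integral>\<omega>. (D \<omega>)\<^sup>2 \<partial>M) = ?c\<^sup>2 * (\<Sum>k<N. \<Sum>l<N. \<Sum>k'<N. \<Sum>l'<N. (w k l * w k' l') * (\<integral>\<omega>. U k l \<omega> * U k' l' \<omega> \<partial>M))"
  proof -
    have "(\<integral>\<omega>. (\<Sum>k<N. \<Sum>l<N. \<Sum>k'<N. \<Sum>l'<N. (w k l * w k' l') * (U k l \<omega> * U k' l' \<omega>)) \<partial>M) =
       (\<Sum>k<N. \<integral>\<omega>. (\<Sum>l<N. \<Sum>k'<N. \<Sum>l'<N. (w k l * w k' l') * (U k l \<omega> * U k' l' \<omega>)) \<partial>M)"
      by (intro Bochner_Integration.integral_sum Bochner_Integration.integrable_sum integrable_mult_right UU; simp)
    also have "\<dots> = (\<Sum>k<N. \<Sum>l<N. \<integral>\<omega>. (\<Sum>k'<N. \<Sum>l'<N. (w k l * w k' l') * (U k l \<omega> * U k' l' \<omega>)) \<partial>M)"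
      by (intro sum.cong refl Bochner_Integration.integral_sum Bochner_Integration.integrable_sum integrable_mult_right UU; simp)
    also have "\<dots> = (\<Sum>k<N. \<Sum>l<N. \<Sum>k'<N. \<integral>\<omega>. (\<Sum>l'<N. (w k l * w k' l') * (U k l \<omega> * U k' l' \<omega>)) \<partial>M)"
      by (intro sum.cong refl Bochner_Integration.integral_sum Bochner_Integration.integrable_sum integrable_mult_right UU; simp)
    also have "\<dots> = (\<Sum>k<N. \<Sum>l<N. \<Sum>k'<N. \<Sum>l'<N. \<integral>\<omega>. (w k l * w k' l') * (U k l \<omega> * U k' l' \<omega>) \<partial>M)"
      by (intro sum.cong refl Bochner_Integration.integral_sum integrable_mult_right UU; simp)
    finally show ?thesis unfolding D2 by simp
  qed
  also have "\<dots> \<le> ?c\<^sup>2 * (\<Sum>k<N. \<Sum>l<N. \<Sum>k'<N. \<Sum>l'<N. K * cycle_bound p (edges k l k' l'))"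
  proof (intro mult_left_mono sum_mono)
    fix k l k' l' assume "k \<in> {..<N}" "l \<in> {..<N}" "k' \<in> {..<N}" "l' \<in> {..<N}"
    then have n: "k < N" "l < N" "k' < N" "l' < N" by auto
    let ?C = "wick p p p p (edges k l k' l') - fact p * R k l ^ p * (fact p * R k' l' ^ p)"
    have "(w k l * w k' l') * (\<integral>\<omega>. U k l \<omega> * U k' l' \<omega> \<partial>M) \<le> \<bar>w k l * w k' l'\<bar> * \<bar>?C\<bar>"
      unfolding cov[OF n] by (metis abs_ge_self abs_mult)
    \<comment> \<open>Here the indicators are dropped. The remaining bound is nonnegative and no
      longer depends on the blocks.\<close>
    also have "\<dots> \<le> \<bar>R k l * R k' l'\<bar> * \<bar>?C\<bar>"
      by (intro mult_right_mono) (auto simp: w_def abs_mult)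
    also have "\<dots> = \<bar>R k l * R k' l' * ?C\<bar>" by (simp only: abs_mult)
    also have "\<dots> \<le> K * cycle_bound p (edges k l k' l')"
      using K(2)[of "edges k l k' l'"] by simp
    finally show "(w k l * w k' l') * (\<integral>\<omega>. U k l \<omega> * U k' l' \<omega> \<partial>M) \<le> K * cycle_bound p (edges k l k' l')" .
  qed simp
  also have "\<dots> = ?c\<^sup>2 * (K * (\<Sum>k<N. \<Sum>l<N. \<Sum>k'<N. \<Sum>l'<N. cycle_bound p (edges k l k' l')))"
    by (simp only: sum_distrib_left)
  also have "\<dots> \<le> ?c\<^sup>2 * (K * (4 * (real N * A * B\<^sup>2)))"
    by (intro mult_left_mono cycle_bound_sum A B K(1)) auto
  finally show "(\<integral>\<omega>. (D \<omega>)\<^sup>2 \<partial>M) \<le> ?c\<^sup>2 * (K * (4 * (real N * A * B\<^sup>2)))" .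
qed

text \<open>The kernel error is split into its bias, at most \<open>E1\<close>, and its fluctuation,
  whose first absolute moment is at most the standard deviation and hence \<open>E2\<close>;
  \<open>d^2\<close> counts the entries.\<close>

theorem chaos_distance:
  assumes I: "\<And>i. i < d \<Longrightarrow> I i \<subseteq> {..<N}"
    and A: "\<And>a. a < N \<Longrightarrow> (\<Sum>b<N. (R a b)\<^sup>2) \<le> A" and B: "\<And>a. a < N \<Longrightarrow> (\<Sum>b<N. \<bar>R a b\<bar> ^ p) \<le> B"
    and K: "K \<ge> 0" "\<And>z. \<bar>z 0 * z 5 * (wick p p p p z - fact p * z 0 ^ p * (fact p * z 5 ^ p))\<bar> \<le> K * cycle_bound p z"
    and E1: "\<And>i j. i < d \<Longrightarrow> j < d \<Longrightarrow>
       \<bar>s i * s j * fact (Suc p) * (\<Sum>k\<in>I i. \<Sum>l\<in>I j. R k l ^ Suc p) - (if i = j then 1 else 0)\<bar> \<le> E1"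
    and E2: "E2 \<ge> 0" "\<And>i j. i < d \<Longrightarrow> j < d \<Longrightarrow>
       (s i * s j * real (Suc p))\<^sup>2 * (K * (4 * (real N * A * B\<^sup>2))) \<le> E2\<^sup>2"
    and g: "lip1 d g"
  shows "\<bar>(\<integral>\<omega>. g (\<lambda>i\<in>{..<d}. chaos p I s i \<omega>) \<partial>M) - (\<integral>z. g z \<partial>std_gauss d)\<bar> \<le> pi / 2 * ((real d)\<^sup>2 * (E1 + E2))"
proof -
  interpret S: stein_kernel M d "chaos p I s" "chaos_kernel p I s"
    by (rule chaos_stein_kernel[OF I])
  have "(\<integral>\<omega>. \<bar>S.kernel_error i j \<omega>\<bar> \<partial>M) \<le> E1 + E2" if ij: "i < d" "j < d" for i j
  proof -
    let ?W = "chaos_kernel p I s i j" and ?\<delta> = "if i = j then 1 else 0 :: real"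
    let ?m = "\<integral>\<omega>. ?W \<omega> \<partial>M"
    let ?D = "\<lambda>\<omega>. ?W \<omega> - ?m"
    note var = chaos_kernel_variance[OF I[OF ij(1)] I[OF ij(2)] A B K, of s]
    have iW: "integrable M ?W" by (rule S.W_int[OF ij])
    have "(\<integral>\<omega>. \<bar>S.kernel_error i j \<omega>\<bar> \<partial>M) \<le> (\<integral>\<omega>. \<bar>?D \<omega>\<bar> + \<bar>?m - ?\<delta>\<bar> \<partial>M)"
      by (rule integral_mono) (use S.kernel_error_int[OF ij] iW in \<open>auto simp: S.kernel_error_def\<close>)
    also have "\<dots> = (\<integral>\<omega>. \<bar>?D \<omega>\<bar> \<partial>M) + \<bar>?m - ?\<delta>\<bar>"
      using iW by (simp add: prob_space)
    also have "\<bar>?m - ?\<delta>\<bar> \<le> E1"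
      using E1[OF ij] by (simp only: chaos_kernel_mean[OF I[OF ij(1)] I[OF ij(2)]])
    also have "(\<integral>\<omega>. \<bar>?D \<omega>\<bar> \<partial>M) \<le> sqrt (\<integral>\<omega>. (?D \<omega>)\<^sup>2 \<partial>M)"
      by (rule expectation_abs_le_sqrt) (use iW var(1) in auto)
    also have "\<dots> \<le> sqrt (E2\<^sup>2)" using var(2) E2(2)[OF ij] by (intro real_sqrt_le_mono) linarith
    also have "\<dots> = E2" using E2(1) by simp
    finally show ?thesis by simp
  qed
  then have "S.total_error \<le> (\<Sum>i<d. \<Sum>j<d. E1 + E2)"
    unfolding S.total_error_def by (intro sum_mono) auto
  also have "\<dots> = (real d)\<^sup>2 * (E1 + E2)" by (simp add: power2_eq_square)
  finally have "pi / 2 * S.total_error \<le> pi / 2 * ((real d)\<^sup>2 * (E1 + E2))" by (intro mult_left_mono) auto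
  then show ?thesis using S.lipschitz_distance[OF g] by linarith
qed

end

section \<open>Increments of fractional Brownian motion\<close>

lemma fbm_cov_increments:
  "fbm_cov H (x + 1) (y + 1) - fbm_cov H (x + 1) y - fbm_cov H x (y + 1) + fbm_cov H x y = rho_fbm H (x - y)"
proof -
  have "\<bar>y + 1 - (x + 1)\<bar> = \<bar>x - y\<bar>" "\<bar>y - x\<bar> = \<bar>x - y\<bar>" "\<bar>y - (x + 1)\<bar> = \<bar>x - y + 1\<bar>" "\<bar>y + 1 - x\<bar> = \<bar>x - y - 1\<bar>"
    by linarith+
  then show ?thesis by (simp add: fbm_cov_def rho_fbm_def field_simps)
qed

lemma sum_lessThan_plus: "(\<Sum>i<m + n. f i) = (\<Sum>i<m. f i) + (\<Sum>i<n. f (m + i))" for f :: "nat \<Rightarrow> real"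
  by (induction n) (simp_all add: add.assoc)

text \<open>A combination of \<open>N\<close> increments is a combination of \<open>2 N\<close>
  values of \<open>B\<close>, and the double difference of \<open>fbm_cov\<close> is
  \<open>rho_fbm\<close>.\<close>

lemma fbm_increments_gaussian:
  assumes B: "is_fbm M H B"
  shows "gaussian_family M N (\<lambda>k \<omega>. B (real k + 1) \<omega> - B (real k) \<omega>) (\<lambda>k l. rho_fbm H (real k - real l))"
proof -
  interpret prob_space M using B by (simp add: is_fbm_def)
  show ?thesis
  proof
    show "(\<lambda>\<omega>. B (real i + 1) \<omega> - B (real i) \<omega>) \<in> borel_measurable M" for i
      using B by (intro borel_measurable_diff) (simp_all add: is_fbm_def)
    show "rho_fbm H (real i - real i) = 1" for i by simp
    show "rho_fbm H (real i - real j) = rho_fbm H (real j - real i)" for i j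
      using rho_fbm_minus[of H "real i - real j"] by simp
    fix c :: "nat \<Rightarrow> real"
    \<comment> \<open>First the right end points with coefficients \<open>c\<close>, then the left
      end points with \<open>- c\<close>. Times occur repeatedly, which \<open>is_fbm\<close>
      permits.\<close>
    define ts where "ts = (\<lambda>i. if i < N then real i + 1 else real (i - N))"
    define cc where "cc = (\<lambda>i. if i < N then c i else - c (i - N))"
    have cg: "\<And>(m::nat) ts c. (\<forall>i<m. ts i \<ge> 0) \<Longrightarrow>
        centered_gaussian_rv M (\<lambda>\<omega>. \<Sum>i<m. c i * B (ts i) \<omega>)
          (\<Sum>i<m. \<Sum>j<m. c i * c j * fbm_cov H (ts i) (ts j))"
      using B unfolding is_fbm_def by blast
    have split: "(\<Sum>i<N + N. cc i * f (ts i)) = (\<Sum>i<N. c i * (f (real i + 1) - f (real i)))" for f :: "real \<Rightarrow> real"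
      unfolding sum_lessThan_plus by (simp add: cc_def ts_def sum_negf right_diff_distrib sum_subtractf)
    have "centered_gaussian_rv M (\<lambda>\<omega>. \<Sum>i<N + N. cc i * B (ts i) \<omega>)
          (\<Sum>i<N + N. \<Sum>j<N + N. cc i * cc j * fbm_cov H (ts i) (ts j))"
      by (rule cg) (auto simp: ts_def)
    moreover have "(\<Sum>i<N + N. cc i * B (ts i) \<omega>) = (\<Sum>i<N. c i * (B (real i + 1) \<omega> - B (real i) \<omega>))" for \<omega>
      by (rule split)
    moreover have "(\<Sum>i<N + N. \<Sum>j<N + N. cc i * cc j * fbm_cov H (ts i) (ts j)) =
        (\<Sum>i<N. \<Sum>j<N. c i * c j * rho_fbm H (real i - real j))"
    proof -
      have "(\<Sum>i<N + N. \<Sum>j<N + N. cc i * cc j * fbm_cov H (ts i) (ts j)) =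
         (\<Sum>i<N + N. cc i * (\<Sum>j<N + N. cc j * fbm_cov H (ts i) (ts j)))"
        by (simp only: sum_distrib_left mult.assoc)
      also have "\<dots> = (\<Sum>i<N. c i * ((\<Sum>j<N. c j * (fbm_cov H (real i + 1) (real j + 1) - fbm_cov H (real i + 1) (real j)))
          - (\<Sum>j<N. c j * (fbm_cov H (real i) (real j + 1) - fbm_cov H (real i) (real j)))))"
        by (simp only: split[of "fbm_cov H _"] split[of "\<lambda>s. \<Sum>j<N. c j * (fbm_cov H s (real j + 1) - fbm_cov H s (real j))"])
      also have "\<dots> = (\<Sum>i<N. c i * (\<Sum>j<N. c j * rho_fbm H (real i - real j)))"
        unfolding sum_subtractf[symmetric] right_diff_distrib[symmetric]
        by (intro sum.cong refl arg_cong2[where f = "(*)"]) (simp add: fbm_cov_increments[symmetric])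
      finally show ?thesis by (simp only: sum_distrib_left mult.assoc)
    qed
    ultimately show "centered_gaussian_rv M (\<lambda>\<omega>. \<Sum>i<N. c i * (B (real i + 1) \<omega> - B (real i) \<omega>))
        (\<Sum>i<N. \<Sum>j<N. c i * c j * rho_fbm H (real i - real j))" by simp
  qed
qed

lemma increasing_times:
  assumes "t 0 = 0" "\<forall>i<d. t i < t (Suc i)"
  shows "i \<le> j \<Longrightarrow> j \<le> d \<Longrightarrow> t i \<le> (t j :: real)"
proof (induction j)
  case (Suc j)
  show ?case
  proof (cases "i = Suc j")
    case False
    then have "t i \<le> t j" using Suc by simp
    also have "t j < t (Suc j)" using assms(2) Suc.prems(2) by simp
    finally show ?thesis by simp
  qed simp
qed simp

lemma floor_count_diff:
  assumes "0 \<le> x" "x \<le> y"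
  shows "\<bar>real (nat \<lfloor>y\<rfloor> - nat \<lfloor>x\<rfloor>) - (y - x)\<bar> \<le> 1"
proof -
  have "nat \<lfloor>x\<rfloor> \<le> nat \<lfloor>y\<rfloor>" using assms by (intro nat_mono floor_mono)
  then have "real (nat \<lfloor>y\<rfloor> - nat \<lfloor>x\<rfloor>) = real_of_int \<lfloor>y\<rfloor> - real_of_int \<lfloor>x\<rfloor>"
    using assms by (simp add: of_nat_diff)
  then show ?thesis by linarith
qed

text \<open>Since \<open>sigma_fbm\<close> squared is \<open>q!\<close> times
  \<open>corr_sum\<close>, the factorials cancel and the prefactor is of order \<open>1 / n\<close>;
  the error \<open>n^(1 + r)\<close> of \<open>mean_estimates\<close> thus becomes
  \<open>n^r\<close>. On the diagonal the leading term is the block length times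
  \<open>corr_sum\<close>, which the prefactor turns into \<open>1\<close> up to rounding.\<close>

lemma increments_covariance_estimate:
  fixes H :: real and p d :: nat and t :: "nat \<Rightarrow> real"
  assumes H: "0 < H" "H < 1" and p: "p \<ge> 1" and Hq: "H < 1 - 1 / (2 * real (Suc p))"
    and t0: "t 0 = 0" and t: "\<forall>i<d. t i < t (Suc i)"
    and \<delta>: "\<delta> > 0" "\<And>i. i < d \<Longrightarrow> \<delta> \<le> t (Suc i) - t i"
  defines "a \<equiv> \<lambda>n i. nat \<lfloor>real n * t i\<rfloor>"
    and "s \<equiv> \<lambda>n i. 1 / (sigma_fbm H (Suc p) * sqrt (real n) * sqrt (t (Suc i) - t i))"
  shows "\<exists>C\<ge>0. \<forall>n\<ge>1. \<forall>i<d. \<forall>j<d.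
    \<bar>s n i * s n j * fact (Suc p) * (\<Sum>k\<in>{a n i..<a n (Suc i)}. \<Sum>l\<in>{a n j..<a n (Suc j)}. rho_fbm H (real k - real l) ^ Suc p)
       - (if i = j then 1 else 0)\<bar> \<le> C * real n powr rate_exponent H (Suc p)"
proof -
  define r where "r = rate_exponent H (Suc p)"
  define \<kappa> where "\<kappa> = 1 + r"
  define S where "S = corr_sum H (Suc p)"
  note re = rate_exponent_mean[OF H p Hq, folded r_def]
  have q2: "Suc p \<ge> 2" using p by simp
  have S: "S \<ge> 1/2" unfolding S_def by (rule corr_sum_ge[OF H q2 re(3)])
  have sig: "(sigma_fbm H (Suc p))\<^sup>2 = fact (Suc p) * S"
    unfolding sigma_fbm_eq[OF H q2 re(3)] S_def[symmetric] using S by (simp del: fact_Suc)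
  obtain C where C: "C \<ge> 0" and diag: "\<And>a b. a \<le> b \<Longrightarrow>
      \<bar>(\<Sum>k\<in>{a..<b}. \<Sum>l\<in>{a..<b}. rho_fbm H (real k - real l) ^ Suc p) - real (b - a) * S\<bar> \<le> C * real b powr \<kappa>"
    and off: "\<And>a b a' b'. a \<le> b \<Longrightarrow> b \<le> a' \<Longrightarrow>
      \<bar>\<Sum>k\<in>{a..<b}. \<Sum>l\<in>{a'..<b'}. rho_fbm H (real k - real l) ^ Suc p\<bar> \<le> C * real b powr \<kappa>"
    using mean_estimates[OF H q2, of \<kappa>] re unfolding \<kappa>_def S_def by blast
  define T where "T = t d"
  have tm: "t i \<le> t j" if "i \<le> j" "j \<le> d" for i j by (rule increasing_times[OF t0 t that])
  have T0: "T \<ge> 0" using tm[of 0 d] t0 by (simp add: T_def)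
  have mono: "a n i \<le> a n j" if "i \<le> j" "j \<le> d" for n i j
    unfolding a_def using tm[OF that] by (intro nat_mono floor_mono mult_left_mono) auto
  have an: "C * real (a n i) powr \<kappa> \<le> C * T powr \<kappa> * real n powr \<kappa>" if "i \<le> d" for n i
  proof -
    have "real (a n i) \<le> real n * t i" unfolding a_def using tm[of 0 i] t0 that by simp
    also have "\<dots> \<le> real n * T" unfolding T_def using tm[OF that] by (intro mult_left_mono) auto
    finally have "real (a n i) powr \<kappa> \<le> (real n * T) powr \<kappa>" using re(1) by (intro powr_mono2) (auto simp: \<kappa>_def)
    then have "C * real (a n i) powr \<kappa> \<le> C * (real n * T) powr \<kappa>" using C by (rule mult_left_mono)
    then show ?thesis using T0 by (simp add: powr_mult mult_ac)
  qed
  let ?S = "\<lambda>n i j. \<Sum>k\<in>{a n i..<a n (Suc i)}. \<Sum>l\<in>{a n j..<a n (Suc j)}. rho_fbm H (real k - real l) ^ Suc p"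
  have sym: "?S n i j = ?S n j i" for n i j
  proof -
    have "?S n i j = (\<Sum>l\<in>{a n j..<a n (Suc j)}. \<Sum>k\<in>{a n i..<a n (Suc i)}. rho_fbm H (real k - real l) ^ Suc p)"
      by (rule sum.swap)
    also have "\<dots> = ?S n j i"
    proof (intro sum.cong refl)
      fix k l show "rho_fbm H (real k - real l) ^ Suc p = rho_fbm H (real l - real k) ^ Suc p"
        using rho_fbm_minus[of H "real k - real l"] by simp
    qed
    finally show ?thesis .
  qed
  \<comment> \<open>The first summand is the block estimate, all indices being at most
    \<open>n * T\<close>. The second pays for the floors, which change a block length by at most
    \<open>1\<close> and the sum by at most \<open>S \<le> S * n^\<kappa>\<close>.\<close>
  define E where "E = C * T powr \<kappa> + S"
  have E0: "E \<ge> 0" using C S by (simp add: E_def)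
  have ss: "s n i * s n j * fact (Suc p) = 1 / (S * real n * (sqrt (t (Suc i) - t i) * sqrt (t (Suc j) - t j)))"
    if "n \<ge> 1" for n i j
  proof -
    have "s n i * s n j = 1 / ((sigma_fbm H (Suc p))\<^sup>2 * (sqrt (real n) * sqrt (real n)) * (sqrt (t (Suc i) - t i) * sqrt (t (Suc j) - t j)))"
      by (simp add: s_def power2_eq_square)
    also have "\<dots> = 1 / (fact (Suc p) * (S * real n * (sqrt (t (Suc i) - t i) * sqrt (t (Suc j) - t j))))"
      unfolding sig by (simp add: mult.assoc del: fact_Suc)
    finally show ?thesis by (simp del: fact_Suc)
  qed
  have dd: "\<delta> \<le> sqrt (t (Suc i) - t i) * sqrt (t (Suc j) - t j)" if "i < d" "j < d" for i j
  proof -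
    have "sqrt \<delta> * sqrt \<delta> \<le> sqrt (t (Suc i) - t i) * sqrt (t (Suc j) - t j)"
      using \<delta>(1) \<delta>(2)[OF that(1)] \<delta>(2)[OF that(2)] by (intro mult_mono real_sqrt_le_mono) auto
    then show ?thesis using \<delta>(1) by simp
  qed
  have fin: "\<bar>x\<bar> / (S * real n * D) \<le> E / (S * \<delta>) * real n powr r" if x: "\<bar>x\<bar> \<le> E * real n powr \<kappa>" and n: "n \<ge> 1" and D: "\<delta> \<le> D"
    for x D n
  proof -
    have "\<bar>x\<bar> / (S * real n * D) \<le> E * real n powr \<kappa> / (S * real n * \<delta>)"
      using x n D \<delta>(1) S E0 by (intro frac_le mult_left_mono) auto
    also have "\<dots> = E / (S * \<delta>) * (real n powr \<kappa> / real n)" by simp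
    also have "real n powr \<kappa> / real n = real n powr r" using n by (simp add: \<kappa>_def powr_add)
    finally show ?thesis .
  qed
  have np1: "1 \<le> real n powr \<kappa>" if "n \<ge> 1" for n
    using that re(1) by (intro ge_one_powr_ge_zero) (auto simp: \<kappa>_def)
  have gen: "\<bar>1 / Z * x\<bar> = \<bar>x\<bar> / Z" if "Z > 0" for x Z :: real
    using that by (simp add: abs_mult)
  have offb: "\<bar>s n i * s n j * fact (Suc p) * ?S n i j\<bar> \<le> E / (S * \<delta>) * real n powr r" if n: "n \<ge> 1" and ij: "i < j" "j < d" for n i j
  proof -
    have "\<bar>?S n i j\<bar> \<le> C * real (a n (Suc i)) powr \<kappa>"
      using ij by (intro off mono) auto
    also have "\<dots> \<le> C * T powr \<kappa> * real n powr \<kappa>" using ij by (intro an) auto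
    also have "\<dots> \<le> E * real n powr \<kappa>" using S by (intro mult_right_mono) (auto simp: E_def)
    finally have "\<bar>?S n i j\<bar> / (S * real n * (sqrt (t (Suc i) - t i) * sqrt (t (Suc j) - t j))) \<le> E / (S * \<delta>) * real n powr r"
      using ij by (intro fin n dd) auto
    moreover have "sqrt (t (Suc i) - t i) * sqrt (t (Suc j) - t j) > 0" using dd[of i j] ij \<delta>(1) by simp
    then have "S * real n * (sqrt (t (Suc i) - t i) * sqrt (t (Suc j) - t j)) > 0"
      using S n by (intro mult_pos_pos[of "S * real n"]) simp_all
    then have "\<bar>1 / (S * real n * (sqrt (t (Suc i) - t i) * sqrt (t (Suc j) - t j))) * ?S n i j\<bar> =
        \<bar>?S n i j\<bar> / (S * real n * (sqrt (t (Suc i) - t i) * sqrt (t (Suc j) - t j)))"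
      by (rule gen)
    ultimately show ?thesis unfolding ss[OF n] by (simp only:)
  qed
  have main: "\<bar>s n i * s n j * fact (Suc p) * ?S n i j - (if i = j then 1 else 0)\<bar> \<le> E / (S * \<delta>) * real n powr r"
    if n: "n \<ge> 1" and ij: "i < d" "j < d" for n i j
  proof -
    consider "i < j" | "j < i" | "i = j" by linarith
    then show ?thesis
    proof cases
      case 1
      then show ?thesis using offb[OF n 1 ij(2)] by simp
    next
      case 2
      have eq: "s n i * s n j * fact (Suc p) * ?S n i j = s n j * s n i * fact (Suc p) * ?S n j i"
        by (simp only: sym[of n i j] mult.commute[of "s n i" "s n j"])
      show ?thesis using offb[OF n 2 ij(1)] 2 unfolding eq by simp
    next
      case 3
      define \<Delta> where "\<Delta> = t (Suc i) - t i"
      have D: "\<Delta> \<ge> \<delta>" using \<delta>(2)[OF ij(1)] by (simp add: \<Delta>_def)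
      have sq: "sqrt \<Delta> * sqrt \<Delta> = \<Delta>" using D \<delta>(1) by simp
      let ?m = "real (a n (Suc i) - a n i)"
      have "\<bar>?S n i i - ?m * S\<bar> \<le> C * real (a n (Suc i)) powr \<kappa>"
        using ij by (intro diag mono) auto
      also have "\<dots> \<le> C * T powr \<kappa> * real n powr \<kappa>" using ij by (intro an) auto
      finally have 1: "\<bar>?S n i i - ?m * S\<bar> \<le> C * T powr \<kappa> * real n powr \<kappa>" .
      have "\<bar>?m - (real n * t (Suc i) - real n * t i)\<bar> \<le> 1"
        unfolding a_def using tm[of 0 i] tm[of i "Suc i"] t0 ij by (intro floor_count_diff mult_left_mono) auto
      then have "\<bar>?m - real n * \<Delta>\<bar> * S \<le> 1 * S" using S by (intro mult_right_mono) (auto simp: \<Delta>_def right_diff_distrib)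
      also have "1 * S \<le> S * real n powr \<kappa>" using np1[OF n] S by simp
      finally have 2: "\<bar>(?m - real n * \<Delta>) * S\<bar> \<le> S * real n powr \<kappa>" using S by (simp add: abs_mult)
      have "?S n i i - real n * \<Delta> * S = (?S n i i - ?m * S) + (?m - real n * \<Delta>) * S" by (simp add: left_diff_distrib)
      then have "\<bar>?S n i i - real n * \<Delta> * S\<bar> \<le> E * real n powr \<kappa>"
        using 1 2 unfolding E_def distrib_right by linarith
      then have "\<bar>?S n i i - real n * \<Delta> * S\<bar> / (S * real n * \<Delta>) \<le> E / (S * \<delta>) * real n powr r"
        by (intro fin n D)
      moreover have "s n i * s n i * fact (Suc p) * ?S n i i - 1 = (?S n i i - real n * \<Delta> * S) / (S * real n * \<Delta>)"
        unfolding ss[OF n] \<Delta>_def[symmetric] sq using S n D \<delta>(1) by (simp add: field_simps)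
      moreover have "\<bar>S * real n * \<Delta>\<bar> = S * real n * \<Delta>" using S D \<delta>(1) by simp
      ultimately show ?thesis using 3 by (simp add: abs_divide)
    qed
  qed
  show ?thesis
    unfolding r_def[symmetric] using main E0 S \<delta>(1) by (intro exI[of _ "E / (S * \<delta>)"]) auto
qed

theorem theorem4:
  fixes H :: real and q d :: nat and t :: "nat \<Rightarrow> real"
  assumes "0 < H" and "H < 1" and "q \<ge> 2" and "H < 1 - 1 / (2 * real q)"
    and "d \<ge> 1" and "t 0 = 0" and "\<forall>i<d. t i < t (Suc i)"
  shows "\<exists>c::real. \<forall>(M::'a measure) B. is_fbm M H B \<longrightarrow>
           (\<forall>n::nat. n \<ge> 1 \<longrightarrow>
              dW_std M d (\<lambda>\<omega>. restrict (\<lambda>i. (S_fbm H q B n (t (Suc i)) \<omega> - S_fbm H q B n (t i) \<omega>)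
                                             / sqrt (t (Suc i) - t i)) {..<d})
              \<le> ereal (c * rate_fbm H q n))"
proof -
  obtain p where q: "q = Suc p" and p: "p \<ge> 1" using assms(3) by (cases q) auto
  note Hq = assms(4)[unfolded q]
  define r where "r = rate_exponent H (Suc p)"
  note re = rate_exponent_mean[OF assms(1,2) p Hq, folded r_def]
  obtain \<delta> where \<delta>: "\<delta> > 0" "\<And>i. i < d \<Longrightarrow> \<delta> \<le> t (Suc i) - t i"
  proof
    let ?D = "(\<lambda>i. t (Suc i) - t i) ` {..<d}"
    have D: "finite ?D" "?D \<noteq> {}" using assms(5) by (auto simp: lessThan_empty_iff)
    show "Min ?D > 0" using D assms(7) by simp
    show "Min ?D \<le> t (Suc i) - t i" if "i < d" for i using D that by (intro Min_le) auto
  qed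
  define a where "a = (\<lambda>n i. nat \<lfloor>real n * t i\<rfloor>)"
  define s where "s = (\<lambda>n i. 1 / (sigma_fbm H (Suc p) * sqrt (real n) * sqrt (t (Suc i) - t i)))"
  define I where "I = (\<lambda>n i. {a n i..<a n (Suc i)})"
  have tm: "t i \<le> t j" if "i \<le> j" "j \<le> d" for i j by (rule increasing_times[OF assms(6,7) that])
  have mono: "a n i \<le> a n j" if "i \<le> j" "j \<le> d" for n i j
    unfolding a_def using tm[OF that] by (intro nat_mono floor_mono mult_left_mono) auto
  obtain C1 where C1: "C1 \<ge> 0" "\<And>n i j. n \<ge> 1 \<Longrightarrow> i < d \<Longrightarrow> j < d \<Longrightarrow>
    \<bar>s n i * s n j * fact (Suc p) * (\<Sum>k\<in>I n i. \<Sum>l\<in>I n j. rho_fbm H (real k - real l) ^ Suc p)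
       - (if i = j then 1 else 0)\<bar> \<le> C1 * real n powr r"
    using increments_covariance_estimate[OF assms(1,2) p Hq assms(6,7) \<delta>] unfolding s_def I_def a_def r_def by blast
  obtain C2 where C2: "C2 \<ge> 0" "\<And>N. real N * abs_row_bound H 2 N * (abs_row_bound H p N)\<^sup>2 \<le> C2 * real N powr (2 + 2 * r)"
    using cycle_estimate[OF assms(1,2) p Hq] unfolding r_def by blast
  obtain K where K: "K \<ge> 0"
    "\<And>z. \<bar>z 0 * z 5 * (wick p p p p z - fact p * z 0 ^ p * (fact p * z 5 ^ p))\<bar> \<le> K * cycle_bound p z"
    using wick_covariance_bound[of p] by blast
  define \<sigma> where "\<sigma> = sigma_fbm H (Suc p)"
  have \<sigma>: "\<sigma> > 0"
    using corr_sum_ge[OF assms(1,2) _ re(3)] p unfolding \<sigma>_def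
    by (subst sigma_fbm_eq[OF assms(1,2) _ re(3)]) (auto simp del: fact_Suc intro!: mult_pos_pos)
  \<comment> \<open>Bounds the variance of a kernel entry by \<open>L * n^(2r)\<close>: the product
    \<open>s n i * s n j\<close> is at most \<open>1 / (\<sigma>^2 n \<delta>)\<close>, and
    \<open>N \<le> n * t d\<close> gives \<open>N^(2+2r)\<close> a factor \<open>n^2\<close> that
    cancels the \<open>n^(-2)\<close>. Everything entering \<open>c\<close> is fixed before
    \<open>M\<close>, \<open>B\<close> and \<open>n\<close>.\<close>
  define L where "L = (real (Suc p))\<^sup>2 / (\<sigma> ^ 4 * \<delta>\<^sup>2) * (K * (4 * (C2 * t d powr (2 + 2 * r))))"
  have L: "L \<ge> 0" using K(1) C2(1) by (simp add: L_def)
  define c where "c = pi / 2 * ((real d)\<^sup>2 * (C1 + sqrt L))"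
  show ?thesis
  proof (intro exI[of _ c] allI impI)
    fix M :: "'a measure" and B n
    assume B: "is_fbm M H B" and n: "n \<ge> (1::nat)"
    define N where "N = a n d"
    interpret gaussian_family M N "\<lambda>k \<omega>. B (real k + 1) \<omega> - B (real k) \<omega>" "\<lambda>k l. rho_fbm H (real k - real l)"
      by (rule fbm_increments_gaussian[OF B])
    have sub: "I n i \<subseteq> {..<N}" if "i < d" for i
      using mono[of "Suc i" d n] that unfolding I_def N_def by auto
    have Nn: "real N powr (2 + 2 * r) \<le> t d powr (2 + 2 * r) * (real n)\<^sup>2 * (real n powr r)\<^sup>2"
    proof -
      have "real N \<le> real n * t d" unfolding N_def a_def using tm[of 0 d] assms(6) by simp
      then have "real N powr (2 + 2 * r) \<le> (real n * t d) powr (2 + 2 * r)" using re(4) by (intro powr_mono2) auto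
      also have "\<dots> = t d powr (2 + 2 * r) * real n powr (2 + 2 * r)"
        using tm[of 0 d] assms(6) by (simp add: powr_mult mult.commute)
      also have "real n powr (2 + 2 * r) = (real n)\<^sup>2 * (real n powr r)\<^sup>2"
        using n by (simp add: powr_add powr_power mult.commute)
      finally show ?thesis by (simp only: mult.assoc)
    qed
    have E2: "(s n i * s n j * real (Suc p))\<^sup>2 * (K * (4 * (real N * abs_row_bound H 2 N * (abs_row_bound H p N)\<^sup>2)))
        \<le> (sqrt L * real n powr r)\<^sup>2" if ij: "i < d" "j < d" for i j
    proof -
      have di: "\<delta> \<le> t (Suc i) - t i" "\<delta> \<le> t (Suc j) - t j" using \<delta>(2) ij by auto
      have "(s n i * s n j * real (Suc p))\<^sup>2 = (real (Suc p))\<^sup>2 / (\<sigma> ^ 4 * (real n)\<^sup>2 * ((t (Suc i) - t i) * (t (Suc j) - t j)))"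
      proof -
        have sq: "(s n i)\<^sup>2 = 1 / (\<sigma>\<^sup>2 * real n * (t (Suc i) - t i))" "(s n j)\<^sup>2 = 1 / (\<sigma>\<^sup>2 * real n * (t (Suc j) - t j))"
          using di \<delta>(1) by (simp_all add: s_def \<sigma>_def power_mult_distrib power_divide)
        show ?thesis unfolding power_mult_distrib sq
          by (simp add: power2_eq_square power4_eq_xxxx mult_ac)
      qed
      also have "\<dots> \<le> (real (Suc p))\<^sup>2 / (\<sigma> ^ 4 * (real n)\<^sup>2 * \<delta>\<^sup>2)"
      proof -
        have "\<delta> * \<delta> \<le> (t (Suc i) - t i) * (t (Suc j) - t j)" using di \<delta>(1) by (intro mult_mono) auto
        then show ?thesis using \<sigma> n \<delta>(1) by (intro frac_le mult_left_mono) (auto simp: power2_eq_square)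
      qed
      finally have 1: "(s n i * s n j * real (Suc p))\<^sup>2 \<le> (real (Suc p))\<^sup>2 / (\<sigma> ^ 4 * (real n)\<^sup>2 * \<delta>\<^sup>2)" .
      have "real N * abs_row_bound H 2 N * (abs_row_bound H p N)\<^sup>2 \<le> C2 * (t d powr (2 + 2 * r) * (real n)\<^sup>2 * (real n powr r)\<^sup>2)"
        using C2(2)[of N] mult_left_mono[OF Nn C2(1)] by linarith
      then have 2: "K * (4 * (real N * abs_row_bound H 2 N * (abs_row_bound H p N)\<^sup>2)) \<le>
          K * (4 * (C2 * (t d powr (2 + 2 * r) * (real n)\<^sup>2 * (real n powr r)\<^sup>2)))"
        using K(1) by (intro mult_left_mono) auto
      have "(s n i * s n j * real (Suc p))\<^sup>2 * (K * (4 * (real N * abs_row_bound H 2 N * (abs_row_bound H p N)\<^sup>2)))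
        \<le> (real (Suc p))\<^sup>2 / (\<sigma> ^ 4 * (real n)\<^sup>2 * \<delta>\<^sup>2) * (K * (4 * (C2 * (t d powr (2 + 2 * r) * (real n)\<^sup>2 * (real n powr r)\<^sup>2))))"
        using K(1) abs_row_bound_nonneg \<sigma> by (intro mult_mono[OF 1 2]) auto
      also have "\<dots> = L * (real n powr r)\<^sup>2" using n \<sigma> \<delta>(1) by (simp add: L_def field_simps del: of_nat_Suc)
      finally show ?thesis using L by (simp add: power_mult_distrib)
    qed
    have vec_eq: "restrict (\<lambda>i. (S_fbm H q B n (t (Suc i)) \<omega> - S_fbm H q B n (t i) \<omega>) / sqrt (t (Suc i) - t i)) {..<d}
       = (\<lambda>i\<in>{..<d}. chaos p (I n) (s n) i \<omega>)" for \<omega>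
    proof (rule restrict_ext)
      fix i assume "i \<in> {..<d}"
      then have m: "a n i \<le> a n (Suc i)" by (intro mono) auto
      let ?h = "\<lambda>k. hermite (Suc p) (B (real k + 1) \<omega> - B (real k) \<omega>)"
      have "(\<Sum>k<a n (Suc i). ?h k) - (\<Sum>k<a n i. ?h k) = (\<Sum>k\<in>I n i. ?h k)"
        unfolding I_def lessThan_atLeast0 by (rule sum_diff_nat_ivl) (use m in auto)
      then have "S_fbm H q B n (t (Suc i)) \<omega> - S_fbm H q B n (t i) \<omega> = 1 / (\<sigma> * sqrt (real n)) * (\<Sum>k\<in>I n i. ?h k)"
        unfolding S_fbm_def q \<sigma>_def a_def by (simp only: right_diff_distrib[symmetric])
      then show "(S_fbm H q B n (t (Suc i)) \<omega> - S_fbm H q B n (t i) \<omega>) / sqrt (t (Suc i) - t i) = chaos p (I n) (s n) i \<omega>"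
        by (simp add: chaos_def s_def \<sigma>_def)
    qed
    have "\<bar>(\<integral>\<omega>. g (\<lambda>i\<in>{..<d}. chaos p (I n) (s n) i \<omega>) \<partial>M) - (\<integral>z. g z \<partial>std_gauss d)\<bar> \<le> c * rate_fbm H q n"
      if g: "lip1 d g" for g
    proof -
      have A: "(\<Sum>b<N. (rho_fbm H (real a - real b))\<^sup>2) \<le> abs_row_bound H 2 N" if "a < N" for a
        using abs_row_sum_le[OF that, of H 2] by simp
      have "\<bar>(\<integral>\<omega>. g (\<lambda>i\<in>{..<d}. chaos p (I n) (s n) i \<omega>) \<partial>M) - (\<integral>z. g z \<partial>std_gauss d)\<bar>
          \<le> pi / 2 * ((real d)\<^sup>2 * (C1 * real n powr r + sqrt L * real n powr r))"
      proof (rule chaos_distance[OF sub A abs_row_sum_le K])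
        show "0 \<le> sqrt L * real n powr r" using L by simp
      qed (use C1(2)[OF n] E2 g in auto)
      also have "\<dots> = c * rate_fbm H q n"
        unfolding c_def q rate_fbm_eq r_def[symmetric] by (simp add: algebra_simps)
      finally show ?thesis .
    qed
    then show "dW_std M d (\<lambda>\<omega>. restrict (\<lambda>i. (S_fbm H q B n (t (Suc i)) \<omega> - S_fbm H q B n (t i) \<omega>)
                                             / sqrt (t (Suc i) - t i)) {..<d})
              \<le> ereal (c * rate_fbm H q n)"
      unfolding dW_std_def vec_eq by (intro SUP_least) auto
  qed
qed

end
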